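(* Let $T_0, T_1$ be recursively enumerable theories extending $\mathbf{I\Sigma_1}$, and let $\tau_0(v)$, $\tau_1(v)$ be $\Sigma_1$ definitions of $T_0$ and $T_1$, respectively. Suppose $\mathrm{Th}(\mathbf{PA}) \subseteq \mathrm{Th}(T_0)$. If $\mathrm{QPL}_{\tau_0}(T_0) \subseteq \mathrm{QPL}_{\tau_1}(T_1)$, then for every $\mathcal{L}_A$-formula $\varphi(\vec{y})$, \[ T_1 \vdash \forall \vec{y}\,\bigl(\mathrm{Pr}_{\tau_0}(\ulcorner \mathrm{Con}_{\tau_0} \to \varphi(\vec{\dot{y}})\urcorner) \leftrightarrow \mathrm{Pr}_{\tau_1}(\ulcorner \mathrm{Con}_{\tau_1} \to \varphi(\vec{\dot{y}})\urcorner)\bigr). \]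
   Context: $\mathcal{L}_A=\{0,S,+,\times,<,=\}$; a theory is a set of $\mathcal{L}_A$-sentences and $\mathrm{Th}(T)$ is the set of sentences provable in $T$. $\mathbf{PA}$ is Peano arithmetic; $\mathbf{I\Sigma_1}$ is $\mathbf{PA}$ with induction restricted to $\Sigma_1$ formulas. A formula $\tau(v)$ is a definition of $T$ if for every $n$, $\mathbb{N}\models\tau(\overline{n})$ iff $n$ is the Gödel number of an axiom of $T$. For a $\Sigma_1$ definition $\tau$, $\mathrm{Pr}_\tau(x)$ is the standard $\Sigma_1$ provability predicate for the theory defined by $\tau$; $\mathrm{Con}_\tau$ is $\neg\mathrm{Pr}_\tau(\ulcorner 0=\overline{1}\urcorner)$. $\ulcorner\varphi(\vec{\dot{y}})\urcorner$ is the primitive recursive term giving the Gödel number of $\varphi(\overline{k_1},\dots,\overline{k_n})$ from the values of $\vec y$. Quantified modal language: first-order logic without function or constant symbols, plus $\Box,\Diamond$. An arithmetical interpretation $f$ maps each atomic modal formula $P(x_1,\dots,x_n)$ to an $\mathcal{L}_A$-formula $\varphi(x_1,\dots,x_n)$ with the same free variables, uniformly under renaming of variables. It extends to $f_\tau$: $f_\tau(\bot)$ is $0=\overline 1$; $f_\tau$ commutes with connectives and quantifiers; $f_\tau(\Box A(x_1,\dots,x_n))$ is $\mathrm{Pr}_\tau(\ulcorner f_\tau(A(\dot x_1,\dots,\dot x_n))\urcorner)$. $\mathrm{QPL}_\tau(T)$ is the set of modal sentences $A$ with $T\vdash f_\tau(A)$ for all arithmetical interpretations $f$. *)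

theory Defs
  imports Main
begin

section \<open>Formulas of arithmetic\<close>

text \<open>
  Terms and formulas over \<open>{0, S, +, \<times>, <, =}\<close> with de Bruijn indices: \<open>V i\<close> below \<open>d\<close> quantifiers
  refers to the \<open>i\<close>-th enclosing quantifier if \<open>i < d\<close>, and to the free variable \<open>i - d\<close>
  otherwise. Formulas are thus identified up to renaming of bound variables.
\<close>

datatype tm = V nat | Zero | Succ tm | Add tm tm | Mul tm tm

datatype fm =
    Eq tm tm (infix "\<^bold>=" 50)
  | Less tm tm (infix "\<^bold><" 50)
  | Neg fm ("\<^bold>\<not> _" [40] 40)
  | Imp fm fm (infixr "\<^bold>\<longrightarrow>" 25)
  | Forall fm ("\<^bold>\<forall> _" [10] 10)

abbreviation Or (infixr "\<^bold>\<or>" 30) where "p \<^bold>\<or> q \<equiv> \<^bold>\<not> p \<^bold>\<longrightarrow> q"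
abbreviation And (infixr "\<^bold>\<and>" 35) where "p \<^bold>\<and> q \<equiv> \<^bold>\<not> (p \<^bold>\<longrightarrow> \<^bold>\<not> q)"
abbreviation Iff (infixr "\<^bold>\<longleftrightarrow>" 25) where "p \<^bold>\<longleftrightarrow> q \<equiv> (p \<^bold>\<longrightarrow> q) \<^bold>\<and> (q \<^bold>\<longrightarrow> p)"
abbreviation Exists ("\<^bold>\<exists> _" [10] 10) where "\<^bold>\<exists> p \<equiv> \<^bold>\<not> (\<^bold>\<forall> \<^bold>\<not> p)"

primrec num :: "nat \<Rightarrow> tm" where
  "num 0 = Zero"
| "num (Suc n) = Succ (num n)"

primrec freest :: "tm \<Rightarrow> nat set" where
  "freest (V i) = {i}"
| "freest Zero = {}"
| "freest (Succ t) = freest t"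
| "freest (Add s t) = freest s \<union> freest t"
| "freest (Mul s t) = freest s \<union> freest t"

primrec frees :: "fm \<Rightarrow> nat set" where
  "frees (s \<^bold>= t) = freest s \<union> freest t"
| "frees (s \<^bold>< t) = freest s \<union> freest t"
| "frees (\<^bold>\<not> p) = frees p"
| "frees (p \<^bold>\<longrightarrow> q) = frees p \<union> frees q"
| "frees (\<^bold>\<forall> p) = {i. Suc i \<in> frees p}"

abbreviation sentence :: "fm \<Rightarrow> bool" where "sentence p \<equiv> frees p = {}"

primrec substt :: "(nat \<Rightarrow> tm) \<Rightarrow> tm \<Rightarrow> tm" where
  "substt \<sigma> (V i) = \<sigma> i"
| "substt \<sigma> Zero = Zero"
| "substt \<sigma> (Succ t) = Succ (substt \<sigma> t)"
| "substt \<sigma> (Add s t) = Add (substt \<sigma> s) (substt \<sigma> t)"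
| "substt \<sigma> (Mul s t) = Mul (substt \<sigma> s) (substt \<sigma> t)"

definition lift :: "nat \<Rightarrow> tm \<Rightarrow> tm" where
  "lift d = substt (\<lambda>i. V (i + d))"

definition up :: "(nat \<Rightarrow> tm) \<Rightarrow> nat \<Rightarrow> tm" where
  "up \<sigma> = case_nat (V 0) (\<lambda>i. lift 1 (\<sigma> i))"

text \<open>Simultaneous capture-avoiding substitution.\<close>

primrec subst :: "(nat \<Rightarrow> tm) \<Rightarrow> fm \<Rightarrow> fm" where
  "subst \<sigma> (s \<^bold>= t) = (substt \<sigma> s \<^bold>= substt \<sigma> t)"
| "subst \<sigma> (s \<^bold>< t) = (substt \<sigma> s \<^bold>< substt \<sigma> t)"
| "subst \<sigma> (\<^bold>\<not> p) = (\<^bold>\<not> subst \<sigma> p)"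
| "subst \<sigma> (p \<^bold>\<longrightarrow> q) = (subst \<sigma> p \<^bold>\<longrightarrow> subst \<sigma> q)"
| "subst \<sigma> (\<^bold>\<forall> p) = (\<^bold>\<forall> subst (up \<sigma>) p)"

text \<open>\<open>inst p t\<close> is the body \<open>p\<close> of a quantifier with \<open>t\<close> put for the quantified variable.\<close>

definition inst :: "fm \<Rightarrow> tm \<Rightarrow> fm" where
  "inst p t = subst (case_nat t V) p"

definition liftf :: "fm \<Rightarrow> fm" where
  "liftf = subst (\<lambda>i. V (Suc i))"

definition bound :: "fm \<Rightarrow> nat" where
  "bound p = (LEAST n. frees p \<subseteq> {..<n})"

definition closure :: "fm \<Rightarrow> fm" where
  "closure p = (Forall ^^ bound p) p"

primrec evalt :: "(nat \<Rightarrow> nat) \<Rightarrow> tm \<Rightarrow> nat" where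
  "evalt e (V i) = e i"
| "evalt e Zero = 0"
| "evalt e (Succ t) = Suc (evalt e t)"
| "evalt e (Add s t) = evalt e s + evalt e t"
| "evalt e (Mul s t) = evalt e s * evalt e t"

text \<open>Satisfaction in the standard model.\<close>

primrec sat :: "(nat \<Rightarrow> nat) \<Rightarrow> fm \<Rightarrow> bool" where
  "sat e (s \<^bold>= t) \<longleftrightarrow> evalt e s = evalt e t"
| "sat e (s \<^bold>< t) \<longleftrightarrow> evalt e s < evalt e t"
| "sat e (\<^bold>\<not> p) \<longleftrightarrow> \<not> sat e p"
| "sat e (p \<^bold>\<longrightarrow> q) \<longleftrightarrow> (sat e p \<longrightarrow> sat e q)"
| "sat e (\<^bold>\<forall> p) \<longleftrightarrow> (\<forall>n. sat (case_nat n e) p)"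

inductive Delta0 :: "fm \<Rightarrow> bool" where
  "Delta0 (s \<^bold>= t)"
| "Delta0 (s \<^bold>< t)"
| "Delta0 p \<Longrightarrow> Delta0 (\<^bold>\<not> p)"
| "Delta0 p \<Longrightarrow> Delta0 q \<Longrightarrow> Delta0 (p \<^bold>\<longrightarrow> q)"
| "Delta0 p \<Longrightarrow> Delta0 (\<^bold>\<forall> (V 0 \<^bold>< lift 1 t \<^bold>\<longrightarrow> p))"
| "Delta0 p \<Longrightarrow> Delta0 (\<^bold>\<exists> (V 0 \<^bold>< lift 1 t \<^bold>\<and> p))"

inductive Sigma1 :: "fm \<Rightarrow> bool" where
  "Delta0 p \<Longrightarrow> Sigma1 p"
| "Sigma1 p \<Longrightarrow> Sigma1 (\<^bold>\<exists> p)"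


section \<open>Provability and theories\<close>

text \<open>A Hilbert calculus for classical first-order logic with equality.\<close>

inductive logax :: "fm \<Rightarrow> bool" where
  "logax (p \<^bold>\<longrightarrow> q \<^bold>\<longrightarrow> p)"
| "logax ((p \<^bold>\<longrightarrow> q \<^bold>\<longrightarrow> r) \<^bold>\<longrightarrow> (p \<^bold>\<longrightarrow> q) \<^bold>\<longrightarrow> p \<^bold>\<longrightarrow> r)"
| "logax ((\<^bold>\<not> p \<^bold>\<longrightarrow> \<^bold>\<not> q) \<^bold>\<longrightarrow> q \<^bold>\<longrightarrow> p)"
| "logax ((\<^bold>\<forall> p) \<^bold>\<longrightarrow> inst p t)"
| "logax ((\<^bold>\<forall> p \<^bold>\<longrightarrow> q) \<^bold>\<longrightarrow> (\<^bold>\<forall> p) \<^bold>\<longrightarrow> (\<^bold>\<forall> q))"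
| "logax (p \<^bold>\<longrightarrow> (\<^bold>\<forall> liftf p))"
| "logax (t \<^bold>= t)"
| "logax (s \<^bold>= t \<^bold>\<longrightarrow> inst p s \<^bold>\<longrightarrow> inst p t)"

inductive proves :: "fm set \<Rightarrow> fm \<Rightarrow> bool" (infix "\<turnstile>" 50) for T where
  Ax: "p \<in> T \<Longrightarrow> T \<turnstile> p"
| Logic: "logax p \<Longrightarrow> T \<turnstile> p"
| MP: "T \<turnstile> (p \<^bold>\<longrightarrow> q) \<Longrightarrow> T \<turnstile> p \<Longrightarrow> T \<turnstile> q"
| Gen: "T \<turnstile> p \<Longrightarrow> T \<turnstile> (\<^bold>\<forall> p)"

definition Th :: "fm set \<Rightarrow> fm set" where
  "Th T = {p. sentence p \<and> T \<turnstile> p}"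

definition basic_axioms :: "fm set" where
  "basic_axioms = {
     \<^bold>\<forall> \<^bold>\<not> Succ (V 0) \<^bold>= Zero,
     \<^bold>\<forall> \<^bold>\<forall> Succ (V 1) \<^bold>= Succ (V 0) \<^bold>\<longrightarrow> V 1 \<^bold>= V 0,
     \<^bold>\<forall> Add (V 0) Zero \<^bold>= V 0,
     \<^bold>\<forall> \<^bold>\<forall> Add (V 1) (Succ (V 0)) \<^bold>= Succ (Add (V 1) (V 0)),
     \<^bold>\<forall> Mul (V 0) Zero \<^bold>= Zero,
     \<^bold>\<forall> \<^bold>\<forall> Mul (V 1) (Succ (V 0)) \<^bold>= Add (Mul (V 1) (V 0)) (V 1),
     \<^bold>\<forall> \<^bold>\<not> V 0 \<^bold>< Zero,
     \<^bold>\<forall> \<^bold>\<forall> V 1 \<^bold>< Succ (V 0) \<^bold>\<longleftrightarrow> V 1 \<^bold>< V 0 \<^bold>\<or> V 1 \<^bold>= V 0}"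

text \<open>Induction on the variable \<open>V 0\<close> of \<open>p\<close>; the other free variables are parameters.\<close>

definition ind_axiom :: "fm \<Rightarrow> fm" where
  "ind_axiom p = closure (inst p Zero \<^bold>\<longrightarrow>
     (\<^bold>\<forall> p \<^bold>\<longrightarrow> subst (case_nat (Succ (V 0)) (\<lambda>i. V (Suc i))) p) \<^bold>\<longrightarrow> (\<^bold>\<forall> p))"

definition PA :: "fm set" where
  "PA = basic_axioms \<union> range ind_axiom"

definition ISigma1 :: "fm set" where
  "ISigma1 = basic_axioms \<union> ind_axiom ` {p. Sigma1 p}"


section \<open>Goedel numbers\<close>

text \<open>
  The pairing \<open>(m, n) \<mapsto> (m + n)\<^sup>2 + m + 1\<close> is injective and is denoted by a term of the language, so
  that the code of a compound expression is given by a term in the codes of its parts.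
\<close>

definition pr :: "nat \<Rightarrow> nat \<Rightarrow> nat" where
  "pr m n = Suc ((m + n) * (m + n) + m)"

primrec gnt :: "tm \<Rightarrow> nat" where
  "gnt (V i) = pr 0 i"
| "gnt Zero = pr 1 0"
| "gnt (Succ t) = pr 2 (gnt t)"
| "gnt (Add s t) = pr 3 (pr (gnt s) (gnt t))"
| "gnt (Mul s t) = pr 4 (pr (gnt s) (gnt t))"

primrec gn :: "fm \<Rightarrow> nat" where
  "gn (s \<^bold>= t) = pr 5 (pr (gnt s) (gnt t))"
| "gn (s \<^bold>< t) = pr 6 (pr (gnt s) (gnt t))"
| "gn (\<^bold>\<not> p) = pr 7 (gn p)"
| "gn (p \<^bold>\<longrightarrow> q) = pr 8 (pr (gn p) (gn q))"
| "gn (\<^bold>\<forall> p) = pr 9 (gn p)"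

definition pairt :: "tm \<Rightarrow> tm \<Rightarrow> tm" ("\<langle>_, _\<rangle>") where
  "\<langle>s, t\<rangle> = Succ (Add (Mul (Add s t) (Add s t)) s)"

abbreviation "cV t \<equiv> \<langle>num 0, t\<rangle>"
abbreviation "cZero \<equiv> \<langle>num 1, Zero\<rangle>"
abbreviation "cSucc t \<equiv> \<langle>num 2, t\<rangle>"
abbreviation "cAdd s t \<equiv> \<langle>num 3, \<langle>s, t\<rangle>\<rangle>"
abbreviation "cMul s t \<equiv> \<langle>num 4, \<langle>s, t\<rangle>\<rangle>"
abbreviation "cEq s t \<equiv> \<langle>num 5, \<langle>s, t\<rangle>\<rangle>"
abbreviation "cLess s t \<equiv> \<langle>num 6, \<langle>s, t\<rangle>\<rangle>"
abbreviation "cNeg t \<equiv> \<langle>num 7, t\<rangle>"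
abbreviation "cImp s t \<equiv> \<langle>num 8, \<langle>s, t\<rangle>\<rangle>"
abbreviation "cAll t \<equiv> \<langle>num 9, t\<rangle>"

definition defines_theory :: "fm \<Rightarrow> fm set \<Rightarrow> bool" where
  "defines_theory \<tau> T \<longleftrightarrow> frees \<tau> \<subseteq> {0} \<and>
     (\<forall>n. sat (\<lambda>_. 0) (inst \<tau> (num n)) \<longleftrightarrow> n \<in> gn ` T)"


section \<open>Arithmetised syntax\<close>

text \<open>
  \<open>Beta a b i z\<close>: the remainder of \<open>a\<close> modulo \<open>1 + (i + 1) b\<close> is \<open>z\<close> (Goedel's beta function).
  In all formulas below, term arguments are terms of the ambient context and are lifted
  past the quantifiers that the formula introduces.
\<close>

definition Beta :: "tm \<Rightarrow> tm \<Rightarrow> tm \<Rightarrow> tm \<Rightarrow> fm" where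
  "Beta a b i z = (let m = Succ (Mul (Succ i) b) in
     z \<^bold>< m \<^bold>\<and> (\<^bold>\<exists> lift 1 a \<^bold>= Add (Mul (V 0) (lift 1 m)) (lift 1 z)))"

definition Listed :: "tm \<Rightarrow> tm \<Rightarrow> tm \<Rightarrow> tm \<Rightarrow> fm" where
  "Listed a b l x = (\<^bold>\<exists> V 0 \<^bold>< lift 1 l \<^bold>\<and> Beta (lift 1 a) (lift 1 b) (V 0) (lift 1 x))"

text \<open>
  \<open>Derivable R x\<close>: some finite sequence contains \<open>x\<close>, and each of its entries is obtained by \<open>R\<close> from
  earlier entries. In \<open>R E\<close> the entry in question is \<open>V 0\<close>, and \<open>E d v\<close>, used below \<open>d\<close> further
  quantifiers, says that \<open>v\<close> is an earlier entry. (The variables bound around \<open>R E\<close> are: \<open>V 0\<close> the entry,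
  \<open>V 1\<close> its index, \<open>V 2\<close> the length, \<open>V 3\<close> and \<open>V 4\<close> the beta function parameters.)
\<close>

definition Derivable :: "((nat \<Rightarrow> tm \<Rightarrow> fm) \<Rightarrow> fm) \<Rightarrow> tm \<Rightarrow> fm" where
  "Derivable R x = (\<^bold>\<exists> \<^bold>\<exists> \<^bold>\<exists> Listed (V 2) (V 1) (V 0) (lift 3 x) \<^bold>\<and>
     (\<^bold>\<forall> V 0 \<^bold>< V 1 \<^bold>\<longrightarrow> (\<^bold>\<exists> Beta (V 4) (V 3) (V 1) (V 0) \<^bold>\<and>
        R (\<lambda>d v. Listed (V (4 + d)) (V (3 + d)) (V (1 + d)) v))))"

text \<open>\<open>Num n z\<close>: \<open>z\<close> is the code of the numeral of \<open>n\<close>.\<close>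

definition Num :: "tm \<Rightarrow> tm \<Rightarrow> fm" where
  "Num n z = Derivable (\<lambda>E.
       V 0 \<^bold>= \<langle>Zero, cZero\<rangle>
     \<^bold>\<or> (\<^bold>\<exists> \<^bold>\<exists> E 2 \<langle>V 1, V 0\<rangle> \<^bold>\<and> V 2 \<^bold>= \<langle>Succ (V 1), cSucc (V 0)\<rangle>)) \<langle>n, z\<rangle>"

text \<open>
  \<open>Tm n u\<close>, \<open>Fm n u\<close>: \<open>u\<close> is the code of a term (formula) all of whose free variables are \<open>< n\<close>.
\<close>

definition Tm :: "tm \<Rightarrow> tm \<Rightarrow> fm" where
  "Tm n u = Derivable (\<lambda>E.
       (\<^bold>\<exists> \<^bold>\<exists> V 0 \<^bold>< V 1 \<^bold>\<and> V 2 \<^bold>= \<langle>V 1, cV (V 0)\<rangle>)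
     \<^bold>\<or> (\<^bold>\<exists> V 1 \<^bold>= \<langle>V 0, cZero\<rangle>)
     \<^bold>\<or> (\<^bold>\<exists> \<^bold>\<exists> E 2 \<langle>V 1, V 0\<rangle> \<^bold>\<and> V 2 \<^bold>= \<langle>V 1, cSucc (V 0)\<rangle>)
     \<^bold>\<or> (\<^bold>\<exists> \<^bold>\<exists> \<^bold>\<exists> E 3 \<langle>V 2, V 1\<rangle> \<^bold>\<and> E 3 \<langle>V 2, V 0\<rangle> \<^bold>\<and>
          (V 3 \<^bold>= \<langle>V 2, cAdd (V 1) (V 0)\<rangle> \<^bold>\<or> V 3 \<^bold>= \<langle>V 2, cMul (V 1) (V 0)\<rangle>))) \<langle>n, u\<rangle>"

definition Fm :: "tm \<Rightarrow> tm \<Rightarrow> fm" where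
  "Fm n u = Derivable (\<lambda>E.
       (\<^bold>\<exists> \<^bold>\<exists> \<^bold>\<exists> Tm (V 2) (V 1) \<^bold>\<and> Tm (V 2) (V 0) \<^bold>\<and>
          (V 3 \<^bold>= \<langle>V 2, cEq (V 1) (V 0)\<rangle> \<^bold>\<or> V 3 \<^bold>= \<langle>V 2, cLess (V 1) (V 0)\<rangle>))
     \<^bold>\<or> (\<^bold>\<exists> \<^bold>\<exists> E 2 \<langle>V 1, V 0\<rangle> \<^bold>\<and> V 2 \<^bold>= \<langle>V 1, cNeg (V 0)\<rangle>)
     \<^bold>\<or> (\<^bold>\<exists> \<^bold>\<exists> \<^bold>\<exists> E 3 \<langle>V 2, V 1\<rangle> \<^bold>\<and> E 3 \<langle>V 2, V 0\<rangle> \<^bold>\<and> V 3 \<^bold>= \<langle>V 2, cImp (V 1) (V 0)\<rangle>)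
     \<^bold>\<or> (\<^bold>\<exists> \<^bold>\<exists> E 2 \<langle>Succ (V 1), V 0\<rangle> \<^bold>\<and> V 2 \<^bold>= \<langle>V 1, cAll (V 0)\<rangle>)) \<langle>n, u\<rangle>"

definition Term :: "tm \<Rightarrow> fm" where
  "Term u = (\<^bold>\<exists> Tm (V 0) (lift 1 u))"

definition Form :: "tm \<Rightarrow> fm" where
  "Form u = (\<^bold>\<exists> Fm (V 0) (lift 1 u))"

abbreviation Sent :: "tm \<Rightarrow> fm" where
  "Sent u \<equiv> Fm Zero u"

text \<open>
  Lifting and substitution are derived as triples \<open>\<langle>k, \<langle>u, v\<rangle>\<rangle>\<close>, the operation with parameters \<open>k\<close> taking
  the term or formula \<open>u\<close> to \<open>v\<close>. \<open>Homo\<close> has the clauses in which the parameters do not matter.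
\<close>

definition Homo :: "(nat \<Rightarrow> tm \<Rightarrow> fm) \<Rightarrow> fm" where
  "Homo E = (
       (\<^bold>\<exists> V 1 \<^bold>= \<langle>V 0, \<langle>cZero, cZero\<rangle>\<rangle>)
     \<^bold>\<or> (\<^bold>\<exists> \<^bold>\<exists> \<^bold>\<exists> E 3 \<langle>V 2, \<langle>V 1, V 0\<rangle>\<rangle> \<^bold>\<and>
          (V 3 \<^bold>= \<langle>V 2, \<langle>cSucc (V 1), cSucc (V 0)\<rangle>\<rangle> \<^bold>\<or> V 3 \<^bold>= \<langle>V 2, \<langle>cNeg (V 1), cNeg (V 0)\<rangle>\<rangle>))
     \<^bold>\<or> (\<^bold>\<exists> \<^bold>\<exists> \<^bold>\<exists> \<^bold>\<exists> \<^bold>\<exists> E 5 \<langle>V 4, \<langle>V 3, V 2\<rangle>\<rangle> \<^bold>\<and> E 5 \<langle>V 4, \<langle>V 1, V 0\<rangle>\<rangle> \<^bold>\<and>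
          (  V 5 \<^bold>= \<langle>V 4, \<langle>cAdd (V 3) (V 1), cAdd (V 2) (V 0)\<rangle>\<rangle>
           \<^bold>\<or> V 5 \<^bold>= \<langle>V 4, \<langle>cMul (V 3) (V 1), cMul (V 2) (V 0)\<rangle>\<rangle>
           \<^bold>\<or> V 5 \<^bold>= \<langle>V 4, \<langle>cEq (V 3) (V 1), cEq (V 2) (V 0)\<rangle>\<rangle>
           \<^bold>\<or> V 5 \<^bold>= \<langle>V 4, \<langle>cLess (V 3) (V 1), cLess (V 2) (V 0)\<rangle>\<rangle>
           \<^bold>\<or> V 5 \<^bold>= \<langle>V 4, \<langle>cImp (V 3) (V 1), cImp (V 2) (V 0)\<rangle>\<rangle>)))"

text \<open>\<open>Lift k u v\<close>: increasing the free variables \<open>\<ge> k\<close> of \<open>u\<close> by one gives \<open>v\<close>.\<close>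

definition Lift :: "tm \<Rightarrow> tm \<Rightarrow> tm \<Rightarrow> fm" where
  "Lift k u v = Derivable (\<lambda>E.
       Homo E
     \<^bold>\<or> (\<^bold>\<exists> \<^bold>\<exists> V 0 \<^bold>< V 1 \<^bold>\<and> V 2 \<^bold>= \<langle>V 1, \<langle>cV (V 0), cV (V 0)\<rangle>\<rangle>)
     \<^bold>\<or> (\<^bold>\<exists> \<^bold>\<exists> \<^bold>\<not> V 0 \<^bold>< V 1 \<^bold>\<and> V 2 \<^bold>= \<langle>V 1, \<langle>cV (V 0), cV (Succ (V 0))\<rangle>\<rangle>)
     \<^bold>\<or> (\<^bold>\<exists> \<^bold>\<exists> \<^bold>\<exists> E 3 \<langle>Succ (V 2), \<langle>V 1, V 0\<rangle>\<rangle> \<^bold>\<and> V 3 \<^bold>= \<langle>V 2, \<langle>cAll (V 1), cAll (V 0)\<rangle>\<rangle>))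
     \<langle>k, \<langle>u, v\<rangle>\<rangle>"

text \<open>
  \<open>Sub k t u v\<close>: putting \<open>t\<close> for the free variable \<open>k\<close> of \<open>u\<close>, and decreasing the free variables \<open>> k\<close>
  by one, gives \<open>v\<close>.
\<close>

definition Sub :: "tm \<Rightarrow> tm \<Rightarrow> tm \<Rightarrow> tm \<Rightarrow> fm" where
  "Sub k t u v = Derivable (\<lambda>E.
       Homo E
     \<^bold>\<or> (\<^bold>\<exists> \<^bold>\<exists> \<^bold>\<exists> V 0 \<^bold>< V 2 \<^bold>\<and> V 3 \<^bold>= \<langle>\<langle>V 2, V 1\<rangle>, \<langle>cV (V 0), cV (V 0)\<rangle>\<rangle>)
     \<^bold>\<or> (\<^bold>\<exists> \<^bold>\<exists> V 2 \<^bold>= \<langle>\<langle>V 1, V 0\<rangle>, \<langle>cV (V 1), V 0\<rangle>\<rangle>)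
     \<^bold>\<or> (\<^bold>\<exists> \<^bold>\<exists> \<^bold>\<exists> \<^bold>\<not> V 0 \<^bold>< V 2 \<^bold>\<and> V 3 \<^bold>= \<langle>\<langle>V 2, V 1\<rangle>, \<langle>cV (Succ (V 0)), cV (V 0)\<rangle>\<rangle>)
     \<^bold>\<or> (\<^bold>\<exists> \<^bold>\<exists> \<^bold>\<exists> \<^bold>\<exists> \<^bold>\<exists> Lift Zero (V 3) (V 2) \<^bold>\<and> E 5 \<langle>\<langle>Succ (V 4), V 2\<rangle>, \<langle>V 1, V 0\<rangle>\<rangle> \<^bold>\<and>
          V 5 \<^bold>= \<langle>\<langle>V 4, V 3\<rangle>, \<langle>cAll (V 1), cAll (V 0)\<rangle>\<rangle>))
     \<langle>\<langle>k, t\<rangle>, \<langle>u, v\<rangle>\<rangle>"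

text \<open>The entry \<open>V 0\<close> is the code of a logical axiom; the clauses are those of \<open>logax\<close>.\<close>

definition LogAx :: fm where
  "LogAx = (
       (\<^bold>\<exists> \<^bold>\<exists> Form (V 1) \<^bold>\<and> Form (V 0) \<^bold>\<and> V 2 \<^bold>= cImp (V 1) (cImp (V 0) (V 1)))
     \<^bold>\<or> (\<^bold>\<exists> \<^bold>\<exists> \<^bold>\<exists> Form (V 2) \<^bold>\<and> Form (V 1) \<^bold>\<and> Form (V 0) \<^bold>\<and>
          V 3 \<^bold>= cImp (cImp (V 2) (cImp (V 1) (V 0)))
                   (cImp (cImp (V 2) (V 1)) (cImp (V 2) (V 0))))
     \<^bold>\<or> (\<^bold>\<exists> \<^bold>\<exists> Form (V 1) \<^bold>\<and> Form (V 0) \<^bold>\<and>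
          V 2 \<^bold>= cImp (cImp (cNeg (V 1)) (cNeg (V 0))) (cImp (V 0) (V 1)))
     \<^bold>\<or> (\<^bold>\<exists> \<^bold>\<exists> \<^bold>\<exists> Form (V 2) \<^bold>\<and> Term (V 1) \<^bold>\<and> Sub Zero (V 1) (V 2) (V 0) \<^bold>\<and>
          V 3 \<^bold>= cImp (cAll (V 2)) (V 0))
     \<^bold>\<or> (\<^bold>\<exists> \<^bold>\<exists> Form (V 1) \<^bold>\<and> Form (V 0) \<^bold>\<and>
          V 2 \<^bold>= cImp (cAll (cImp (V 1) (V 0))) (cImp (cAll (V 1)) (cAll (V 0))))
     \<^bold>\<or> (\<^bold>\<exists> \<^bold>\<exists> Form (V 1) \<^bold>\<and> Lift Zero (V 1) (V 0) \<^bold>\<and> V 2 \<^bold>= cImp (V 1) (cAll (V 0)))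
     \<^bold>\<or> (\<^bold>\<exists> Term (V 0) \<^bold>\<and> V 1 \<^bold>= cEq (V 0) (V 0))
     \<^bold>\<or> (\<^bold>\<exists> \<^bold>\<exists> \<^bold>\<exists> \<^bold>\<exists> \<^bold>\<exists> Form (V 4) \<^bold>\<and> Term (V 3) \<^bold>\<and> Term (V 2) \<^bold>\<and>
          Sub Zero (V 3) (V 4) (V 1) \<^bold>\<and> Sub Zero (V 2) (V 4) (V 0) \<^bold>\<and>
          V 5 \<^bold>= cImp (cEq (V 3) (V 2)) (cImp (V 1) (V 0))))"

text \<open>
  The provability predicate of the theory defined by \<open>\<tau>\<close>. As theories consist of sentences, the
  nonlogical axioms are the (codes of) sentences that satisfy \<open>\<tau>\<close>; in the standard model
  the conjunct \<open>Sent\<close> is redundant if \<open>\<tau>\<close> defines a theory. For \<open>\<tau>\<close> in \<open>\<Sigma>\<^sub>1\<close>, \<open>Pr \<tau> x\<close> is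
  \<open>\<Sigma>\<^sub>1\<close> up to equivalence in \<open>I\<Sigma>\<^sub>1\<close>, by \<open>\<Sigma>\<^sub>1\<close> collection.
\<close>

definition Pr :: "fm \<Rightarrow> tm \<Rightarrow> fm" where
  "Pr \<tau> = Derivable (\<lambda>E.
       Sent (V 0) \<^bold>\<and> \<tau>
     \<^bold>\<or> LogAx
     \<^bold>\<or> (\<^bold>\<exists> E 1 (cImp (V 0) (V 1)) \<^bold>\<and> E 1 (V 0))
     \<^bold>\<or> (\<^bold>\<exists> E 1 (V 0) \<^bold>\<and> V 1 \<^bold>= cAll (V 0)))"

definition Con :: "fm \<Rightarrow> fm" where
  "Con \<tau> = (\<^bold>\<not> Pr \<tau> (num (gn (Zero \<^bold>= num 1))))"

text \<open>
  \<open>dotf 0 p\<close> is the term for the code of \<open>p\<close> in which \<open>V i\<close> stands for the code of what is put for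
  the free variable \<open>i\<close> of \<open>p\<close>; the first argument counts the quantifiers passed.
\<close>

primrec dott :: "nat \<Rightarrow> tm \<Rightarrow> tm" where
  "dott d (V i) = (if i < d then cV (num i) else V (i - d))"
| "dott d Zero = cZero"
| "dott d (Succ t) = cSucc (dott d t)"
| "dott d (Add s t) = cAdd (dott d s) (dott d t)"
| "dott d (Mul s t) = cMul (dott d s) (dott d t)"

primrec dotf :: "nat \<Rightarrow> fm \<Rightarrow> tm" where
  "dotf d (s \<^bold>= t) = cEq (dott d s) (dott d t)"
| "dotf d (s \<^bold>< t) = cLess (dott d s) (dott d t)"
| "dotf d (\<^bold>\<not> p) = cNeg (dotf d p)"
| "dotf d (p \<^bold>\<longrightarrow> q) = cImp (dotf d p) (dotf d q)"
| "dotf d (\<^bold>\<forall> p) = cAll (dotf (Suc d) p)"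

text \<open>
  \<open>Prdot \<tau> p\<close> is \<open>Pr\<^sub>\<tau>\<close> applied to the code of \<open>p\<close> with the numerals of the free variables \<open>y\<^sub>i\<close> put in, that is
  \<open>\<exists>z\<^sub>0 \<dots> z\<^sub>n\<^sub>-\<^sub>1. Num y\<^sub>i z\<^sub>i (for all y\<^sub>i free in p) \<and> Pr\<^sub>\<tau>(dotf 0 p)\<close>. It has the same free variables as \<open>p\<close>.
\<close>

definition Prdot :: "fm \<Rightarrow> fm \<Rightarrow> fm" where
  "Prdot \<tau> p = (let n = bound p in
     (Exists ^^ n) (foldr And [Num (V (n + i)) (V i). i \<leftarrow> [0..<n], i \<in> frees p] (Pr \<tau> (dotf 0 p))))"


section \<open>Quantified provability logic\<close>

text \<open>
  Modal formulas, again with de Bruijn indices. \<open>MPred p xs\<close> is the predicate symbol with name \<open>p\<close> and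
  arity \<open>length xs\<close> applied to the variables \<open>xs\<close>; \<open>\<diamond>A\<close> is \<open>\<not>\<box>\<not>A\<close>, and the other connectives are
  abbreviations as usual.
\<close>

datatype mfm = MPred nat "nat list" | MBot | MNeg mfm | MImp mfm mfm | MAll mfm | Box mfm

abbreviation Dia :: "mfm \<Rightarrow> mfm" where "Dia A \<equiv> MNeg (Box (MNeg A))"

primrec mfrees :: "mfm \<Rightarrow> nat set" where
  "mfrees (MPred p xs) = set xs"
| "mfrees MBot = {}"
| "mfrees (MNeg A) = mfrees A"
| "mfrees (MImp A B) = mfrees A \<union> mfrees B"
| "mfrees (MAll A) = {i. Suc i \<in> mfrees A}"
| "mfrees (Box A) = mfrees A"

text \<open>
  An arithmetical interpretation is given by the formulas \<open>f p n\<close> assigned to \<open>P(v\<^sub>0, \<dots>, v\<^sub>n\<^sub>-\<^sub>1)\<close>, for \<open>P\<close> the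
  \<open>n\<close>-ary predicate symbol with name \<open>p\<close>; uniformity determines it on all other atomic formulas.
\<close>

definition interpretation_of :: "(nat \<Rightarrow> nat \<Rightarrow> fm) \<Rightarrow> bool" where
  "interpretation_of f \<longleftrightarrow> (\<forall>p n. frees (f p n) = {..<n})"

primrec interp :: "fm \<Rightarrow> (nat \<Rightarrow> nat \<Rightarrow> fm) \<Rightarrow> mfm \<Rightarrow> fm" where
  "interp \<tau> f (MPred p xs) = subst (\<lambda>i. V (xs ! i)) (f p (length xs))"
| "interp \<tau> f MBot = (Zero \<^bold>= num 1)"
| "interp \<tau> f (MNeg A) = (\<^bold>\<not> interp \<tau> f A)"
| "interp \<tau> f (MImp A B) = (interp \<tau> f A \<^bold>\<longrightarrow> interp \<tau> f B)"
| "interp \<tau> f (MAll A) = (\<^bold>\<forall> interp \<tau> f A)"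
| "interp \<tau> f (Box A) = Prdot \<tau> (interp \<tau> f A)"

definition QPL :: "fm \<Rightarrow> fm set \<Rightarrow> mfm set" where
  "QPL \<tau> T = {A. mfrees A = {} \<and> (\<forall>f. interpretation_of f \<longrightarrow> T \<turnstile> interp \<tau> f A)}"


section \<open>Recursively enumerable theories\<close>

datatype prim = PZero | PSucc | PProj nat | PComp prim "prim list" | PRec prim prim

primrec pval :: "prim \<Rightarrow> nat list \<Rightarrow> nat" where
  "pval PZero xs = 0"
| "pval PSucc xs = (case xs of [] \<Rightarrow> 0 | x # _ \<Rightarrow> Suc x)"
| "pval (PProj i) xs = (if i < length xs then xs ! i else 0)"
| "pval (PComp g hs) xs = pval g (map (\<lambda>h. pval h xs) hs)"
| "pval (PRec g h) xs = (case xs of [] \<Rightarrow> 0 | x # ys \<Rightarrow>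
     rec_nat (pval g ys) (\<lambda>n r. pval h (n # r # ys)) x)"

text \<open>A set is r.e. iff it is the projection of a primitive recursive relation (Kleene).\<close>

definition rec_enum :: "nat set \<Rightarrow> bool" where
  "rec_enum A \<longleftrightarrow> (\<exists>g. A = {n. \<exists>m. pval g [n, m] = 0})"

definition re_theory :: "fm set \<Rightarrow> bool" where
  "re_theory T \<longleftrightarrow> (\<forall>p\<in>T. sentence p) \<and> rec_enum (gn ` T)"

end

theory Submission
  imports Defs "HOL-Library.Countable_Set"
begin

text \<open>
  By completeness, provability in a theory is truth in its models with domain \<open>nat\<close>. Let \<open>M\<close> be a model of \<open>T0\<close>,
  and let an arithmetical interpretation give a structure \<open>N\<close> inside \<open>M\<close> that satisfies the (finitely many)
  basic axioms. By induction in \<open>M\<close>, \<open>M\<close> embeds onto an initial segment of \<open>N\<close>, so \<open>\<Sigma>\<^sub>1\<close> sentences go up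
  from \<open>M\<close> to \<open>N\<close>. Suppose moreover that \<open>M\<close> satisfies \<open>Con\<close> and that zero, successor and the
  relation ``below \<open>c\<close> there is a proof of \<open>x\<close> that precedes all proofs of the negation of \<open>x\<close>'' of \<open>N\<close> are decided
  by provability in \<open>T0\<close>, which \<open>\<box>\<close> can express. Then the embedding is onto, as in Tennenbaum's
  theorem: for \<open>c\<close> above its range, the relation would separate the provable from the refutable sentences of \<open>M\<close>,
  and a fixed point refutes that.

  Let \<open>D\<close> be the modal sentence that states these hypotheses together with \<open>\<box>\<close> of them, \<open>p\<degree>\<close> the translation of \<open>p\<close>
  into the relational language of \<open>N\<close>, and \<open>\<psi>\<close> the formula \<open>Pr\<^sub>\<tau>\<^sub>0(Con\<^sub>\<tau>\<^sub>0 \<longrightarrow> \<phi>)\<close>. Then \<open>\<diamond>\<top> \<and> D \<longrightarrow> (\<psi>\<degree> \<longleftrightarrow> \<box>(\<diamond>\<top> \<longrightarrow> \<phi>\<degree>))\<close> is in the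
  logic of \<open>T0\<close>, hence in that of \<open>T1\<close>. For the standard interpretation in \<open>T1\<close>, \<open>D\<close> holds by provable
  \<open>\<Sigma>\<^sub>1\<close>-completeness, and the claim follows under \<open>Con\<^sub>\<tau>\<^sub>1\<close>. In the same way, the basic axioms and \<open>\<box>\<bottom>\<close> imply
  \<open>(\<not> Con\<^sub>\<tau>\<^sub>0)\<degree>\<close>; so without \<open>Con\<^sub>\<tau>\<^sub>1\<close> both sides of the claim are true.
\<close>

section \<open>Semantics and soundness\<close>

text \<open>A modal sentence can state only finitely many axioms, so the interpreted structure has
  no induction of its own. All induction about it is done in the model of \<open>T0\<close>, on a
  relation as complex as the interpretation; this is where \<open>PA\<close> is used. In models of
  \<open>T1\<close>, which may satisfy no more than \<open>ISigma1\<close>, only the standard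
  interpretation is evaluated. Bare provability would not serve in the Tennenbaum step: besides the
  images of true witnesses, the interpreted structure may have spurious witnesses above the range of
  the embedding, for a sentence and for its negation alike. True witnesses lie in the initial
  segment and precede the spurious ones, so comparing witnesses in the manner of Rosser ignores the
  latter. The comparison needs a bounded formula for "\<open>s\<close> witnesses the provability of
  \<open>x\<close>": the matrix \<open>W\<close> of a normal form of \<open>Pr\<close>. The set to
  be refuted depends on an arbitrary element \<open>c\<close> of the model. Hence the fixed point
  has a parameter, and codes containing nonstandard numerals are needed from the start. Consistency
  prevents the fixed point from being both provable and refutable. Since this is used again in the
  models reached through the box, both sides of the claim carry the premise Con.\<close>

record 'm str =
  mzero :: 'm
  msucc :: "'m \<Rightarrow> 'm"
  madd :: "'m \<Rightarrow> 'm \<Rightarrow> 'm"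
  mmul :: "'m \<Rightarrow> 'm \<Rightarrow> 'm"
  mless :: "'m \<Rightarrow> 'm \<Rightarrow> bool"

abbreviation scons :: "'a \<Rightarrow> (nat \<Rightarrow> 'a) \<Rightarrow> nat \<Rightarrow> 'a" (infixr "##" 65) where
  "x ## e \<equiv> case_nat x e"

primrec ev :: "'m str \<Rightarrow> (nat \<Rightarrow> 'm) \<Rightarrow> tm \<Rightarrow> 'm" where
  "ev M e (V i) = e i"
| "ev M e Zero = mzero M"
| "ev M e (Succ t) = msucc M (ev M e t)"
| "ev M e (Add s t) = madd M (ev M e s) (ev M e t)"
| "ev M e (Mul s t) = mmul M (ev M e s) (ev M e t)"

primrec holds :: "'m str \<Rightarrow> (nat \<Rightarrow> 'm) \<Rightarrow> fm \<Rightarrow> bool" where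
  "holds M e (s \<^bold>= t) \<longleftrightarrow> ev M e s = ev M e t"
| "holds M e (s \<^bold>< t) \<longleftrightarrow> mless M (ev M e s) (ev M e t)"
| "holds M e (\<^bold>\<not> p) \<longleftrightarrow> \<not> holds M e p"
| "holds M e (p \<^bold>\<longrightarrow> q) \<longleftrightarrow> (holds M e p \<longrightarrow> holds M e q)"
| "holds M e (\<^bold>\<forall> p) \<longleftrightarrow> (\<forall>x. holds M (x ## e) p)"

definition models :: "'m str \<Rightarrow> fm set \<Rightarrow> bool" where
  "models M T \<longleftrightarrow> (\<forall>p\<in>T. \<forall>e. holds M e p)"

lemma up_simps [simp]: "up \<sigma> 0 = V 0" "up \<sigma> (Suc i) = lift 1 (\<sigma> i)"
  by (simp_all add: up_def)

lemma lift_simps [simp]: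
  "lift d (V i) = V (i + d)" "lift d Zero = Zero" "lift d (Succ t) = Succ (lift d t)"
  "lift d (Add s t) = Add (lift d s) (lift d t)" "lift d (Mul s t) = Mul (lift d s) (lift d t)"
  "lift d \<langle>s, t\<rangle> = \<langle>lift d s, lift d t\<rangle>"
  by (simp_all add: lift_def pairt_def)

lemma lift_num [simp]: "lift d (num n) = num n"
  by (induction n) auto

lemma substt_num [simp]: "substt \<sigma> (num n) = num n"
  by (induction n) auto

lemma freest_num [simp]: "freest (num n) = {}"
  by (induction n) auto

lemma ev_cong: "(\<And>i. i \<in> freest t \<Longrightarrow> e i = e' i) \<Longrightarrow> ev M e t = ev M e' t"
  by (induction t) auto

lemma holds_cong: "(\<And>i. i \<in> frees p \<Longrightarrow> e i = e' i) \<Longrightarrow> holds M e p = holds M e' p"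
proof (induction p arbitrary: e e')
  case (Eq s t)
  then show ?case using ev_cong[of s e e' M] ev_cong[of t e e' M] by auto
next
  case (Less s t)
  then show ?case using ev_cong[of s e e' M] ev_cong[of t e e' M] by auto
next
  case (Forall p)
  have "holds M (x ## e) p = holds M (x ## e') p" for x
    by (rule Forall.IH) (auto simp: Forall.prems split: nat.split)
  then show ?case by simp
next
  case (Imp p q)
  have "holds M e p = holds M e' p" "holds M e q = holds M e' q"
    by (rule Imp.IH, simp add: Imp.prems)+
  then show ?case by simp
next
  case (Neg p)
  show ?case using Neg.IH[of e e'] Neg.prems by simp
qed

lemma ev_substt: "ev M e (substt \<sigma> t) = ev M (\<lambda>i. ev M e (\<sigma> i)) t"
  by (induction t) auto

lemma ev_lift [simp]: "ev M e (lift d t) = ev M (\<lambda>i. e (i + d)) t"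
  by (simp add: lift_def ev_substt)

lemma scons_shift: "(\<lambda>i. ev M (x ## e) (up \<sigma> i)) = x ## (\<lambda>i. ev M e (\<sigma> i))"
  by (rule ext) (auto simp: up_def split: nat.split)

lemma holds_subst: "holds M e (subst \<sigma> p) = holds M (\<lambda>i. ev M e (\<sigma> i)) p"
  by (induction p arbitrary: e \<sigma>) (auto simp: ev_substt scons_shift)

lemma scons_ev: "(\<lambda>i. ev M e ((t ## \<sigma>) i)) = ev M e t ## (\<lambda>i. ev M e (\<sigma> i))"
  by (rule ext) (auto split: nat.split)

lemma holds_inst [simp]: "holds M e (inst p t) = holds M (ev M e t ## e) p"
  by (simp add: inst_def holds_subst scons_ev)

lemma holds_liftf [simp]: "holds M e (liftf p) = holds M (\<lambda>i. e (Suc i)) p"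
  by (simp add: liftf_def holds_subst)

lemma soundness: "T \<turnstile> p \<Longrightarrow> models M T \<Longrightarrow> holds M e p"
proof (induction arbitrary: e rule: proves.induct)
  case (Logic p)
  then show ?case by (induction rule: logax.induct) auto
qed (auto simp: models_def)

section \<open>Substitution\<close>

lemma finite_freest [simp]: "finite (freest t)"
  by (induction t) auto

lemma finite_frees [simp]: "finite (frees p)"
proof (induction p)
  case (Forall p)
  have "{i. Suc i \<in> frees p} = Suc -` frees p" by auto
  then show ?case using Forall by (auto intro: finite_vimageI)
qed auto

lemma substt_cong: "(\<And>i. i \<in> freest t \<Longrightarrow> \<sigma> i = \<sigma>' i) \<Longrightarrow> substt \<sigma> t = substt \<sigma>' t"
  by (induction t) auto

lemma subst_cong: "(\<And>i. i \<in> frees p \<Longrightarrow> \<sigma> i = \<sigma>' i) \<Longrightarrow> subst \<sigma> p = subst \<sigma>' p"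
proof (induction p arbitrary: \<sigma> \<sigma>')
  case (Forall p)
  have "subst (up \<sigma>) p = subst (up \<sigma>') p"
    by (rule Forall.IH) (auto simp: Forall.prems up_def split: nat.split)
  then show ?case by simp
next
  case (Imp p q)
  have "subst \<sigma> p = subst \<sigma>' p" "subst \<sigma> q = subst \<sigma>' q"
    by (rule Imp.IH, simp add: Imp.prems)+
  then show ?case by simp
next
  case (Neg p)
  show ?case using Neg.IH[of \<sigma> \<sigma>'] Neg.prems by simp
qed (auto intro: substt_cong)

lemma substt_V [simp]: "substt V t = t"
  by (induction t) auto

lemma up_V [simp]: "up V = V"
  by (rule ext) (auto simp: up_def split: nat.split)

lemma subst_V [simp]: "subst V p = p"
  by (induction p) auto

lemma subst_sentence: "sentence p \<Longrightarrow> subst \<sigma> p = p"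
  using subst_cong[of p \<sigma> V] by simp

lemma substt_substt: "substt \<sigma> (substt \<rho> t) = substt (\<lambda>i. substt \<sigma> (\<rho> i)) t"
  by (induction t) auto

lemma substt_up_lift: "substt (up \<sigma>) (lift 1 t) = lift 1 (substt \<sigma> t)"
  by (simp add: lift_def substt_substt)

lemma up_comp: "(\<lambda>i. substt (up \<sigma>) (up \<rho> i)) = up (\<lambda>i. substt \<sigma> (\<rho> i))"
  by (rule ext) (auto simp: up_def substt_up_lift[unfolded up_def One_nat_def] split: nat.split)

lemma subst_subst: "subst \<sigma> (subst \<rho> p) = subst (\<lambda>i. substt \<sigma> (\<rho> i)) p"
  by (induction p arbitrary: \<sigma> \<rho>) (auto simp: substt_substt up_comp)

lemma lift_substt_scons: "substt (t ## \<sigma>) (lift (Suc 0) s) = substt \<sigma> s"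
  by (simp add: lift_def substt_substt)

lemma inst_subst_up: "inst (subst (up \<sigma>) p) t = subst (t ## \<sigma>) p"
proof -
  have "(\<lambda>i. substt (t ## V) (up \<sigma> i)) = t ## \<sigma>"
    by (rule ext) (auto simp: up_def lift_substt_scons split: nat.split)
  then show ?thesis by (simp add: inst_def subst_subst)
qed

lemma subst_inst: "subst \<sigma> (inst p t) = inst (subst (up \<sigma>) p) (substt \<sigma> t)"
proof -
  have "(\<lambda>i. substt \<sigma> ((t ## V) i)) = substt \<sigma> t ## \<sigma>"
    by (rule ext) (auto split: nat.split)
  then show ?thesis by (simp add: inst_subst_up) (simp add: inst_def subst_subst)
qed

lemma subst_liftf: "subst (up \<sigma>) (liftf p) = liftf (subst \<sigma> p)"
  by (simp add: liftf_def subst_subst) (simp add: lift_def)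

lemma logax_subst: "logax p \<Longrightarrow> logax (subst \<sigma> p)"
  by (induction rule: logax.induct) (auto simp: subst_inst subst_liftf intro: logax.intros)

text \<open>Axioms of \<open>T\<close> are sentences and so are fixed by substitution, and each
  logical scheme is closed under it. The induction leaves \<open>\<sigma>\<close> arbitrary because
  \<open>Gen\<close> calls for \<open>up \<sigma>\<close>.\<close>

lemma proves_subst:
  assumes "T \<turnstile> p" and "\<forall>p\<in>T. sentence p"
  shows "T \<turnstile> subst \<sigma> p"
  using assms(1)
proof (induction arbitrary: \<sigma> rule: proves.induct)
  case (Ax p)
  then show ?case using assms(2) by (simp add: subst_sentence proves.Ax)
next
  case (MP p q)
  then show ?case by (metis proves.MP subst.simps(4))
qed (auto intro: proves.Logic proves.Gen logax_subst)

section \<open>Completeness\<close>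

text \<open>Local assumptions: unlike those in \<open>T\<close>, their free variables may not be generalised.\<close>

inductive derives :: "fm set \<Rightarrow> fm set \<Rightarrow> fm \<Rightarrow> bool" for T S where
  Hyp: "p \<in> S \<Longrightarrow> derives T S p"
| Thm: "T \<turnstile> p \<Longrightarrow> derives T S p"
| Mp: "derives T S (p \<^bold>\<longrightarrow> q) \<Longrightarrow> derives T S p \<Longrightarrow> derives T S q"

lemma derives_logax: "logax p \<Longrightarrow> derives T S p"
  by (simp add: Thm Logic)

lemma derives_mono: "derives T S p \<Longrightarrow> S \<subseteq> S' \<Longrightarrow> derives T S' p"
proof (induction rule: derives.induct)
  case (Mp p q)
  then show ?case using derives.Mp[of T S' p q] by blast
qed (auto intro: Hyp Thm)

lemma derives_refl_imp: "derives T S (p \<^bold>\<longrightarrow> p)"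
proof -
  have "derives T S ((p \<^bold>\<longrightarrow> (p \<^bold>\<longrightarrow> p) \<^bold>\<longrightarrow> p) \<^bold>\<longrightarrow> (p \<^bold>\<longrightarrow> p \<^bold>\<longrightarrow> p) \<^bold>\<longrightarrow> p \<^bold>\<longrightarrow> p)"
    by (intro derives_logax logax.intros)
  moreover have "derives T S (p \<^bold>\<longrightarrow> (p \<^bold>\<longrightarrow> p) \<^bold>\<longrightarrow> p)" "derives T S (p \<^bold>\<longrightarrow> p \<^bold>\<longrightarrow> p)"
    by (intro derives_logax logax.intros)+
  ultimately show ?thesis by (rule Mp[OF Mp])
qed

lemma derives_weaken: "derives T S p \<Longrightarrow> derives T S (q \<^bold>\<longrightarrow> p)"
  by (rule Mp[OF derives_logax[OF logax.intros(1)]])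

text \<open>There is no eigenvariable condition: generalisation occurs only inside
  \<open>Thm\<close>, where hypotheses from \<open>S\<close> cannot be used.\<close>

lemma deduction: "derives T (insert q S) p \<Longrightarrow> derives T S (q \<^bold>\<longrightarrow> p)"
proof (induction rule: derives.induct)
  case (Hyp p)
  then show ?case by (auto intro: derives_refl_imp derives_weaken derives.Hyp)
next
  case (Thm p)
  then show ?case by (simp add: derives_weaken derives.Thm)
next
  case (Mp p r)
  show ?case by (rule derives.Mp[OF derives.Mp[OF derives_logax[OF logax.intros(2)] Mp.IH(1)] Mp.IH(2)])
qed

lemma derives_cut: "derives T (insert q S) p \<Longrightarrow> derives T S q \<Longrightarrow> derives T S p"
  by (rule Mp[OF deduction])

lemma derives_explode: "derives T S (\<^bold>\<not> p) \<Longrightarrow> derives T S p \<Longrightarrow> derives T S q"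
  by (rule Mp[OF Mp[OF derives_logax[OF logax.intros(3)] derives_weaken]])

lemma derives_dne: "derives T S (\<^bold>\<not> \<^bold>\<not> p) \<Longrightarrow> derives T S p"
proof -
  assume a: "derives T S (\<^bold>\<not> \<^bold>\<not> p)"
  have "derives T (insert (\<^bold>\<not> p) S) (\<^bold>\<not> \<^bold>\<not> \<^bold>\<not> p)"
    by (rule derives_explode[of _ _ "\<^bold>\<not> p"]) (auto intro: derives_mono[OF a] Hyp)
  then have "derives T S (\<^bold>\<not> p \<^bold>\<longrightarrow> \<^bold>\<not> \<^bold>\<not> \<^bold>\<not> p)" by (rule deduction)
  then have "derives T S (\<^bold>\<not> \<^bold>\<not> p \<^bold>\<longrightarrow> p)"
    by (rule Mp[OF derives_logax[OF logax.intros(3)]])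
  then show ?thesis using a by (rule Mp)
qed

lemma derives_neg: "derives T (insert p S) (\<^bold>\<not> p) \<Longrightarrow> derives T S (\<^bold>\<not> p)"
proof -
  assume a: "derives T (insert p S) (\<^bold>\<not> p)"
  \<comment> \<open>Any provable formula would do: its negation plays the part of falsity, for which
    there is no symbol.\<close>
  define \<theta> where "\<theta> = (p \<^bold>\<longrightarrow> p)"
  have "derives T (insert (\<^bold>\<not> \<^bold>\<not> p) S) p"
    by (rule derives_dne) (simp add: Hyp)
  moreover have "derives T (insert p (insert (\<^bold>\<not> \<^bold>\<not> p) S)) (\<^bold>\<not> p)"
    by (rule derives_mono[OF a]) auto
  ultimately have "derives T (insert (\<^bold>\<not> \<^bold>\<not> p) S) (\<^bold>\<not> p)" by (rule derives_cut[rotated])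
  then have "derives T (insert (\<^bold>\<not> \<^bold>\<not> p) S) (\<^bold>\<not> \<theta>)"
    using \<open>derives T (insert (\<^bold>\<not> \<^bold>\<not> p) S) p\<close> by (rule derives_explode)
  then have "derives T S (\<^bold>\<not> \<^bold>\<not> p \<^bold>\<longrightarrow> \<^bold>\<not> \<theta>)" by (rule deduction)
  then have "derives T S (\<theta> \<^bold>\<longrightarrow> \<^bold>\<not> p)"
    by (rule Mp[OF derives_logax[OF logax.intros(3)]])
  then show ?thesis
    unfolding \<theta>_def by (rule Mp[OF _ derives_refl_imp])
qed

lemma derives_inconsistent: "derives T (insert (\<^bold>\<not> p) S) q \<Longrightarrow> derives T (insert (\<^bold>\<not> p) S) (\<^bold>\<not> q) \<Longrightarrow> derives T S p"
  by (rule derives_dne, rule derives_neg) (rule derives_explode)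

lemma derives_finite:
  "derives T S p \<Longrightarrow> \<exists>F\<subseteq>S. finite F \<and> derives T F p"
proof (induction rule: derives.induct)
  case (Hyp p)
  then show ?case by (intro exI[of _ "{p}"]) (auto intro: derives.Hyp)
next
  case (Thm p)
  then show ?case by (intro exI[of _ "{}"]) (auto intro: derives.Thm)
next
  case (Mp p q)
  then obtain F G where "F \<subseteq> S" "G \<subseteq> S" "finite F" "finite G"
    "derives T F (p \<^bold>\<longrightarrow> q)" "derives T G p" by blast
  then show ?case
    by (intro exI[of _ "F \<union> G"]) (auto intro: derives.Mp[of T _ p] derives_mono)
qed

lemma derives_subst:
  "derives T S p \<Longrightarrow> \<forall>p\<in>T. sentence p \<Longrightarrow> derives T (subst \<sigma> ` S) (subst \<sigma> p)"
proof (induction rule: derives.induct)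
  case (Mp p q)
  then show ?case using derives.Mp[of T "subst \<sigma> ` S" "subst \<sigma> p" "subst \<sigma> q"] by simp
qed (auto intro: Hyp Thm proves_subst)

text \<open>No formula in the image of \<open>liftf\<close> mentions \<open>V 0\<close>, so
  \<open>V 0\<close> may be generalised: the vacuous quantifier axiom treats hypotheses, and
  distribution of the quantifier treats modus ponens.\<close>

lemma derives_gen: "derives T (liftf ` S) p \<Longrightarrow> derives T S (\<^bold>\<forall> p)"
proof (induction rule: derives.induct)
  case (Hyp p)
  then show ?case by (auto intro: Mp[OF derives_logax[OF logax.intros(6)] derives.Hyp])
next
  case (Thm p)
  then show ?case by (intro derives.Thm Gen)
next
  case (Mp p q)
  show ?case by (rule derives.Mp[OF derives.Mp[OF derives_logax[OF logax.intros(5)] Mp.IH(1)] Mp.IH(2)])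
qed

lemma derives_fresh:
  assumes d: "derives T S (inst p (V k))" and T: "\<forall>p\<in>T. sentence p"
    and k: "\<And>q. q \<in> S \<Longrightarrow> k \<notin> frees q" "Suc k \<notin> frees p"
  shows "derives T S (\<^bold>\<forall> p)"
proof -
  \<comment> \<open>The fresh variable becomes \<open>V 0\<close> and all others move up. This
    undoes \<open>inst p (V k)\<close> and acts as \<open>liftf\<close> on formulas without
    \<open>V k\<close>.\<close>
  define \<rho> where "\<rho> = (\<lambda>i. if i = k then V 0 else V (Suc i))"
  have "subst \<rho> (inst p (V k)) = subst V p"
    unfolding inst_def subst_subst
  proof (rule subst_cong)
    fix i assume "i \<in> frees p"
    then show "substt \<rho> ((V k ## V) i) = V i"
      using k(2) by (auto simp: \<rho>_def split: nat.split)
  qed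
  moreover have "subst \<rho> ` S = liftf ` S"
    by (rule image_cong) (auto simp: liftf_def \<rho>_def dest: k(1) intro!: subst_cong)
  ultimately have "derives T (liftf ` S) p"
    using derives_subst[OF d T, of \<rho>] by simp
  then show ?thesis by (rule derives_gen)
qed

section \<open>Henkin sets of formulas\<close>

definition consistent :: "fm set \<Rightarrow> fm set \<Rightarrow> bool" where
  "consistent T S \<longleftrightarrow> \<not> (\<exists>p. derives T S p \<and> derives T S (\<^bold>\<not> p))"

lemma inconsistent_all: "\<not> consistent T S \<Longrightarrow> derives T S p"
  using derives_explode by (auto simp: consistent_def)

instance tm :: countable by countable_datatype
instance fm :: countable by countable_datatype

definition fresh :: "fm set \<Rightarrow> nat" where
  "fresh S = (LEAST k. \<forall>q\<in>S. \<forall>i\<in>frees q. i < k)"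

lemma fresh:
  assumes "finite S" and "q \<in> S"
  shows "\<And>i. i \<in> frees q \<Longrightarrow> i < fresh S"
proof -
  have "finite (\<Union> (frees ` S))" using assms(1) by auto
  then obtain k where "\<forall>i\<in>\<Union> (frees ` S). i < k"
    by (metis finite_nat_set_iff_bounded)
  then have "\<forall>q\<in>S. \<forall>i\<in>frees q. i < k" by auto
  then have "\<forall>q\<in>S. \<forall>i\<in>frees q. i < fresh S"
    unfolding fresh_def by (rule LeastI)
  then show "\<And>i. i \<in> frees q \<Longrightarrow> i < fresh S" using assms(2) by auto
qed

definition witness :: "fm set \<Rightarrow> fm \<Rightarrow> fm" where
  "witness S p = (case p of \<^bold>\<not> (\<^bold>\<forall> q) \<Rightarrow> \<^bold>\<not> inst q (V (fresh (insert p S))) | _ \<Rightarrow> p)"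

primrec henkin :: "fm set \<Rightarrow> fm set \<Rightarrow> nat \<Rightarrow> fm set" where
  "henkin T S 0 = S"
| "henkin T S (Suc n) = (let S' = henkin T S n; p = from_nat n in
     if consistent T (insert p S') then insert (witness S' p) (insert p S') else S')"

lemma witness_consistent:
  assumes T: "\<forall>p\<in>T. sentence p" and "finite S" and c: "consistent T (insert p S)"
  shows "consistent T (insert (witness S p) (insert p S))"
proof (rule ccontr)
  assume i: "\<not> ?thesis"
  show False
  proof (cases "\<exists>q. p = (\<^bold>\<not> (\<^bold>\<forall> q))")
    case False
    then have "witness S p = p" unfolding witness_def by (auto split: fm.split)
    with i c show False by simp
  next
    case True
    then obtain q where p: "p = (\<^bold>\<not> (\<^bold>\<forall> q))" by auto
    define k where "k = fresh (insert p S)"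
    have w: "witness S p = (\<^bold>\<not> inst q (V k))" by (simp add: witness_def p k_def)
    have "derives T (insert p S) (inst q (V k))"
      using i derives_inconsistent[of T "inst q (V k)" _ p] inconsistent_all unfolding w by blast
    moreover have fr: "k \<notin> frees r" if "r \<in> insert p S" for r
      using fresh[of "insert p S" r k] that assms(2) unfolding k_def by blast
    moreover have "Suc k \<notin> frees q" using fr[of p] by (simp add: p)
    ultimately have "derives T (insert p S) (\<^bold>\<forall> q)" using T by (intro derives_fresh) auto
    moreover have "derives T (insert p S) (\<^bold>\<not> (\<^bold>\<forall> q))" by (simp add: p Hyp)
    ultimately show False using c by (auto simp: consistent_def)
  qed
qed

lemma consistent_mono: "consistent T S' \<Longrightarrow> S \<subseteq> S' \<Longrightarrow> consistent T S"
  unfolding consistent_def using derives_mono[of T S _ S'] by blast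

lemma consistent_insert: "consistent T S \<Longrightarrow> derives T S p \<Longrightarrow> consistent T (insert p S)"
  unfolding consistent_def using derives_cut[of T p S] by blast

lemma henkin_finite: "finite S \<Longrightarrow> finite (henkin T S n)"
  by (induction n) (auto simp: Let_def)

lemma henkin_consistent:
  assumes "\<forall>p\<in>T. sentence p" "finite S" "consistent T S"
  shows "consistent T (henkin T S n)"
proof (induction n)
  case (Suc n)
  then show ?case
    using witness_consistent[OF assms(1) henkin_finite[OF assms(2)]] by (simp add: Let_def)
qed (simp add: assms)

lemma henkin_mono: "m \<le> n \<Longrightarrow> henkin T S m \<subseteq> henkin T S n"
  by (rule lift_Suc_mono_le) (auto simp: Let_def)

lemma henkin_Union:
  assumes T: "\<forall>p\<in>T. sentence p" and S: "finite S" "consistent T S"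
  defines "H \<equiv> \<Union>n. henkin T S n"
  shows "S \<subseteq> H"
    and "derives T H p \<longleftrightarrow> p \<in> H"
    and "(\<^bold>\<not> p) \<in> H \<longleftrightarrow> p \<notin> H"
    and "(p \<^bold>\<longrightarrow> q) \<in> H \<longleftrightarrow> (p \<in> H \<longrightarrow> q \<in> H)"
    and "(\<^bold>\<forall> p) \<in> H \<longleftrightarrow> (\<forall>t. inst p t \<in> H)"
proof -
  show "S \<subseteq> H" unfolding H_def by (rule UN_upper[of 0 UNIV "henkin T S", simplified])
  have H: "consistent T H"
  proof (rule ccontr)
    assume "\<not> consistent T H"
    then obtain r where "derives T H r" "derives T H (\<^bold>\<not> r)" by (auto simp: consistent_def)
    then obtain F G where FG: "F \<subseteq> H" "G \<subseteq> H" "finite F" "finite G" "derives T F r" "derives T G (\<^bold>\<not> r)"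
      using derives_finite[of T H r] derives_finite[of T H "\<^bold>\<not> r"] by blast
    have "\<exists>n. F' \<subseteq> henkin T S n" if "finite F'" "F' \<subseteq> H" for F'
      using that
    proof (induction rule: finite_induct)
      case (insert x F')
      then obtain n m where "F' \<subseteq> henkin T S n" "x \<in> henkin T S m" by (auto simp: H_def)
      then have "insert x F' \<subseteq> henkin T S (max n m)"
        using henkin_mono[of n "max n m" T S] henkin_mono[of m "max n m" T S] by auto
      then show ?case by blast
    qed auto
    from this[of "F \<union> G"] FG obtain n where "F \<union> G \<subseteq> henkin T S n" by auto
    then have "\<not> consistent T (henkin T S n)"
      using FG derives_mono[of T F r] derives_mono[of T G "\<^bold>\<not> r"] unfolding consistent_def by blast
    then show False using henkin_consistent[OF T S] by simp
  qed
  \<comment> \<open>Stage \<open>n\<close> treats \<open>from_nat n\<close>, so \<open>p\<close> has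
    its turn at stage \<open>to_nat p\<close>.\<close>
  have add: "p \<in> henkin T S (Suc (to_nat p)) \<and> witness (henkin T S (to_nat p)) p \<in> henkin T S (Suc (to_nat p))"
    if "consistent T (insert p H)" for p
  proof -
    have "consistent T (insert p (henkin T S (to_nat p)))"
      using that by (rule consistent_mono) (auto simp: H_def)
    then show ?thesis by (simp add: Let_def)
  qed
  have addH: "p \<in> H" if "consistent T (insert p H)" for p
    using add[OF that] unfolding H_def by blast
  have addw: "\<exists>n. witness (henkin T S n) p \<in> H" if "consistent T (insert p H)" for p
    using add[OF that] unfolding H_def by blast
  have clo: "p \<in> H" if "derives T H p" for p
  proof -
    have "consistent T (insert p H)"
      using H that by (rule consistent_insert)
    then show ?thesis by (rule addH)
  qed
  show c: "derives T H p \<longleftrightarrow> p \<in> H" for p using clo by (auto intro: Hyp)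
  show n: "(\<^bold>\<not> p) \<in> H \<longleftrightarrow> p \<notin> H" for p
  proof
    show "(\<^bold>\<not> p) \<in> H \<Longrightarrow> p \<notin> H" using H unfolding consistent_def by (blast intro: Hyp)
    assume "p \<notin> H"
    then have "\<not> consistent T (insert p H)" using addH by blast
    then have "derives T H (\<^bold>\<not> p)" by (rule derives_neg[OF inconsistent_all])
    then show "(\<^bold>\<not> p) \<in> H" by (rule clo)
  qed
  show "(p \<^bold>\<longrightarrow> q) \<in> H \<longleftrightarrow> (p \<in> H \<longrightarrow> q \<in> H)"
  proof (intro iffI impI)
    assume "p \<in> H \<longrightarrow> q \<in> H"
    then show "(p \<^bold>\<longrightarrow> q) \<in> H"
    proof (cases "p \<in> H")
      case True
      then have "q \<in> H" using \<open>p \<in> H \<longrightarrow> q \<in> H\<close> by simp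
      then show ?thesis by (rule clo[OF derives_weaken[OF derives.Hyp]])
    next
      case False
      then have "(\<^bold>\<not> p) \<in> H" using n by blast
      then have "derives T (insert p H) q"
        by - (rule derives_explode[of _ _ p, OF Hyp Hyp], simp_all)
      then show ?thesis by (rule clo[OF deduction])
    qed
  next
    assume "(p \<^bold>\<longrightarrow> q) \<in> H" "p \<in> H"
    then show "q \<in> H" by (rule clo[OF Mp[OF Hyp Hyp]])
  qed
  show "(\<^bold>\<forall> p) \<in> H \<longleftrightarrow> (\<forall>t. inst p t \<in> H)"
  proof (intro iffI allI)
    fix t assume "(\<^bold>\<forall> p) \<in> H"
    then show "inst p t \<in> H" by (rule clo[OF Mp[OF derives_logax[OF logax.intros(4)] Hyp]])
  next
    assume a: "\<forall>t. inst p t \<in> H"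
    show "(\<^bold>\<forall> p) \<in> H"
    proof (rule ccontr)
      assume "(\<^bold>\<forall> p) \<notin> H"
      then have "(\<^bold>\<not> (\<^bold>\<forall> p)) \<in> H" using n by blast
      then have "consistent T (insert (\<^bold>\<not> (\<^bold>\<forall> p)) H)" using H by (simp add: insert_absorb)
      from addw[OF this] have "\<exists>t. (\<^bold>\<not> inst p t) \<in> H"
        by (auto simp: witness_def)
      then show False using a n by blast
    qed
  qed
qed

text \<open>By the basic axioms the numerals are pairwise distinct. Hence the terms modulo the
  equations of the Henkin set form a countably infinite model, which can be moved to
  \<open>nat\<close>; a single type of models then suffices for both theories.\<close>

theorem completeness:
  assumes T: "\<forall>p\<in>T. sentence p" and B: "\<And>p. p \<in> basic_axioms \<Longrightarrow> T \<turnstile> p"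
    and valid: "\<And>M :: nat str. \<And>e. models M T \<Longrightarrow> holds M e p"
  shows "T \<turnstile> p"
proof (rule ccontr)
  assume np: "\<not> T \<turnstile> p"
  have TD: "T \<turnstile> q" if "derives T {} q" for q
    using that by (induction rule: derives.induct) (simp, assumption, rule proves.MP)
  have c: "consistent T {\<^bold>\<not> p}"
  proof (rule ccontr)
    assume "\<not> consistent T {\<^bold>\<not> p}"
    then have "derives T {} p"
      using derives_inconsistent[of T p "{}" p] inconsistent_all by blast
    then show False using np TD by blast
  qed
  define H where "H = (\<Union>n. henkin T {\<^bold>\<not> p} n)"
  have fin: "finite {\<^bold>\<not> p}" by simp
  note H = henkin_Union[OF T fin c, folded H_def]
  have HT: "q \<in> H" if "T \<turnstile> q" for q using that H(2) by (auto intro: Thm)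
  have HL: "q \<in> H" if "logax q" for q using that by (auto intro: HT Logic)
  have leib: "inst q s \<in> H \<Longrightarrow> inst q t \<in> H" if "(s \<^bold>= t) \<in> H" for s t q
    using HL[OF logax.intros(8)[of s t q]] that H(4) by blast
  have lift0: "substt (t ## V) (lift (Suc 0) s) = s" for s t by (simp add: lift_substt_scons)
  have refl: "(t \<^bold>= t) \<in> H" for t by (rule HL) (rule logax.intros)
  have sym: "(t \<^bold>= s) \<in> H" if "(s \<^bold>= t) \<in> H" for s t
    using leib[OF that, of "V 0 \<^bold>= lift 1 s"] refl by (simp add: inst_def lift0)
  have trans: "(s \<^bold>= u) \<in> H" if "(s \<^bold>= t) \<in> H" "(t \<^bold>= u) \<in> H" for s t u
    using leib[OF that(2), of "lift 1 s \<^bold>= V 0"] that(1) by (simp add: inst_def lift0)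
  have congS: "(Succ s \<^bold>= Succ t) \<in> H" if "(s \<^bold>= t) \<in> H" for s t
    using leib[OF that, of "Succ (lift 1 s) \<^bold>= Succ (V 0)"] refl by (simp add: inst_def lift0)
  have congA: "(Add s s' \<^bold>= Add t t') \<in> H" if "(s \<^bold>= t) \<in> H" "(s' \<^bold>= t') \<in> H" for s t s' t'
    using leib[OF that(1), of "Add (lift 1 s) (lift 1 s') \<^bold>= Add (V 0) (lift 1 s')"]
      leib[OF that(2), of "Add (lift 1 s) (lift 1 s') \<^bold>= Add (lift 1 t) (V 0)"] refl
    by (simp add: inst_def lift0)
  have congM: "(Mul s s' \<^bold>= Mul t t') \<in> H" if "(s \<^bold>= t) \<in> H" "(s' \<^bold>= t') \<in> H" for s t s' t'
    using leib[OF that(1), of "Mul (lift 1 s) (lift 1 s') \<^bold>= Mul (V 0) (lift 1 s')"]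
      leib[OF that(2), of "Mul (lift 1 s) (lift 1 s') \<^bold>= Mul (lift 1 t) (V 0)"] refl
    by (simp add: inst_def lift0)
  have congL: "(t \<^bold>< t') \<in> H" if "(s \<^bold>= t) \<in> H" "(s' \<^bold>= t') \<in> H" "(s \<^bold>< s') \<in> H" for s t s' t'
    using leib[OF that(1), of "V 0 \<^bold>< lift 1 s'"] leib[OF that(2), of "lift 1 t \<^bold>< V 0"] that(3)
    by (simp add: inst_def lift0)
  define cl where "cl = (\<lambda>t. {u. (t \<^bold>= u) \<in> H})"
  have cl: "cl s = cl t \<longleftrightarrow> (s \<^bold>= t) \<in> H" for s t
    unfolding cl_def using refl sym trans by blast
  have numS: "(num i \<^bold>= num j) \<notin> H" if "i < j" for i j
    using that
  proof (induction i arbitrary: j)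
    case 0
    then obtain k where j: "j = Suc k" by (cases j) auto
    have "(\<^bold>\<forall> \<^bold>\<not> Succ (V 0) \<^bold>= Zero) \<in> H" by (rule HT, rule B) (simp add: basic_axioms_def)
    then have "inst (\<^bold>\<not> Succ (V 0) \<^bold>= Zero) (num k) \<in> H" using H(5) by blast
    then have "(num j \<^bold>= num 0) \<notin> H" using H(3) by (simp add: inst_def j)
    then show ?case using sym by blast
  next
    case (Suc i)
    then obtain k where j: "j = Suc k" by (cases j) auto
    have "(\<^bold>\<forall> \<^bold>\<forall> Succ (V 1) \<^bold>= Succ (V 0) \<^bold>\<longrightarrow> V 1 \<^bold>= V 0) \<in> H"
      by (rule HT, rule B) (simp add: basic_axioms_def)
    then have "inst (\<^bold>\<forall> Succ (V 1) \<^bold>= Succ (V 0) \<^bold>\<longrightarrow> V 1 \<^bold>= V 0) (num i) \<in> H" using H(5) by blast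
    then have "(\<^bold>\<forall> Succ (num i) \<^bold>= Succ (V 0) \<^bold>\<longrightarrow> num i \<^bold>= V 0) \<in> H"
      by (simp add: inst_def up_def)
    then have "inst (Succ (num i) \<^bold>= Succ (V 0) \<^bold>\<longrightarrow> num i \<^bold>= V 0) (num k) \<in> H" using H(5) by blast
    then have "(num (Suc i) \<^bold>= num j \<^bold>\<longrightarrow> num i \<^bold>= num k) \<in> H"
      by (simp add: inst_def j)
    then show ?case using Suc H(4) j by auto
  qed
  have "inj (cl \<circ> num)"
  proof (rule injI)
    fix i j assume "(cl \<circ> num) i = (cl \<circ> num) j"
    then have "(num i \<^bold>= num j) \<in> H" "(num j \<^bold>= num i) \<in> H"
      using cl[of "num i" "num j"] cl[of "num j" "num i"] by auto
    then show "i = j" using numS[of i j] numS[of j i] by linarith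
  qed
  then have "infinite (range (cl \<circ> num))" by (rule range_inj_infinite)
  moreover have "range (cl \<circ> num) \<subseteq> range cl" by auto
  ultimately have "infinite (range cl)" using finite_subset by blast
  moreover have "countable (range cl)" by simp
  ultimately have bij: "bij_betw (to_nat_on (range cl)) (range cl) UNIV"
    by (rule to_nat_on_infinite[rotated])
  define c where "c = (\<lambda>t. to_nat_on (range cl) (cl t))"
  have c_eq: "c s = c t \<longleftrightarrow> (s \<^bold>= t) \<in> H" for s t
    using inj_on_eq_iff[OF bij_betw_imp_inj_on[OF bij] rangeI rangeI, of s t] by (simp add: c_def cl)
  have "range c = UNIV"
    using bij unfolding bij_betw_def c_def by (simp add: image_image[symmetric])
  then have surj: "\<exists>t. c t = n" for n
  proof -
    have "n \<in> range c" using \<open>range c = UNIV\<close> by simp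
    then show ?thesis by blast
  qed
  define r where "r = (\<lambda>n. SOME t. c t = n)"
  have cr: "c (r n) = n" for n unfolding r_def using surj by (rule someI_ex)
  then have rc: "(r (c t) \<^bold>= t) \<in> H" for t using c_eq by blast
  define M where "M = \<lparr>mzero = c Zero, msucc = (\<lambda>x. c (Succ (r x))), madd = (\<lambda>x y. c (Add (r x) (r y))),
    mmul = (\<lambda>x y. c (Mul (r x) (r y))), mless = (\<lambda>x y. (r x \<^bold>< r y) \<in> H)\<rparr>"
  have evM: "ev M (\<lambda>i. c (\<sigma> i)) t = c (substt \<sigma> t)" for \<sigma> t
    by (induction t) (auto simp: M_def c_eq intro!: congS congA congM rc)
  have less: "(r (c s) \<^bold>< r (c t)) \<in> H \<longleftrightarrow> (s \<^bold>< t) \<in> H" for s t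
    using congL[OF rc rc, of s t] congL[OF sym[OF rc] sym[OF rc], of s t] by blast
  \<comment> \<open>All substitutions are needed at once, since a quantifier extends the assignment
    by the value of an arbitrary term.\<close>
  have truth: "holds M (\<lambda>i. c (\<sigma> i)) q \<longleftrightarrow> subst \<sigma> q \<in> H" for \<sigma> q
  proof (induction q arbitrary: \<sigma>)
    case (Less s t)
    have "mless M x y \<longleftrightarrow> (r x \<^bold>< r y) \<in> H" for x y by (simp add: M_def)
    then show ?case by (simp add: evM less)
  next
    case (Forall q)
    have "c t ## (\<lambda>i. c (\<sigma> i)) = (\<lambda>i. c ((t ## \<sigma>) i))" for t
      by (rule ext) (auto split: nat.split)
    then have "holds M (c t ## (\<lambda>i. c (\<sigma> i))) q \<longleftrightarrow> inst (subst (up \<sigma>) q) t \<in> H" for t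
      using Forall[of "t ## \<sigma>"] by (simp add: inst_subst_up)
    moreover have "(\<forall>x. P x) \<longleftrightarrow> (\<forall>t. P (c t))" for P using cr by metis
    ultimately show ?case by (simp add: H(5))
  qed (simp_all add: evM c_eq H(3,4))
  have truth': "holds M e q \<longleftrightarrow> subst (\<lambda>i. r (e i)) q \<in> H" for e q
    using truth[of "\<lambda>i. r (e i)" q] by (simp add: cr)
  have "models M T"
    unfolding models_def by (auto simp: truth' intro!: HT proves_subst[OF proves.Ax] T[rule_format])
  then have "holds M (\<lambda>i. c (V i)) p" by (rule valid)
  then have "p \<in> H" using truth[of V p] by simp
  then show False using H(1,3) by blast
qed

section \<open>Models of \<open>I\<Sigma>\<^sub>1\<close>\<close>

lemma scons_eta [simp]: "e 0 ## (\<lambda>i. e (Suc i)) = e"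
  by (rule ext) (auto split: nat.split)

lemma all_env: "(\<forall>e. holds M e (\<^bold>\<forall> p)) \<longleftrightarrow> (\<forall>e. holds M e p)"
proof
  assume "\<forall>e. holds M e (\<^bold>\<forall> p)"
  then have "holds M (e 0 ## (\<lambda>i. e (Suc i))) p" for e
    unfolding holds.simps by blast
  then show "\<forall>e. holds M e p" by simp
qed simp

lemma all_env_Forall: "(\<forall>e. holds M e ((Forall ^^ n) p)) \<longleftrightarrow> (\<forall>e. holds M e p)"
proof (induction n)
  case (Suc n)
  have "(Forall ^^ Suc n) p = (\<^bold>\<forall> (Forall ^^ n) p)" by simp
  then show ?case using Suc all_env by metis
qed simp

lemma all_env_closure: "(\<forall>e. holds M e (closure p)) \<longleftrightarrow> (\<forall>e. holds M e p)"
  unfolding closure_def by (rule all_env_Forall)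

lemma frees_Forall: "frees ((Forall ^^ n) p) = {i. i + n \<in> frees p}"
  by (induction n) auto

lemma frees_bound: "frees p \<subseteq> {..<bound p}"
proof -
  obtain k where "frees p \<subseteq> {..<k}"
    using finite_nat_iff_bounded[of "frees p"] by auto
  then show ?thesis unfolding bound_def by (rule LeastI)
qed

lemma sentence_closure: "sentence (closure p)"
  using frees_bound[of p] by (auto simp: closure_def frees_Forall)

lemma Delta0_subst: "Delta0 p \<Longrightarrow> Delta0 (subst \<sigma> p)"
proof (induction arbitrary: \<sigma> rule: Delta0.induct)
  case (5 p t)
  have "Delta0 (\<^bold>\<forall> (V 0 \<^bold>< lift 1 (substt \<sigma> t) \<^bold>\<longrightarrow> subst (up \<sigma>) p))"
    by (rule Delta0.intros) (rule 5)
  then show ?case using substt_up_lift[of \<sigma> t] by simp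
next
  case (6 p t)
  have "Delta0 (\<^bold>\<exists> (V 0 \<^bold>< lift 1 (substt \<sigma> t) \<^bold>\<and> subst (up \<sigma>) p))"
    by (rule Delta0.intros) (rule 6)
  then show ?case using substt_up_lift[of \<sigma> t] by simp
qed (auto intro: Delta0.intros)

text \<open>An even position of \<open>mix e\<close> holds a value of \<open>e\<close>, an odd one an element of the (countable) model, so that
  all elements of the model are available as parameters.\<close>

definition mix :: "(nat \<Rightarrow> 'm::countable) \<Rightarrow> nat \<Rightarrow> 'm" where
  "mix e k = (if even k then e (k div 2) else from_nat (k div 2))"

text \<open>Pushing a value onto \<open>mix e\<close> displaces every position by one. This renaming
  restores the layout: values move by two even positions, parameters stay at their odd ones.\<close>

definition unmix :: "nat \<Rightarrow> tm" where
  "unmix k = (if k = 0 then V 0 else if even k then V (k - 1) else V (k + 1))"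

lemma unmix: "(\<lambda>k. ev M (x ## mix e) (unmix k)) = mix (x ## e)"
proof
  fix k
  show "ev M (x ## mix e) (unmix k) = mix (x ## e) k"
  proof (cases "even k")
    case True
    then obtain j where j: "k = 2 * j" by blast
    show ?thesis by (cases j) (auto simp: unmix_def mix_def j)
  next
    case False
    then obtain j where j: "k = Suc (2 * j)" by (metis oddE Suc_eq_plus1)
    show ?thesis by (auto simp: unmix_def mix_def j)
  qed
qed

section \<open>Definability with parameters\<close>

definition tdef :: "'m::countable str \<Rightarrow> ((nat \<Rightarrow> 'm) \<Rightarrow> 'm) \<Rightarrow> bool" where
  "tdef M f \<longleftrightarrow> (\<exists>t. \<forall>e. ev M (mix e) t = f e)"

text \<open>Definability is a property of HOL predicates with closure rules, so that the premise of
  an induction is met by introduction rules and no formula has to be written.\<close>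

definition definable :: "'m::countable str \<Rightarrow> (fm \<Rightarrow> bool) \<Rightarrow> ((nat \<Rightarrow> 'm) \<Rightarrow> bool) \<Rightarrow> bool" where
  "definable M \<Gamma> P \<longleftrightarrow> (\<exists>p. \<Gamma> p \<and> (\<forall>e. holds M (mix e) p = P e))"

lemma tdef_var: "tdef M (\<lambda>e. e i)"
  unfolding tdef_def by (rule exI[of _ "V (2 * i)"]) (simp add: mix_def)

lemma tdef_const: "tdef M (\<lambda>e. a)"
  unfolding tdef_def by (rule exI[of _ "V (Suc (2 * to_nat a))"]) (simp add: mix_def)

lemma tdef_succ: "tdef M f \<Longrightarrow> tdef M (\<lambda>e. msucc M (f e))"
  unfolding tdef_def by (metis ev.simps(3))

lemma tdef_add: "tdef M f \<Longrightarrow> tdef M g \<Longrightarrow> tdef M (\<lambda>e. madd M (f e) (g e))"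
  unfolding tdef_def by (metis ev.simps(4))

lemma tdef_mul: "tdef M f \<Longrightarrow> tdef M g \<Longrightarrow> tdef M (\<lambda>e. mmul M (f e) (g e))"
  unfolding tdef_def by (metis ev.simps(5))

lemmas tdef_intros = tdef_const tdef_var tdef_succ tdef_add tdef_mul

abbreviation "d0 M \<equiv> definable M Delta0"

lemma d0_eq: "tdef M f \<Longrightarrow> tdef M g \<Longrightarrow> d0 M (\<lambda>e. f e = g e)"
  unfolding tdef_def definable_def by (metis holds.simps(1) Delta0.intros(1))

lemma d0_less: "tdef M f \<Longrightarrow> tdef M g \<Longrightarrow> d0 M (\<lambda>e. mless M (f e) (g e))"
  unfolding tdef_def definable_def by (metis holds.simps(2) Delta0.intros(2))

lemma d0_not: "d0 M P \<Longrightarrow> d0 M (\<lambda>e. \<not> P e)"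
  unfolding definable_def by (metis holds.simps(3) Delta0.intros(3))

lemma d0_imp: "d0 M P \<Longrightarrow> d0 M Q \<Longrightarrow> d0 M (\<lambda>e. P e \<longrightarrow> Q e)"
  unfolding definable_def by (metis holds.simps(4) Delta0.intros(4))

lemma d0_conj: "d0 M P \<Longrightarrow> d0 M Q \<Longrightarrow> d0 M (\<lambda>e. P e \<and> Q e)"
  using d0_not[OF d0_imp[OF _ d0_not], of M P Q] by simp

lemma d0_disj: "d0 M P \<Longrightarrow> d0 M Q \<Longrightarrow> d0 M (\<lambda>e. P e \<or> Q e)"
  using d0_imp[OF d0_not, of M P Q] by (simp add: disj_imp)

lemma d0_iff: "d0 M P \<Longrightarrow> d0 M Q \<Longrightarrow> d0 M (\<lambda>e. P e \<longleftrightarrow> Q e)"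
  unfolding iff_conv_conj_imp by (intro d0_conj d0_imp)

lemma d0_ball:
  assumes "tdef M t" and "d0 M (\<lambda>e. P (\<lambda>i. e (Suc i)) (e 0))"
  shows "d0 M (\<lambda>e. \<forall>x. mless M x (t e) \<longrightarrow> P e x)"
proof -
  from assms obtain s p where s: "\<And>e. ev M (mix e) s = t e" and "Delta0 p"
    and p: "\<And>e. holds M (mix e) p = P (\<lambda>i. e (Suc i)) (e 0)"
    unfolding tdef_def definable_def by blast
  have "Delta0 (\<^bold>\<forall> (V 0 \<^bold>< lift 1 s \<^bold>\<longrightarrow> subst unmix p))"
    by (intro Delta0.intros Delta0_subst) fact
  moreover have "holds M (mix e) (\<^bold>\<forall> (V 0 \<^bold>< lift 1 s \<^bold>\<longrightarrow> subst unmix p)) = (\<forall>x. mless M x (t e) \<longrightarrow> P e x)" for e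
    by (simp add: holds_subst unmix p s)
  ultimately show ?thesis unfolding definable_def by blast
qed

lemma d0_bex:
  assumes "tdef M t" and "d0 M (\<lambda>e. P (\<lambda>i. e (Suc i)) (e 0))"
  shows "d0 M (\<lambda>e. \<exists>x. mless M x (t e) \<and> P e x)"
  using d0_not[OF d0_ball[OF assms(1) d0_not[OF assms(2)]]] by simp

lemmas d0_intros = d0_iff d0_eq d0_less d0_not d0_conj d0_disj d0_imp d0_ball d0_bex tdef_intros

section \<open>Arithmetic and order in models of \<open>ISigma1\<close>\<close>

locale is1 =
  fixes M :: "'m::countable str"
  assumes models: "models M ISigma1"
begin

abbreviation zeroM ("\<zero>") where "\<zero> \<equiv> mzero M"
abbreviation "sc \<equiv> msucc M"
abbreviation addM (infixl "\<oplus>" 65) where "x \<oplus> y \<equiv> madd M x y"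
abbreviation mulM (infixl "\<otimes>" 70) where "x \<otimes> y \<equiv> mmul M x y"
abbreviation lessM (infix "\<prec>" 50) where "x \<prec> y \<equiv> mless M x y"
abbreviation "td \<equiv> tdef M"

lemma basic: "p \<in> basic_axioms \<Longrightarrow> holds M e p"
  using models by (auto simp: ISigma1_def models_def)

lemma succ_neq_zero [simp]: "sc x \<noteq> \<zero>" "\<zero> \<noteq> sc x"
  and succ_inj [simp]: "sc x = sc y \<longleftrightarrow> x = y"
  and add_zero [simp]: "x \<oplus> \<zero> = x"
  and add_succ [simp]: "x \<oplus> sc y = sc (x \<oplus> y)"
  and mul_zero [simp]: "x \<otimes> \<zero> = \<zero>"
  and mul_succ [simp]: "x \<otimes> sc y = x \<otimes> y \<oplus> x"
  and less_zero [simp]: "\<not> x \<prec> \<zero>"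
  and less_succ [simp]: "x \<prec> sc y \<longleftrightarrow> x \<prec> y \<or> x = y"
proof -
  note B = basic[unfolded basic_axioms_def, of _ "\<lambda>_. \<zero>"]
  show "sc x \<noteq> \<zero>" using B[of "\<^bold>\<forall> \<^bold>\<not> Succ (V 0) \<^bold>= Zero"] by simp
  then show "\<zero> \<noteq> sc x" by simp
  show "sc x = sc y \<longleftrightarrow> x = y"
    using B[of "\<^bold>\<forall> \<^bold>\<forall> Succ (V 1) \<^bold>= Succ (V 0) \<^bold>\<longrightarrow> V 1 \<^bold>= V 0"] by auto
  show "x \<oplus> \<zero> = x" using B[of "\<^bold>\<forall> Add (V 0) Zero \<^bold>= V 0"] by simp
  show "x \<oplus> sc y = sc (x \<oplus> y)"
    using B[of "\<^bold>\<forall> \<^bold>\<forall> Add (V 1) (Succ (V 0)) \<^bold>= Succ (Add (V 1) (V 0))"] by simp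
  show "x \<otimes> \<zero> = \<zero>" using B[of "\<^bold>\<forall> Mul (V 0) Zero \<^bold>= Zero"] by simp
  show "x \<otimes> sc y = x \<otimes> y \<oplus> x"
    using B[of "\<^bold>\<forall> \<^bold>\<forall> Mul (V 1) (Succ (V 0)) \<^bold>= Add (Mul (V 1) (V 0)) (V 1)"] by simp
  show "\<not> x \<prec> \<zero>" using B[of "\<^bold>\<forall> \<^bold>\<not> V 0 \<^bold>< Zero"] by simp
  show "x \<prec> sc y \<longleftrightarrow> x \<prec> y \<or> x = y"
    using B[of "\<^bold>\<forall> \<^bold>\<forall> V 1 \<^bold>< Succ (V 0) \<^bold>\<longleftrightarrow> V 1 \<^bold>< V 0 \<^bold>\<or> V 1 \<^bold>= V 0"] by simp blast
qed

lemma induct_Sigma1: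
  assumes "Sigma1 p" "holds M (\<zero> ## e) p" "\<And>x. holds M (x ## e) p \<Longrightarrow> holds M (sc x ## e) p"
  shows "holds M (x ## e) p"
proof -
  have "ind_axiom p \<in> ISigma1" using assms(1) by (simp add: ISigma1_def)
  then have "\<forall>e. holds M e (ind_axiom p)" using models by (simp add: models_def)
  then have "holds M e (inst p Zero \<^bold>\<longrightarrow>
     (\<^bold>\<forall> p \<^bold>\<longrightarrow> subst (case_nat (Succ (V 0)) (\<lambda>i. V (Suc i))) p) \<^bold>\<longrightarrow> (\<^bold>\<forall> p))"
    unfolding ind_axiom_def all_env_closure by blast
  moreover have "holds M (x ## e) (subst (case_nat (Succ (V 0)) (\<lambda>i. V (Suc i))) p) = holds M (sc x ## e) p" for x
    by (simp add: holds_subst scons_ev)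
  ultimately show ?thesis using assms(2,3) by simp
qed

lemma induct_d0:
  assumes "d0 M (\<lambda>e. Q (e 0))" "Q \<zero>" "\<And>x. Q x \<Longrightarrow> Q (sc x)"
  shows "Q x"
proof -
  from assms(1) obtain p where "Delta0 p" and p: "\<And>e. holds M (mix e) p = Q (e 0)"
    unfolding definable_def by blast
  define e where "e = mix (\<lambda>_::nat. \<zero>)"
  have q: "holds M (x ## e) (subst unmix p) = Q x" for x
    unfolding e_def holds_subst unmix by (simp add: p)
  have "Sigma1 (subst unmix p)" by (intro Sigma1.intros Delta0_subst) fact
  from induct_Sigma1[OF this, of e x] show ?thesis by (simp add: q assms)
qed

lemma add_zero_left [simp]: "\<zero> \<oplus> x = x"
  by (rule induct_d0[where x = x]) (intro d0_intros, simp_all)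

lemma add_succ_left [simp]: "sc x \<oplus> y = sc (x \<oplus> y)"
  by (rule induct_d0[where x = y]) (intro d0_intros, simp_all)

lemma add_comm: "x \<oplus> y = y \<oplus> x"
  by (rule induct_d0[where x = y]) (intro d0_intros, simp_all)

lemma add_assoc: "x \<oplus> y \<oplus> z = x \<oplus> (y \<oplus> z)"
  by (rule induct_d0[where x = z]) (intro d0_intros, simp_all)

lemma add_lcomm: "x \<oplus> (y \<oplus> z) = y \<oplus> (x \<oplus> z)"
  by (metis add_assoc add_comm)

lemmas add_ac = add_assoc add_comm add_lcomm

lemma mul_zero_left [simp]: "\<zero> \<otimes> x = \<zero>"
  by (rule induct_d0[where x = x]) (intro d0_intros, simp_all)

lemma mul_succ_left [simp]: "sc x \<otimes> y = x \<otimes> y \<oplus> y"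
  by (rule induct_d0[where x = y]) (intro d0_intros, simp_all add: add_ac)

lemma mul_comm: "x \<otimes> y = y \<otimes> x"
  by (rule induct_d0[where x = y]) (intro d0_intros, simp_all)

lemma distl: "x \<otimes> (y \<oplus> z) = x \<otimes> y \<oplus> x \<otimes> z"
  by (rule induct_d0[where x = z]) (intro d0_intros, simp_all add: add_ac)

lemma distr: "(y \<oplus> z) \<otimes> x = y \<otimes> x \<oplus> z \<otimes> x"
  using distl mul_comm by metis

lemma mul_assoc: "x \<otimes> y \<otimes> z = x \<otimes> (y \<otimes> z)"
  by (rule induct_d0[where x = z]) (intro d0_intros, simp_all add: distl)

lemma mul_lcomm: "x \<otimes> (y \<otimes> z) = y \<otimes> (x \<otimes> z)"
  by (metis mul_assoc mul_comm)

lemmas alg = add_ac mul_assoc mul_comm mul_lcomm distl distr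

lemma add_cancel [simp]: "x \<oplus> z = y \<oplus> z \<longleftrightarrow> x = y"
  by (rule induct_d0[where x = z]) (intro d0_intros, simp_all)

lemma add_cancel_left [simp]: "z \<oplus> x = z \<oplus> y \<longleftrightarrow> x = y"
  using add_cancel[of x z y] by (simp add: add_comm)

lemma zero_less_succ [simp]: "\<zero> \<prec> sc x"
  by (rule induct_d0[where x = x]) (intro d0_intros, simp_all)

lemma succ_less_succ: "sc x \<prec> sc y \<longleftrightarrow> x \<prec> y"
proof (rule induct_d0[where x = y])
  show "d0 M (\<lambda>e. (sc x \<prec> sc (e 0)) = (x \<prec> e 0))"
    by (intro d0_intros)
  fix y assume "sc x \<prec> sc y \<longleftrightarrow> x \<prec> y"
  then show "sc x \<prec> sc (sc y) \<longleftrightarrow> x \<prec> sc y"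
    using less_succ[of "sc x" "sc y"] less_succ[of x y] by (metis succ_inj)
qed simp

lemma cases_M: "x = \<zero> \<or> (\<exists>y. x = sc y)"
proof -
  have "x = \<zero> \<or> (\<exists>y. y \<prec> x \<and> x = sc y)"
    by (rule induct_d0[where x = x]) (intro d0_intros, auto)
  then show ?thesis by blast
qed

lemma less_irrefl [simp]: "\<not> x \<prec> x"
  by (rule induct_d0[where x = x]) (intro d0_intros, simp, simp add: succ_less_succ del: less_succ)

lemma zero_less: "\<zero> \<prec> x \<longleftrightarrow> x \<noteq> \<zero>"
  using cases_M[of x] zero_less_succ by (metis less_zero)

lemma less_linear: "x \<prec> y \<or> x = y \<or> y \<prec> x"
proof (rule induct_d0[where x = x])
  show "d0 M (\<lambda>e. e 0 \<prec> y \<or> e 0 = y \<or> y \<prec> e 0)" by (intro d0_intros)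
  show "\<zero> \<prec> y \<or> \<zero> = y \<or> y \<prec> \<zero>" by (auto simp: zero_less)
  fix x assume "x \<prec> y \<or> x = y \<or> y \<prec> x"
  then show "sc x \<prec> y \<or> sc x = y \<or> y \<prec> sc x"
    using less_succ[of "sc x" y] succ_less_succ[of x y] by auto
qed

lemma less_trans: "x \<prec> y \<Longrightarrow> y \<prec> z \<Longrightarrow> x \<prec> z"
proof -
  have "x \<prec> y \<longrightarrow> y \<prec> z \<longrightarrow> x \<prec> z"
    by (rule induct_d0[where x = z]) (intro d0_intros, auto)
  then show "x \<prec> y \<Longrightarrow> y \<prec> z \<Longrightarrow> x \<prec> z" by blast
qed

lemma less_asym: "x \<prec> y \<Longrightarrow> \<not> y \<prec> x"
  using less_trans less_irrefl by blast

lemma less_ex_add: "x \<prec> y \<longleftrightarrow> (\<exists>z. y = sc (x \<oplus> z))"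
proof
  have "x \<prec> y \<longrightarrow> (\<exists>z. z \<prec> y \<and> y = sc (x \<oplus> z))"
  proof (rule induct_d0[where x = y])
    show "d0 M (\<lambda>e. x \<prec> e 0 \<longrightarrow> (\<exists>z. z \<prec> e 0 \<and> e 0 = sc (x \<oplus> z)))" by (intro d0_intros)
    show "x \<prec> \<zero> \<longrightarrow> (\<exists>z. z \<prec> \<zero> \<and> \<zero> = sc (x \<oplus> z))" by simp
    fix y assume IH: "x \<prec> y \<longrightarrow> (\<exists>z. z \<prec> y \<and> y = sc (x \<oplus> z))"
    show "x \<prec> sc y \<longrightarrow> (\<exists>z. z \<prec> sc y \<and> sc y = sc (x \<oplus> z))"
    proof
      assume "x \<prec> sc y"
      then consider "x \<prec> y" | "x = y" by auto
      then show "\<exists>z. z \<prec> sc y \<and> sc y = sc (x \<oplus> z)"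
      proof cases
        case 1
        then obtain z where "z \<prec> y" "y = sc (x \<oplus> z)" using IH by blast
        then have "sc z \<prec> sc y \<and> sc y = sc (x \<oplus> sc z)"
          using succ_less_succ by simp
        then show ?thesis by blast
      next
        case 2
        then have "\<zero> \<prec> sc y \<and> sc y = sc (x \<oplus> \<zero>)" by (metis zero_less_succ add_zero)
        then show ?thesis by blast
      qed
    qed
  qed
  then show "x \<prec> y \<Longrightarrow> \<exists>z. y = sc (x \<oplus> z)" by blast
next
  have "x \<prec> sc (x \<oplus> z)" for z
    by (rule induct_d0[where x = z]) (intro d0_intros, auto)
  then show "\<exists>z. y = sc (x \<oplus> z) \<Longrightarrow> x \<prec> y" by blast
qed

lemma less_add_succ: "x \<prec> sc (x \<oplus> z)" "x \<prec> sc (z \<oplus> x)"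
proof -
  show "x \<prec> sc (x \<oplus> z)" unfolding less_ex_add by blast
  then show "x \<prec> sc (z \<oplus> x)" by (simp only: add_comm[of z x])
qed

lemma add_less [simp]: "x \<oplus> z \<prec> y \<oplus> z \<longleftrightarrow> x \<prec> y" "z \<oplus> x \<prec> z \<oplus> y \<longleftrightarrow> x \<prec> y"
proof -
  show "x \<oplus> z \<prec> y \<oplus> z \<longleftrightarrow> x \<prec> y"
    by (rule induct_d0[where x = z]) (intro d0_intros, simp_all add: succ_less_succ del: less_succ)
  then show "z \<oplus> x \<prec> z \<oplus> y \<longleftrightarrow> x \<prec> y" by (simp add: add_comm)
qed

definition leM (infix "\<preceq>" 50) where "x \<preceq> y \<longleftrightarrow> x \<prec> y \<or> x = y"

lemma le_ex_add: "x \<preceq> y \<longleftrightarrow> (\<exists>z. y = x \<oplus> z)"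
proof
  show "x \<preceq> y \<Longrightarrow> \<exists>z. y = x \<oplus> z"
    unfolding leM_def less_ex_add by (metis add_succ add_zero)
  assume "\<exists>z. y = x \<oplus> z"
  then obtain z where "y = x \<oplus> z" by blast
  then show "x \<preceq> y"
    using cases_M[of z] unfolding leM_def less_ex_add by auto
qed

lemma le_add [simp]: "x \<preceq> x \<oplus> y" "x \<preceq> y \<oplus> x" 
proof -
  show "x \<preceq> x \<oplus> y" unfolding le_ex_add by blast
  then show "x \<preceq> y \<oplus> x" by (simp only: add_comm[of y x])
qed
lemma not_less: "\<not> x \<prec> y \<longleftrightarrow> y \<preceq> x"
  unfolding leM_def using less_linear less_asym less_irrefl by blast
lemma less_le_trans: "x \<prec> y \<Longrightarrow> y \<preceq> z \<Longrightarrow> x \<prec> z"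
  unfolding leM_def using less_trans by blast
lemma le_trans: "x \<preceq> y \<Longrightarrow> y \<preceq> z \<Longrightarrow> x \<preceq> z"
  unfolding leM_def using less_trans by blast
lemma less_imp_le: "x \<prec> y \<Longrightarrow> x \<preceq> y" by (simp add: leM_def)
lemma less_succ_le: "x \<prec> sc y \<longleftrightarrow> x \<preceq> y" by (simp add: leM_def)

lemma mul_less_lin: "x \<prec> y \<Longrightarrow> x \<otimes> z \<oplus> z \<preceq> y \<otimes> z"
  unfolding less_ex_add le_ex_add by (auto simp: alg)

lemma bounded_pair: "\<exists>s. x \<prec> s \<and> y \<prec> s"
  by (rule exI[of _ "sc (x \<oplus> y)"]) (simp add: less_succ_le del: less_succ)

end

section \<open>\<open>\<Sigma>\<^sub>1\<close> definability\<close>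

text \<open>Arithmetised predicates have this shape but are not prenex; they become \<Sigma>1 in
  models of \<open>ISigma1\<close> through \<open>Sg_normal_form\<close>.\<close>

inductive Sg :: "fm \<Rightarrow> bool" where
  Delta0: "Delta0 p \<Longrightarrow> Sg p"
| And: "Sg p \<Longrightarrow> Sg q \<Longrightarrow> Sg (p \<^bold>\<and> q)"
| Or: "Sg p \<Longrightarrow> Sg q \<Longrightarrow> Sg (p \<^bold>\<or> q)"
| Ex: "Sg p \<Longrightarrow> Sg (\<^bold>\<exists> p)"
| Ball: "Sg p \<Longrightarrow> Sg (\<^bold>\<forall> (V 0 \<^bold>< lift 1 t \<^bold>\<longrightarrow> p))"

lemma Sg_subst: "Sg p \<Longrightarrow> Sg (subst \<sigma> p)"
proof (induction arbitrary: \<sigma> rule: Sg.induct)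
  case (Ball p t)
  have "Sg (\<^bold>\<forall> (V 0 \<^bold>< lift 1 (substt \<sigma> t) \<^bold>\<longrightarrow> subst (up \<sigma>) p))"
    by (rule Sg.intros) (rule Ball)
  then show ?case using substt_up_lift[of \<sigma> t] by simp
next
  case (Or p q)
  show ?case using Sg.Or[OF Or.IH] by simp
qed (auto intro: Sg.intros Delta0_subst)

lemma Sg_Sigma1: "Sigma1 p \<Longrightarrow> Sg p"
  by (induction rule: Sigma1.induct) (erule Sg.Delta0, erule Sg.Ex)

lemma Delta0_bex: "Delta0 p \<Longrightarrow> Delta0 (\<^bold>\<exists> (V 0 \<^bold>< V (Suc i) \<^bold>\<and> p))"
  using Delta0.intros(6)[of p "V i"] by simp

lemma Sg_ball: "Sg p \<Longrightarrow> Sg (\<^bold>\<forall> (V 0 \<^bold>< V (Suc i) \<^bold>\<longrightarrow> p))"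
  using Sg.Ball[of p "V i"] by simp

lemma tdef_sequence:
  assumes "\<forall>i. tdef M (\<lambda>e. f e i)"
  shows "\<exists>\<sigma>. \<forall>e. (\<lambda>i. ev M (mix e) (\<sigma> i)) = f e"
proof -
  from assms have "\<forall>i. \<exists>t. \<forall>e. ev M (mix e) t = f e i" unfolding tdef_def by blast
  then obtain \<sigma> where "\<forall>i e. ev M (mix e) (\<sigma> i) = f e i" by metis
  then have "\<forall>e. (\<lambda>i. ev M (mix e) (\<sigma> i)) = f e" by auto
  then show ?thesis by blast
qed

lemma d0_holds:
  assumes "Delta0 q" "\<And>i. tdef M (\<lambda>e. f e i)"
  shows "d0 M (\<lambda>e. holds M (f e) q)"
proof -
  obtain \<sigma> where \<sigma>: "\<And>e. (\<lambda>i. ev M (mix e) (\<sigma> i)) = f e"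
    using tdef_sequence[of M f] assms(2) by blast
  show ?thesis unfolding definable_def
    by (rule exI[of _ "subst \<sigma> q"]) (simp add: Delta0_subst assms holds_subst \<sigma>)
qed

abbreviation "s1 M \<equiv> definable M Sg"

lemma s1_holds:
  assumes "Sg q" "\<And>i. tdef M (\<lambda>e. f e i)"
  shows "s1 M (\<lambda>e. holds M (f e) q)"
proof -
  obtain \<sigma> where \<sigma>: "\<And>e. (\<lambda>i. ev M (mix e) (\<sigma> i)) = f e"
    using tdef_sequence[of M f] assms(2) by blast
  show ?thesis unfolding definable_def
    by (rule exI[of _ "subst \<sigma> q"]) (simp add: Sg_subst assms holds_subst \<sigma>)
qed

lemma tdef_scons:
  assumes "tdef M f" "\<And>i. tdef M (\<lambda>e. g e i)"
  shows "tdef M (\<lambda>e. (f e ## g e) i)"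
  using assms by (cases i) simp_all

lemma tdef_mix: "(\<And>i. tdef M (\<lambda>e. f e i)) \<Longrightarrow> tdef M (\<lambda>e. mix (f e) i)"
  unfolding mix_def by (cases "even i") (simp_all add: tdef_const)

lemma d0_comp:
  assumes "d0 M P" "\<And>i. tdef M (\<lambda>e. f e i)"
  shows "d0 M (\<lambda>e. P (f e))"
proof -
  from assms(1) obtain p where "Delta0 p" and p: "\<And>e. holds M (mix e) p = P e"
    unfolding definable_def by blast
  show ?thesis using d0_holds[OF \<open>Delta0 p\<close>, of M "\<lambda>e. mix (f e)"] assms(2) by (simp add: p tdef_mix)
qed

lemma s1_comp:
  assumes "s1 M P" "\<And>i. tdef M (\<lambda>e. f e i)"
  shows "s1 M (\<lambda>e. P (f e))"
proof -
  from assms(1) obtain p where "Sg p" and p: "\<And>e. holds M (mix e) p = P e"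
    unfolding definable_def by blast
  show ?thesis using s1_holds[OF \<open>Sg p\<close>, of M "\<lambda>e. mix (f e)"] assms(2) by (simp add: p tdef_mix)
qed

lemma d0_comp2: "d0 M (\<lambda>e. R (e 0) (e (Suc 0))) \<Longrightarrow> tdef M f \<Longrightarrow> tdef M g \<Longrightarrow> d0 M (\<lambda>e. R (f e) (g e))"
  using d0_comp[of M "\<lambda>e. R (e 0) (e (Suc 0))" "\<lambda>e. f e ## g e ## (\<lambda>_. undefined)"]
  by (simp add: tdef_scons tdef_const)

lemma s1_comp1: "s1 M (\<lambda>e. R (e 0)) \<Longrightarrow> tdef M f \<Longrightarrow> s1 M (\<lambda>e. R (f e))"
  using s1_comp[of M "\<lambda>e. R (e 0)" "\<lambda>e. f e ## (\<lambda>_. undefined)"]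
  by (simp add: tdef_scons tdef_const)

lemma s1_comp2: "s1 M (\<lambda>e. R (e 0) (e (Suc 0))) \<Longrightarrow> tdef M f \<Longrightarrow> tdef M g \<Longrightarrow> s1 M (\<lambda>e. R (f e) (g e))"
  using s1_comp[of M "\<lambda>e. R (e 0) (e (Suc 0))" "\<lambda>e. f e ## g e ## (\<lambda>_. undefined)"]
  by (simp add: tdef_scons tdef_const)

lemma s1_d0: "d0 M P \<Longrightarrow> s1 M P"
  unfolding definable_def using Sg.Delta0 by blast

lemma s1_conj: "s1 M P \<Longrightarrow> s1 M Q \<Longrightarrow> s1 M (\<lambda>e. P e \<and> Q e)"
proof -
  assume "s1 M P" "s1 M Q"
  then obtain p q where "Sg p" "Sg q" "\<And>e. holds M (mix e) p = P e" "\<And>e. holds M (mix e) q = Q e"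
    unfolding definable_def by blast
  then show ?thesis unfolding definable_def
    by (intro exI[of _ "p \<^bold>\<and> q"] conjI Sg.And) simp_all
qed

lemma s1_disj: "s1 M P \<Longrightarrow> s1 M Q \<Longrightarrow> s1 M (\<lambda>e. P e \<or> Q e)"
proof -
  assume "s1 M P" "s1 M Q"
  then obtain p q where "Sg p" "Sg q" "\<And>e. holds M (mix e) p = P e" "\<And>e. holds M (mix e) q = Q e"
    unfolding definable_def by blast
  then show ?thesis unfolding definable_def
    by (intro exI[of _ "p \<^bold>\<or> q"] conjI Sg.Or) auto
qed

lemma s1_ex: "s1 M (\<lambda>e. P (\<lambda>i. e (Suc i)) (e 0)) \<Longrightarrow> s1 M (\<lambda>e. \<exists>x. P e x)"
proof -
  assume "s1 M (\<lambda>e. P (\<lambda>i. e (Suc i)) (e 0))"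
  then obtain p where "Sg p" and p: "\<And>e. holds M (mix e) p = P (\<lambda>i. e (Suc i)) (e 0)"
    unfolding definable_def by blast
  have "Sg (\<^bold>\<exists> subst unmix p)" by (intro Sg.Ex Sg_subst) fact
  moreover have "holds M (mix e) (\<^bold>\<exists> subst unmix p) = (\<exists>x. P e x)" for e
    by (simp add: holds_subst unmix p)
  ultimately show ?thesis unfolding definable_def by blast
qed

lemma s1_ball:
  assumes "tdef M t" and "s1 M (\<lambda>e. P (\<lambda>i. e (Suc i)) (e 0))"
  shows "s1 M (\<lambda>e. \<forall>x. mless M x (t e) \<longrightarrow> P e x)"
proof -
  from assms obtain s p where s: "\<And>e. ev M (mix e) s = t e" and "Sg p"
    and p: "\<And>e. holds M (mix e) p = P (\<lambda>i. e (Suc i)) (e 0)"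
    unfolding tdef_def definable_def by blast
  have "Sg (\<^bold>\<forall> (V 0 \<^bold>< lift 1 s \<^bold>\<longrightarrow> subst unmix p))"
    by (intro Sg.Ball Sg_subst) fact
  moreover have "holds M (mix e) (\<^bold>\<forall> (V 0 \<^bold>< lift 1 s \<^bold>\<longrightarrow> subst unmix p)) = (\<forall>x. mless M x (t e) \<longrightarrow> P e x)" for e
    by (simp add: holds_subst unmix p s)
  ultimately show ?thesis unfolding definable_def by blast
qed

lemmas s1_eq = s1_d0[OF d0_eq]
lemmas s1_less = s1_d0[OF d0_less]
lemmas s1_not_less = s1_d0[OF d0_not[OF d0_less]]

lemmas s1_intros = s1_eq s1_less s1_not_less s1_conj s1_disj s1_ball s1_ex tdef_intros

section \<open>Collection and the normal form\<close>

context is1 begin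

text \<open>One unbounded quantifier before a bounded matrix is all that \<Sigma>1 induction offers
  directly. Collection is derived from this case, and the normal form from collection.\<close>

lemma induct_ex_d0:
  assumes "d0 M (\<lambda>e. Q (e 0) (e (Suc 0)))" "\<exists>s. Q s \<zero>" "\<And>x s. Q s x \<Longrightarrow> \<exists>s. Q s (sc x)"
  shows "\<exists>s. Q s x"
proof -
  from assms(1) obtain p where "Delta0 p" and p: "\<And>e. holds M (mix e) p = Q (e 0) (e (Suc 0))"
    unfolding definable_def by blast
  define e where "e = mix (\<lambda>_::nat. \<zero>)"
  define r where "r = subst unmix (\<^bold>\<exists> subst unmix p)"
  have q: "holds M (x ## e) r = (\<exists>s. Q s x)" for x
    unfolding e_def r_def holds_subst unmix by (simp add: holds_subst unmix p)
  have "Sigma1 r" unfolding r_def subst.simps by (intro Sigma1.intros Delta0_subst) fact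
  from induct_Sigma1[OF this, of e x] show ?thesis using assms(2,3) by (auto simp: q)
qed

text \<open>Induction on \<open>y\<close> extends a bound \<open>b\<close> for the arguments below
  \<open>y\<close> by a witness \<open>s\<close> for \<open>y\<close> to
  \<open>sc (b \<oplus> s)\<close>. The condition \<open>x \<prec> t\<close> stays inside because
  witnesses are guaranteed only below \<open>t\<close>.\<close>

lemma collection_d0:
  assumes d: "d0 M (\<lambda>e. R (e 0) (e (Suc 0)))" and ex: "\<And>x. x \<prec> t \<Longrightarrow> \<exists>s. R x s"
  shows "\<exists>b. \<forall>x. x \<prec> t \<longrightarrow> (\<exists>s. s \<prec> b \<and> R x s)"
proof -
  note R = d0_comp2[OF d]
  have "\<exists>b. \<forall>x. x \<prec> y \<longrightarrow> x \<prec> t \<longrightarrow> (\<exists>s. s \<prec> b \<and> R x s)" for y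
  proof (rule induct_ex_d0[where x = y])
    show "d0 M (\<lambda>e. \<forall>x. x \<prec> e (Suc 0) \<longrightarrow> x \<prec> t \<longrightarrow> (\<exists>s. s \<prec> e 0 \<and> R x s))"
      by (intro d0_intros R)
    fix y b assume b: "\<forall>x. x \<prec> y \<longrightarrow> x \<prec> t \<longrightarrow> (\<exists>s. s \<prec> b \<and> R x s)"
    obtain s where s: "y \<prec> t \<Longrightarrow> R y s" using ex by blast
    have "\<forall>x. x \<prec> sc y \<longrightarrow> x \<prec> t \<longrightarrow> (\<exists>s'. s' \<prec> sc (b \<oplus> s) \<and> R x s')"
    proof (intro allI impI)
      fix x assume "x \<prec> sc y" "x \<prec> t"
      then consider "x \<prec> y" | "x = y" by auto
      then show "\<exists>s'. s' \<prec> sc (b \<oplus> s) \<and> R x s'"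
      proof cases
        case 1
        then obtain s' where "s' \<prec> b" "R x s'" using b \<open>x \<prec> t\<close> by blast
        then show ?thesis using less_trans[OF _ less_add_succ(1)] by blast
      next
        case 2
        then show ?thesis using s \<open>x \<prec> t\<close> less_add_succ(2) by blast
      qed
    qed
    then show "\<exists>s. \<forall>x. x \<prec> sc y \<longrightarrow> x \<prec> t \<longrightarrow> (\<exists>s'. s' \<prec> s \<and> R x s')" by blast
  qed simp
  then show ?thesis by blast
qed

end

text \<open>The witness \<open>s\<close> is a common bound for all unbounded existential quantifiers of \<open>p\<close>.\<close>

lemma Sg_normal_form:
  assumes "Sg p"
  shows "\<exists>q. Delta0 q \<and> (\<forall>M :: 'm::countable str. models M ISigma1 \<longrightarrow>
    (\<forall>e. holds M e p \<longleftrightarrow> (\<exists>s. holds M (s ## e) q)))"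
  using assms
proof induction
  case (Delta0 p)
  show ?case
    by (intro exI[of _ "liftf p"]) (simp add: liftf_def Delta0_subst Delta0 holds_subst)
next
  case (And p q)
  then obtain p' q' where d: "Delta0 p'" "Delta0 q'"
    and p: "\<And>M :: 'm str. \<And>e. models M ISigma1 \<Longrightarrow> holds M e p = (\<exists>s. holds M (s ## e) p')"
    and q: "\<And>M :: 'm str. \<And>e. models M ISigma1 \<Longrightarrow> holds M e q = (\<exists>s. holds M (s ## e) q')"
    by blast
  let ?r = "subst (V 0 ## (\<lambda>i. V (Suc (Suc i))))"
  let ?q = "(\<^bold>\<exists> V 0 \<^bold>< V 1 \<^bold>\<and> ?r p') \<^bold>\<and> (\<^bold>\<exists> V 0 \<^bold>< V 1 \<^bold>\<and> ?r q')"
  have "Delta0 ?q" unfolding One_nat_def by (intro Delta0.intros(3,4) Delta0_bex Delta0_subst d)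
  moreover have "holds M e (p \<^bold>\<and> q) \<longleftrightarrow> (\<exists>s. holds M (s ## e) ?q)" if "models M ISigma1" for M :: "'m str" and e
  proof -
    interpret is1 M by unfold_locales fact
    have "holds M (s ## e) ?q \<longleftrightarrow> (\<exists>x. mless M x (s) \<and> holds M (x ## e) p') \<and> (\<exists>x. mless M x (s) \<and> holds M (x ## e) q')" for s
      by (simp add: holds_subst scons_ev)
    then show ?thesis using bounded_pair unfolding holds.simps p[OF that] q[OF that] by blast
  qed
  ultimately show ?case by blast
next
  case (Or p q)
  then obtain p' q' where d: "Delta0 p'" "Delta0 q'"
    and p: "\<And>M :: 'm str. \<And>e. models M ISigma1 \<Longrightarrow> holds M e p = (\<exists>s. holds M (s ## e) p')"
    and q: "\<And>M :: 'm str. \<And>e. models M ISigma1 \<Longrightarrow> holds M e q = (\<exists>s. holds M (s ## e) q')"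
    by blast
  have "Delta0 (p' \<^bold>\<or> q')" by (intro Delta0.intros(3,4) d)
  moreover have "holds M e (p \<^bold>\<or> q) \<longleftrightarrow> (\<exists>s. holds M (s ## e) (p' \<^bold>\<or> q'))" if "models M ISigma1" for M :: "'m str" and e
    unfolding holds.simps p[OF that] q[OF that] by blast
  ultimately show ?case by blast
next
  case (Ex p)
  then obtain p' where d: "Delta0 p'"
    and p: "\<And>M :: 'm str. \<And>e. models M ISigma1 \<Longrightarrow> holds M e p = (\<exists>s. holds M (s ## e) p')"
    by blast
  let ?q = "\<^bold>\<exists> V 0 \<^bold>< V 1 \<^bold>\<and> (\<^bold>\<exists> V 0 \<^bold>< V 2 \<^bold>\<and> subst (V 0 ## V 1 ## (\<lambda>i. V (i + 3))) p')"
  have "Delta0 ?q" unfolding One_nat_def numeral_2_eq_2 by (intro Delta0_bex Delta0_subst d)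
  moreover have "holds M e (\<^bold>\<exists> p) \<longleftrightarrow> (\<exists>s. holds M (s ## e) ?q)" if "models M ISigma1" for M :: "'m str" and e
  proof -
    interpret is1 M by unfold_locales fact
    have "holds M (s ## e) ?q \<longleftrightarrow> (\<exists>x. mless M x (s) \<and> (\<exists>y. mless M y (s) \<and> holds M (y ## x ## e) p'))" for s
      by (simp add: holds_subst scons_ev numeral_3_eq_3)
    then show ?thesis using bounded_pair unfolding holds.simps p[OF that] by blast
  qed
  ultimately show ?case by blast
next
  case (Ball p t)
  then obtain p' where d: "Delta0 p'"
    and p: "\<And>M :: 'm str. \<And>e. models M ISigma1 \<Longrightarrow> holds M e p = (\<exists>s. holds M (s ## e) p')"
    by blast
  let ?q = "\<^bold>\<forall> V 0 \<^bold>< lift 1 (lift 1 t) \<^bold>\<longrightarrow> (\<^bold>\<exists> V 0 \<^bold>< V 2 \<^bold>\<and> subst (V 0 ## V 1 ## (\<lambda>i. V (i + 3))) p')"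
  have "Delta0 ?q" unfolding numeral_2_eq_2 by (intro Delta0.intros(5) Delta0_bex Delta0_subst d)
  moreover have "holds M e (\<^bold>\<forall> V 0 \<^bold>< lift 1 t \<^bold>\<longrightarrow> p) \<longleftrightarrow> (\<exists>s. holds M (s ## e) ?q)"
    if "models M ISigma1" for M :: "'m str" and e
  proof -
    interpret is1 M by unfold_locales fact
    have q: "holds M (s ## e) ?q \<longleftrightarrow> (\<forall>x. mless M x (ev M e t) \<longrightarrow> (\<exists>y. mless M y (s) \<and> holds M (y ## x ## e) p'))" for s
      by (simp add: holds_subst scons_ev numeral_3_eq_3)
    \<comment> \<open>Each \<open>x\<close> below the value of \<open>t\<close> has its own witness;
      collection supplies the common bound that \<open>?q\<close> asks for.\<close>
    have "d0 M (\<lambda>e'. holds M (e' (Suc 0) ## e' 0 ## e) p')"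
      by (intro d0_holds d tdef_scons tdef_intros)
    from collection_d0[of "\<lambda>x s. holds M (s ## x ## e) p'", OF this, of "ev M e t"]
    show ?thesis unfolding q by (auto simp: p[OF that])
  qed
  ultimately show ?case by blast
qed

context is1 begin

lemma induct_s1 [case_names definable zero succ]:
  assumes "s1 M (\<lambda>e. Q (e 0))" "Q \<zero>" "\<And>x. Q x \<Longrightarrow> Q (sc x)"
  shows "Q x"
proof -
  from assms(1) obtain p where "Sg p" and p: "\<And>e. holds M (mix e) p = Q (e 0)"
    unfolding definable_def by blast
  define e where "e = mix (\<lambda>_::nat. \<zero>)"
  have "Sg (subst unmix p)" by (rule Sg_subst) fact
  then obtain q where "Delta0 q" and q: "\<And>e. holds M e (subst unmix p) = (\<exists>s. holds M (s ## e) q)"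
    using Sg_normal_form[where 'm = 'm] models by blast
  have q': "holds M (x ## e) (\<^bold>\<exists> q) = Q x" for x
    using q[of "x ## e"] unfolding e_def holds_subst unmix by (simp add: p)
  have "Sigma1 (\<^bold>\<exists> q)" by (intro Sigma1.intros) fact
  from induct_Sigma1[OF this, of e x] show ?thesis unfolding q' using assms by blast
qed

text \<open>A failure of \<open>Q\<close> at \<open>x\<close> can be pushed down one step at a time.
  That it can be pushed down \<open>z\<close> steps is \<Sigma>1, so induction on \<open>z\<close>
  yields \<open>sc x\<close> steps, more than there are below \<open>x\<close>.\<close>

lemma induct_p1 [case_names definable zero succ]:
  assumes "s1 M (\<lambda>e. \<not> Q (e 0))" "Q \<zero>" "\<And>x. Q x \<Longrightarrow> Q (sc x)"
  shows "Q x"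
proof (rule ccontr)
  assume n: "\<not> Q x"
  note Q = s1_comp1[OF assms(1)]
  have "\<exists>y. y \<oplus> z = x \<and> \<not> Q y" for z
  proof (induction z rule: induct_s1)
    case definable
    show ?case by (intro s1_intros Q)
  next
    case zero
    then show ?case using n by simp
  next
    case (succ z)
    then obtain y where "y \<oplus> z = x" "\<not> Q y" by blast
    moreover then obtain y' where "y = sc y'" using cases_M[of y] assms(2) by auto
    ultimately have "y' \<oplus> sc z = x \<and> \<not> Q y'" using assms(3) by auto
    then show ?case by blast
  qed
  then obtain y where "y \<oplus> sc x = x" by blast
  then show False using less_add_succ(2)[of x y] by simp
qed

lemma collection_s1:
  assumes d: "s1 M (\<lambda>e. R (e 0) (e (Suc 0)))" and ex: "\<And>x. x \<prec> t \<Longrightarrow> \<exists>s. R x s"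
  shows "\<exists>b. \<forall>x. x \<prec> t \<longrightarrow> (\<exists>s. s \<prec> b \<and> R x s)"
proof -
  note R = s1_comp2[OF d]
  \<comment> \<open>A disjunction replaces the implication because \<open>s1\<close> is not closed
    under implication.\<close>
  have "\<exists>b. \<forall>x. x \<prec> y \<longrightarrow> \<not> x \<prec> t \<or> (\<exists>s. s \<prec> b \<and> R x s)" for y
  proof (induction y rule: induct_s1)
    case definable
    show ?case by (intro s1_intros R)
  next
    case (succ y)
    then obtain b where b: "\<forall>x. x \<prec> y \<longrightarrow> \<not> x \<prec> t \<or> (\<exists>s. s \<prec> b \<and> R x s)" by blast
    obtain s where s: "y \<prec> t \<Longrightarrow> R y s" using ex by blast
    have "\<forall>x. x \<prec> sc y \<longrightarrow> \<not> x \<prec> t \<or> (\<exists>s'. s' \<prec> sc (b \<oplus> s) \<and> R x s')"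
      using b s less_trans[OF _ less_add_succ(1)] less_add_succ(2) by (metis less_succ)
    then show ?case by blast
  qed simp
  then show ?thesis by blast
qed

end

section \<open>Finite sequences and derivability\<close>

context is1 begin

section \<open>Pairing\<close>

definition prM :: "'m \<Rightarrow> 'm \<Rightarrow> 'm" where
  "prM x y = sc ((x \<oplus> y) \<otimes> (x \<oplus> y) \<oplus> x)"

lemma ev_pair [simp]: "ev M e \<langle>s, t\<rangle> = prM (ev M e s) (ev M e t)"
  by (simp add: pairt_def prM_def)

text \<open>The pairing separates squares: for \<open>x \<preceq> a \<prec> b\<close>, the number
  a^2 + x is less than (a + 1)^2 and so less than b^2.\<close>

lemma pair_less:
  assumes "x \<preceq> a" "a \<prec> b" "z = b \<otimes> b \<oplus> x'"
  shows "a \<otimes> a \<oplus> x \<noteq> z"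
proof -
  obtain u where a: "a = x \<oplus> u" using assms(1) le_ex_add by blast
  obtain w where b: "b = sc (a \<oplus> w)" using assms(2) less_ex_add by blast
  have "\<exists>v. z = sc (a \<otimes> a \<oplus> x \<oplus> v)"
    \<comment> \<open>The expanded difference: of the two linear terms \<open>a\<close> in the
      square of \<open>sc (a \<oplus> w)\<close>, one is split as
      \<open>x \<oplus> u\<close>.\<close>
    by (rule exI[of _ "u \<oplus> a \<oplus> (w \<otimes> a \<oplus> w \<oplus> a \<otimes> w \<oplus> w \<otimes> w \<oplus> w) \<oplus> x'"])
      (simp add: assms(3) b a alg)
  then have "a \<otimes> a \<oplus> x \<prec> z" unfolding less_ex_add .
  then show ?thesis by auto
qed

lemma prM_inj [simp]: "prM x y = prM x' y' \<longleftrightarrow> x = x' \<and> y = y'"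
proof
  assume e: "prM x y = prM x' y'"
  let ?a = "x \<oplus> y" and ?b = "x' \<oplus> y'"
  have "?a \<otimes> ?a \<oplus> x = ?b \<otimes> ?b \<oplus> x'" using e by (simp add: prM_def)
  moreover from this have "?a = ?b"
    using pair_less[of x ?a ?b _ x'] pair_less[of x' ?b ?a _ x] less_linear[of ?a ?b] le_add by metis
  ultimately show "x = x' \<and> y = y'" by simp
qed simp

section \<open>The beta function\<close>

definition bt :: "'m \<Rightarrow> 'm \<Rightarrow> 'm \<Rightarrow> 'm \<Rightarrow> bool" where
  "bt a b i z \<longleftrightarrow> z \<prec> sc (sc i \<otimes> b) \<and> (\<exists>q. a = q \<otimes> sc (sc i \<otimes> b) \<oplus> z)"

lemma holds_Beta [simp]: "holds M e (Beta a b i z) \<longleftrightarrow> bt (ev M e a) (ev M e b) (ev M e i) (ev M e z)"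
  by (simp add: Beta_def Let_def bt_def del: mul_succ mul_succ_left less_succ)

lemma s1_bt: "td f \<Longrightarrow> td g \<Longrightarrow> td h \<Longrightarrow> td k \<Longrightarrow> s1 M (\<lambda>e. bt (f e) (g e) (h e) (k e))"
proof -
  assume t: "td f" "td g" "td h" "td k"
  have "Sg (Beta (V 0) (V 1) (V 2) (V 3))"
    unfolding Beta_def Let_def by (intro Sg.And Sg.Ex Sg.Delta0 Delta0.intros)
  from s1_holds[OF this, of M "\<lambda>e. f e ## g e ## h e ## k e ## (\<lambda>_. \<zero>)"]
  show ?thesis using t by (simp add: tdef_scons tdef_const)
qed

lemma div_unique_less: "z \<prec> m \<Longrightarrow> q \<prec> q' \<Longrightarrow> q \<otimes> m \<oplus> z \<prec> q' \<otimes> m \<oplus> z'"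
proof -
  assume "z \<prec> m" "q \<prec> q'"
  then have "q \<otimes> m \<oplus> z \<prec> q \<otimes> m \<oplus> m" "q \<otimes> m \<oplus> m \<preceq> q' \<otimes> m"
    using mul_less_lin by simp_all
  then show ?thesis using less_le_trans le_add(1) by metis
qed

lemma bt_unique: "bt a b i z \<Longrightarrow> bt a b i z' \<Longrightarrow> z = z'"
proof -
  assume "bt a b i z" "bt a b i z'"
  then obtain q q' where q: "a = q \<otimes> sc (sc i \<otimes> b) \<oplus> z" "a = q' \<otimes> sc (sc i \<otimes> b) \<oplus> z'"
    and z: "z \<prec> sc (sc i \<otimes> b)" "z' \<prec> sc (sc i \<otimes> b)" unfolding bt_def by blast
  from q have "q \<otimes> sc (sc i \<otimes> b) \<oplus> z = q' \<otimes> sc (sc i \<otimes> b) \<oplus> z'" by metis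
  then have "q = q'"
    using div_unique_less[OF z(1), of q q' z'] div_unique_less[OF z(2), of q' q z] less_linear[of q q'] less_irrefl
    by metis
  then show ?thesis using q by (metis add_cancel_left)
qed

text \<open>A substitute for the factorial, which would itself need coded sequences.\<close>

lemma common_multiple: "\<exists>b. b \<noteq> \<zero> \<and> (\<forall>k. k \<prec> n \<longrightarrow> (\<exists>c. b = sc k \<otimes> c))"
proof (induction n rule: induct_s1)
  case definable
  show ?case by (intro s1_d0[OF d0_not[OF d0_eq]] s1_intros)
next
  case zero
  show ?case by (rule exI[of _ "sc \<zero>"]) simp
next
  case (succ n)
  then obtain b where b: "b \<noteq> \<zero>" "\<And>k. k \<prec> n \<Longrightarrow> \<exists>c. b = sc k \<otimes> c" by blast
  have "b \<otimes> sc n \<noteq> \<zero>" using b(1) cases_M[of b] by auto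
  moreover have "\<exists>c. b \<otimes> sc n = sc k \<otimes> c" if "k \<prec> sc n" for k
  proof (cases "k = n")
    case True
    then show ?thesis using mul_comm by blast
  next
    case False
    then have "k \<prec> n" using that by simp
    then obtain c where "b = sc k \<otimes> c" using b(2) by blast
    then have "b \<otimes> sc n = sc k \<otimes> (c \<otimes> sc n)" by (simp only: mul_assoc)
    then show ?thesis by blast
  qed
  ultimately show ?case by blast
qed

text \<open>Coprimality as a Bezout identity without subtraction; the coefficient \<open>u\<close>
  is what \<open>bt_extend\<close> uses.\<close>

definition inv_mod :: "'m \<Rightarrow> 'm \<Rightarrow> bool" where
  "inv_mod x m \<longleftrightarrow> (\<exists>u v. u \<otimes> x = sc (v \<otimes> m))"

lemma inv_mod_mul: "inv_mod x m \<Longrightarrow> inv_mod y m \<Longrightarrow> inv_mod (x \<otimes> y) m"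
proof -
  assume "inv_mod x m" "inv_mod y m"
  then obtain u v u' v' where "u \<otimes> x = sc (v \<otimes> m)" "u' \<otimes> y = sc (v' \<otimes> m)"
    unfolding inv_mod_def by blast
  moreover have "u \<otimes> u' \<otimes> (x \<otimes> y) = (u \<otimes> x) \<otimes> (u' \<otimes> y)" by (simp add: alg)
  ultimately have "u \<otimes> u' \<otimes> (x \<otimes> y) = sc ((v \<otimes> (m \<otimes> v') \<oplus> v \<oplus> v') \<otimes> m)" by (simp add: alg)
  then show ?thesis unfolding inv_mod_def by blast
qed

text \<open>With \<open>b = r c\<close>, \<open>q\<^sub>k = 1 + K b\<close>, \<open>q\<^sub>j = 1 + J b\<close>, \<open>J = K + r\<close>: \<open>q\<^sub>k c J\<^sup>2 + 1 = q\<^sub>j (c J K + 1)\<close>, so \<open>q\<^sub>k c J\<^sup>2\<close>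
  is \<open>-1\<close> modulo \<open>q\<^sub>j\<close> and its square is \<open>1\<close>.\<close>

lemma inv_mod_moduli:
  assumes "k \<prec> j" "b \<noteq> \<zero>" "\<And>i. i \<prec> j \<Longrightarrow> \<exists>c. b = sc i \<otimes> c"
  shows "inv_mod (sc (sc k \<otimes> b)) (sc (sc j \<otimes> b))"
proof -
  obtain r where j: "j = sc (k \<oplus> r)" using assms(1) less_ex_add by blast
  then have "r \<prec> j" using less_add_succ(2) by blast
  then obtain c where b: "b = sc r \<otimes> c" using assms(3) by blast
  have "c \<noteq> \<zero>" using assms(2) b by auto
  then obtain c' where c: "c = sc c'" using cases_M by blast
  define K R J where "K = sc k" and "R = sc r" and "J = K \<oplus> R"
  have J: "sc j = J" by (simp add: J_def K_def R_def j)
  define X Y where "X = c \<otimes> (J \<otimes> J)" and "Y = sc (c \<otimes> (J \<otimes> K))"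
  define qk qj where "qk = sc (K \<otimes> (R \<otimes> c))" and "qj = sc (J \<otimes> (R \<otimes> c))"
  have e: "sc (qk \<otimes> X) = qj \<otimes> Y"
    unfolding qk_def qj_def X_def Y_def J_def by (simp add: alg)
  obtain T where T: "qk \<otimes> X = sc T"
    unfolding X_def qk_def c J_def K_def by simp
  have "X \<otimes> qk \<otimes> X \<otimes> qk = (qk \<otimes> X) \<otimes> (qk \<otimes> X)" by (simp add: alg)
  also have "\<dots> = sc (T \<otimes> sc (sc T))" unfolding T by (simp add: alg)
  also have "T \<otimes> sc (sc T) = (T \<otimes> Y) \<otimes> qj"
    using e unfolding T by (simp only: mul_assoc mul_comm[of qj])
  finally have "inv_mod qk qj" unfolding inv_mod_def by blast
  then show ?thesis unfolding qk_def qj_def J b K_def R_def .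
qed

text \<open>The step of the Chinese remainder theorem. With \<open>w = sc k \<otimes> b\<close>,
  modulo \<open>sc w\<close> the product of \<open>u\<close> and \<open>P\<close> is 1 and
  \<open>w\<close> is -1, so the added term contributes z - a.\<close>

lemma bt_extend:
  assumes "u \<otimes> P = sc (v \<otimes> sc (sc k \<otimes> b))" "z \<prec> sc (sc k \<otimes> b)"
  shows "bt (a \<oplus> P \<otimes> (u \<otimes> (z \<oplus> (sc k \<otimes> b) \<otimes> a))) b k z"
proof -
  define w where "w = sc k \<otimes> b"
  have "P \<otimes> (u \<otimes> (z \<oplus> w \<otimes> a)) = sc (v \<otimes> sc w) \<otimes> (z \<oplus> w \<otimes> a)"
    using assms(1) unfolding w_def by (metis mul_assoc mul_comm)
  then have "a \<oplus> P \<otimes> (u \<otimes> (z \<oplus> w \<otimes> a)) = (v \<otimes> (z \<oplus> w \<otimes> a) \<oplus> a) \<otimes> sc w \<oplus> z"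
    by (simp add: alg)
  then show ?thesis using assms(2) unfolding bt_def w_def by blast
qed

lemma bt_add_multiple:
  assumes "bt a b i z" "P = sc (sc i \<otimes> b) \<otimes> c"
  shows "bt (a \<oplus> P \<otimes> t) b i z"
proof -
  from assms obtain q where q: "a = q \<otimes> sc (sc i \<otimes> b) \<oplus> z" and z: "z \<prec> sc (sc i \<otimes> b)"
    unfolding bt_def by blast
  define m where "m = sc (sc i \<otimes> b)"
  have "a \<oplus> P \<otimes> t = (q \<oplus> c \<otimes> t) \<otimes> m \<oplus> z"
    unfolding q assms(2) m_def[symmetric] by (simp add: alg)
  then show ?thesis unfolding bt_def m_def using z by blast
qed

text \<open>The entries are coded one by one: adding a multiple of the product of the earlier moduli
  sets the next entry and leaves the earlier ones alone.\<close>

lemma comprehension: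
  assumes d: "s1 M (\<lambda>e. R (e 0) (e (Suc 0)))" and ex: "\<And>x. x \<prec> l \<Longrightarrow> \<exists>s. R x s"
  shows "\<exists>a b. \<forall>i. i \<prec> l \<longrightarrow> (\<exists>z. R i z \<and> bt a b i z)"
proof -
  obtain m where m: "\<And>x. x \<prec> l \<Longrightarrow> \<exists>s. s \<prec> m \<and> R x s"
    using collection_s1[OF d, of l] ex by blast
  note R = s1_comp2[OF d]
  obtain b0 where b0: "b0 \<noteq> \<zero>" "\<And>k. k \<prec> l \<Longrightarrow> \<exists>c. b0 = sc k \<otimes> c" using common_multiple by blast
  \<comment> \<open>Divisibility of \<open>b0\<close> by the numbers up to \<open>l\<close> makes
    the moduli pairwise coprime; the factor \<open>sc m\<close> makes them exceed all chosen
    values.\<close>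
  define b where "b = b0 \<otimes> sc m"
  have b: "\<exists>c. b = sc k \<otimes> c" if "k \<prec> l" for k
    using b0(2)[OF that] unfolding b_def by (metis mul_assoc)
  obtain b1 where b1: "b0 = sc b1" using b0(1) cases_M by blast
  then have "b \<noteq> \<zero>" by (simp add: b_def)
  have "m \<preceq> b" unfolding b_def b1 le_ex_add
    by (rule exI[of _ "sc (b1 \<otimes> m \<oplus> b1)"]) (simp add: alg)
  have mm: "m \<prec> sc (sc i \<otimes> b)" for i
    using \<open>m \<preceq> b\<close> le_trans le_add(2) by (metis less_succ_le mul_succ_left)
  \<comment> \<open>\<open>P\<close> stands for the product of the first \<open>k\<close> moduli. It
    is described by the two properties in use, which keeps the induction formula \<Sigma>1; the
    disjunct \<open>l \<prec> k\<close> ends the construction at \<open>l\<close>.\<close>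
  have "l \<prec> k \<or> (\<exists>a P. (\<forall>i. i \<prec> k \<longrightarrow> (\<exists>z. R i z \<and> bt a b i z) \<and> (\<exists>c. P = sc (sc i \<otimes> b) \<otimes> c)) \<and>
      (\<forall>j. j \<prec> l \<longrightarrow> j \<prec> k \<or> (\<exists>u v. u \<otimes> P = sc (v \<otimes> sc (sc j \<otimes> b)))))" for k
  proof (induction k rule: induct_s1)
    case definable
    show ?case by (intro s1_intros R s1_bt)
  next
    case zero
    have "sc \<zero> \<otimes> sc \<zero> = sc (\<zero> \<otimes> sc (sc j \<otimes> b))" for j by simp
    then show ?case by (metis less_zero)
  next
    case (succ k)
    show ?case
    proof (cases "k \<prec> l")
      case False
      then show ?thesis using less_linear[of k l] by auto
    next
      case True
      then have "\<not> l \<prec> k" using less_asym by blast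
      with succ obtain a P where
        1: "\<And>i. i \<prec> k \<Longrightarrow> (\<exists>z. R i z \<and> bt a b i z) \<and> (\<exists>c. P = sc (sc i \<otimes> b) \<otimes> c)" and
        2: "\<And>j. j \<prec> l \<Longrightarrow> j \<prec> k \<or> inv_mod P (sc (sc j \<otimes> b))" unfolding inv_mod_def by blast
      obtain u v where uv: "u \<otimes> P = sc (v \<otimes> sc (sc k \<otimes> b))" using 2[OF True] unfolding inv_mod_def by auto
      obtain z where z: "z \<prec> m" "R k z" using m True by blast
      have zk: "z \<prec> sc (sc k \<otimes> b)" using less_trans[OF z(1) mm] .
      define t where "t = u \<otimes> (z \<oplus> (sc k \<otimes> b) \<otimes> a)"
      define a' where "a' = a \<oplus> P \<otimes> t"
      define P' where "P' = P \<otimes> sc (sc k \<otimes> b)"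
      have "(\<exists>z. R i z \<and> bt a' b i z) \<and> (\<exists>c. P' = sc (sc i \<otimes> b) \<otimes> c)" if i: "i \<prec> sc k" for i
      proof (cases "i = k")
        case True
        have "bt a' b k z" unfolding a'_def t_def by (rule bt_extend[OF uv zk])
        moreover have "P' = sc (sc k \<otimes> b) \<otimes> P" by (simp only: P'_def mul_comm)
        ultimately show ?thesis using z True by blast
      next
        case False
        then have "i \<prec> k" using i by simp
        then obtain z' c where "R i z'" "bt a b i z'" and c: "P = sc (sc i \<otimes> b) \<otimes> c" using 1 by blast
        moreover have "bt a' b i z'" unfolding a'_def by (rule bt_add_multiple) fact+
        moreover have "P' = sc (sc i \<otimes> b) \<otimes> (c \<otimes> sc (sc k \<otimes> b))" unfolding P'_def c by (simp only: mul_assoc)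
        ultimately show ?thesis by blast
      qed
      moreover have "j \<prec> sc k \<or> inv_mod P' (sc (sc j \<otimes> b))" if j: "j \<prec> l" for j
      proof (cases "k \<prec> j")
        case True
        have "inv_mod P (sc (sc j \<otimes> b))" using 2[OF j] True less_asym by blast
        moreover have "inv_mod (sc (sc k \<otimes> b)) (sc (sc j \<otimes> b))"
          using inv_mod_moduli[OF True \<open>b \<noteq> \<zero>\<close>] b less_trans j by blast
        ultimately show ?thesis unfolding P'_def using inv_mod_mul by blast
      next
        case False
        then show ?thesis using less_linear[of k j] by auto
      qed
      ultimately show ?thesis unfolding inv_mod_def by blast
    qed
  qed
  from this[of l] show ?thesis by auto
qed

section \<open>Derivation sequences in a model\<close>

definition lst :: "'m \<Rightarrow> 'm \<Rightarrow> 'm \<Rightarrow> 'm \<Rightarrow> bool" where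
  "lst a b l x \<longleftrightarrow> (\<exists>i. i \<prec> l \<and> bt a b i x)"

lemma holds_Listed [simp]: "holds M e (Listed a b l x) \<longleftrightarrow> lst (ev M e a) (ev M e b) (ev M e l) (ev M e x)"
  by (simp add: Listed_def lst_def)

definition derM :: "(('m \<Rightarrow> bool) \<Rightarrow> 'm \<Rightarrow> bool) \<Rightarrow> 'm \<Rightarrow> bool" where
  "derM R x \<longleftrightarrow> (\<exists>a b l. lst a b l x \<and> (\<forall>i. i \<prec> l \<longrightarrow> (\<exists>y. bt a b i y \<and> R (lst a b i) y)))"

lemma holds_Derivable:
  assumes "\<And>y i l b a. holds M (y ## i ## l ## b ## a ## e)
    (R (\<lambda>d v. Listed (V (4 + d)) (V (3 + d)) (V (1 + d)) v)) = R' (lst a b i) y"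
  shows "holds M e (Derivable R x) \<longleftrightarrow> derM R' (ev M e x)"
  unfolding Derivable_def derM_def using assms by (simp add: eval_nat_numeral)

text \<open>Entries before \<open>x\<close> belong to the same valid sequence, hence are derivable
  themselves; \<open>bt_unique\<close> identifies the entry that the sequence justifies with
  \<open>x\<close>.\<close>

lemma derM_unfold:
  assumes "mono R" "derM R x"
  shows "R (derM R) x"
proof -
  from assms obtain a b l i where i: "i \<prec> l" "bt a b i x"
    and l: "\<forall>i. i \<prec> l \<longrightarrow> (\<exists>y. bt a b i y \<and> R (lst a b i) y)" unfolding derM_def lst_def by blast
  then have "R (lst a b i) x" using bt_unique by metis
  moreover have "lst a b i \<le> derM R"
  proof (rule predicate1I)
    fix y
    assume "lst a b i y"
    then obtain k where "k \<prec> i" "bt a b k y" unfolding lst_def by blast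
    then have "lst a b l y" using i(1) less_trans unfolding lst_def by blast
    then show "derM R y" using l unfolding derM_def by blast
  qed
  ultimately show ?thesis using monoD[OF assms(1)] by (meson le_funE le_boolE)
qed

lemma derM_intro0:
  assumes "R (\<lambda>_. False) x"
  shows "derM R x"
proof -
  have "\<exists>a b. \<forall>i. i \<prec> sc \<zero> \<longrightarrow> (\<exists>z. z = x \<and> bt a b i z)"
    by (rule comprehension) (intro s1_intros, blast)
  then obtain a b where "bt a b \<zero> x" by auto
  moreover have "lst a b \<zero> = (\<lambda>_. False)" by (auto simp: lst_def)
  ultimately show ?thesis using assms unfolding derM_def lst_def
    by (intro exI[of _ a] exI[of _ b] exI[of _ "sc \<zero>"]) auto
qed

text \<open>The two sequences are concatenated and \<open>x\<close> is appended;
  \<open>comprehension\<close> codes the result. No rule of the arithmetised syntax has more than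
  two premises of this kind.\<close>

lemma derM_intro2:
  assumes R: "mono R" and d: "derM R y1" "derM R y2" and x: "R (\<lambda>v. v = y1 \<or> v = y2) x"
  shows "derM R x"
proof -
  from d(1) obtain a1 b1 l1 i1 where 1: "i1 \<prec> l1" "bt a1 b1 i1 y1"
    "\<And>i. i \<prec> l1 \<Longrightarrow> \<exists>y. bt a1 b1 i y \<and> R (lst a1 b1 i) y" unfolding derM_def lst_def by blast
  from d(2) obtain a2 b2 l2 i2 where 2: "i2 \<prec> l2" "bt a2 b2 i2 y2"
    "\<And>i. i \<prec> l2 \<Longrightarrow> \<exists>y. bt a2 b2 i y \<and> R (lst a2 b2 i) y" unfolding derM_def lst_def by blast
  define Q where "Q = (\<lambda>i z. (i \<prec> l1 \<and> bt a1 b1 i z) \<or> (\<exists>k. k \<prec> l2 \<and> i = l1 \<oplus> k \<and> bt a2 b2 k z) \<or>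
    (i = l1 \<oplus> l2 \<and> z = x))"
  have tri: "i \<prec> l1 \<or> (\<exists>k. k \<prec> l2 \<and> i = l1 \<oplus> k) \<or> i = l1 \<oplus> l2" if "i \<prec> sc (l1 \<oplus> l2)" for i
  proof (cases "i \<prec> l1")
    case False
    then obtain k where "i = l1 \<oplus> k" using not_less le_ex_add by metis
    then show ?thesis using that by auto
  qed simp
  have "\<exists>a b. \<forall>i. i \<prec> sc (l1 \<oplus> l2) \<longrightarrow> (\<exists>z. Q i z \<and> bt a b i z)"
  proof (rule comprehension)
    show "s1 M (\<lambda>e. Q (e 0) (e (Suc 0)))"
      unfolding Q_def by (intro s1_intros s1_bt)
    show "\<exists>z. Q i z" if "i \<prec> sc (l1 \<oplus> l2)" for i
      using tri[OF that] 1(3) 2(3) unfolding Q_def by blast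
  qed
  then obtain a b where ab: "\<And>i. i \<prec> sc (l1 \<oplus> l2) \<Longrightarrow> \<exists>z. Q i z \<and> bt a b i z" by blast
  have le1: "i \<prec> sc (l1 \<oplus> l2)" if "i \<prec> l1" for i
    using that less_trans less_add_succ(1) by blast
  have le2: "l1 \<oplus> k \<prec> sc (l1 \<oplus> l2)" if "k \<prec> l2" for k using that by simp
  have nl: "\<not> l1 \<oplus> k \<prec> l1" for k unfolding not_less by simp
  have e1: "bt a b i z" if "i \<prec> l1" "bt a1 b1 i z" for i z
    using ab[OF le1[OF that(1)]] that bt_unique nl unfolding Q_def by blast
  have e2: "bt a b (l1 \<oplus> k) z" if "k \<prec> l2" "bt a2 b2 k z" for k z
    using ab[OF le2[OF that(1)]] that bt_unique nl less_irrefl unfolding Q_def by (metis add_cancel_left)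
  have e3: "bt a b (l1 \<oplus> l2) x"
    using ab[of "l1 \<oplus> l2"] nl less_irrefl unfolding Q_def by (metis add_cancel_left less_succ)
  have mono: "R E y \<Longrightarrow> (\<And>v. E v \<Longrightarrow> E' v) \<Longrightarrow> R E' y" for E E' y
    using monoD[OF R, of E E'] by (auto simp: le_fun_def)
  have "\<exists>y. bt a b i y \<and> R (lst a b i) y" if i: "i \<prec> sc (l1 \<oplus> l2)" for i
    using tri[OF i]
  proof (elim disjE exE conjE)
    assume i: "i \<prec> l1"
    then obtain y where "bt a1 b1 i y" "R (lst a1 b1 i) y" using 1 by blast
    moreover have "lst a b i v" if "lst a1 b1 i v" for v
      using that i less_trans e1 unfolding lst_def by blast
    ultimately show ?thesis using mono e1 i by blast
  next
    fix k assume k: "k \<prec> l2" "i = l1 \<oplus> k"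
    then obtain y where "bt a2 b2 k y" "R (lst a2 b2 k) y" using 2 by blast
    moreover have "lst a b i v" if "lst a2 b2 k v" for v
      using that k less_trans e2 add_less(2) unfolding lst_def by metis
    ultimately show ?thesis using mono e2 k by blast
  next
    assume i: "i = l1 \<oplus> l2"
    have "i1 \<prec> l1 \<oplus> l2" "l1 \<oplus> i2 \<prec> l1 \<oplus> l2" using less_le_trans[OF 1(1) le_add(1)] 2(1) by auto
    then have "lst a b i y1" "lst a b i y2" using e1 e2 1 2 i unfolding lst_def by blast+
    then show ?thesis using mono[OF x, of "lst a b i"] e3 i by blast
  qed
  moreover have "lst a b (sc (l1 \<oplus> l2)) x" using e3 unfolding lst_def by auto
  ultimately show ?thesis unfolding derM_def by blast
qed

lemma derM_intro1:
  assumes "mono R" "derM R y" "R (\<lambda>v. v = y) x"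
  shows "derM R x"
  using derM_intro2[OF assms(1,2,2)] assms(3) by simp

end

section \<open>Codes of expressions in models\<close>

declare num.simps [simp del]

context is1 begin

section \<open>Standard elements\<close>

primrec nm :: "nat \<Rightarrow> 'm" where
  "nm 0 = \<zero>"
| "nm (Suc n) = sc (nm n)"

declare nm.simps [simp del]

lemma ev_num [simp]: "ev M e (num n) = nm n"
  by (induction n) (simp_all add: num.simps nm.simps)

lemma nm_inj [simp]: "nm m = nm n \<longleftrightarrow> m = n"
proof (induction m arbitrary: n)
  case 0
  then show ?case by (cases n) (simp_all add: nm.simps)
next
  case (Suc m)
  then show ?case by (cases n) (simp_all add: nm.simps)
qed

lemma less_nm: "x \<prec> nm n \<longleftrightarrow> (\<exists>k<n. x = nm k)"
  by (induction n) (auto simp: nm.simps less_Suc_eq)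

lemma nm_less [simp]: "nm m \<prec> nm n \<longleftrightarrow> m < n"
  by (auto simp: less_nm)

lemma nm_add: "nm (m + n) = nm m \<oplus> nm n"
  by (induction n) (simp_all add: nm.simps)

lemma nm_mul: "nm (m * n) = nm m \<otimes> nm n"
  by (induction n) (simp_all add: nm.simps nm_add add_comm)

lemma nm_pr: "nm (pr m n) = prM (nm m) (nm n)"
  by (simp add: pr_def prM_def nm.simps nm_add nm_mul)

text \<open>By \<open>less_nm\<close> the standard elements form an initial segment, so a bounded
  quantifier with standard bound ranges over standard elements.\<close>

lemma Delta0_nm:
  "Delta0 p \<Longrightarrow> holds M (\<lambda>i. nm (e i)) p \<longleftrightarrow> sat e p"
proof (induction arbitrary: e rule: Delta0.induct)
  have ev: "ev M (\<lambda>i. nm (e i)) t = nm (evalt e t)" for e t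
    by (induction t) (simp_all add: nm.simps nm_add nm_mul)
  have evl: "evalt (n ## e) (lift (Suc 0) t) = evalt e t" for e n t
    by (induction t) simp_all
  have sc: "nm n ## (\<lambda>i. nm (e i)) = (\<lambda>i. nm ((n ## e) i))" for n and e :: "nat \<Rightarrow> nat"
    by (rule ext) (simp split: nat.split)
  {
    case (1 s t)
    then show ?case by (simp add: ev)
  next
    case (2 s t)
    then show ?case by (simp add: ev)
  next
    case (5 p t)
    then show ?case by (auto simp: ev evl less_nm sc)
  next
    case (6 p t)
    then show ?case by (auto simp: ev evl less_nm sc)
  }
qed simp_all

lemma Sigma1_nm: "Sigma1 p \<Longrightarrow> sat e p \<Longrightarrow> holds M (\<lambda>i. nm (e i)) p"
proof (induction arbitrary: e rule: Sigma1.induct)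
  case (1 p)
  then show ?case by (simp add: Delta0_nm)
next
  case (2 p)
  then obtain n where "holds M (\<lambda>i. nm ((n ## e) i)) p" by auto
  moreover have "(\<lambda>i. nm ((n ## e) i)) = nm n ## (\<lambda>i. nm (e i))"
    by (rule ext) (simp split: nat.split)
  ultimately show ?case by auto
qed

section \<open>The arithmetised syntax read in a model\<close>

abbreviation tag :: "nat \<Rightarrow> 'm \<Rightarrow> 'm" where "tag k x \<equiv> prM (nm k) x"

definition RNum :: "('m \<Rightarrow> bool) \<Rightarrow> 'm \<Rightarrow> bool" where
  "RNum E y \<longleftrightarrow> y = prM \<zero> (tag 1 \<zero>) \<or> (\<exists>n z. E (prM n z) \<and> y = prM (sc n) (tag 2 z))"

definition RTm :: "('m \<Rightarrow> bool) \<Rightarrow> 'm \<Rightarrow> bool" where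
  "RTm E y \<longleftrightarrow> (\<exists>n i. i \<prec> n \<and> y = prM n (tag 0 i)) \<or> (\<exists>n. y = prM n (tag 1 \<zero>)) \<or>
    (\<exists>n u. E (prM n u) \<and> y = prM n (tag 2 u)) \<or>
    (\<exists>n u v. E (prM n u) \<and> E (prM n v) \<and> (y = prM n (tag 3 (prM u v)) \<or> y = prM n (tag 4 (prM u v))))"

definition "tmM n u \<longleftrightarrow> derM RTm (prM n u)"

definition RFm :: "('m \<Rightarrow> bool) \<Rightarrow> 'm \<Rightarrow> bool" where
  "RFm E y \<longleftrightarrow>
    (\<exists>n u v. tmM n u \<and> tmM n v \<and> (y = prM n (tag 5 (prM u v)) \<or> y = prM n (tag 6 (prM u v)))) \<or>
    (\<exists>n u. E (prM n u) \<and> y = prM n (tag 7 u)) \<or>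
    (\<exists>n u v. E (prM n u) \<and> E (prM n v) \<and> y = prM n (tag 8 (prM u v))) \<or>
    (\<exists>n u. E (prM (sc n) u) \<and> y = prM n (tag 9 u))"

definition "fmM n u \<longleftrightarrow> derM RFm (prM n u)"

definition RHomo :: "('m \<Rightarrow> bool) \<Rightarrow> 'm \<Rightarrow> bool" where
  "RHomo E y \<longleftrightarrow> (\<exists>k. y = prM k (prM (tag 1 \<zero>) (tag 1 \<zero>))) \<or>
    (\<exists>k u v. E (prM k (prM u v)) \<and> (\<exists>c\<in>{2, 7}. y = prM k (prM (tag c u) (tag c v)))) \<or>
    (\<exists>k u v u' v'. E (prM k (prM u v)) \<and> E (prM k (prM u' v')) \<and>
      (\<exists>c\<in>{3, 4, 5, 6, 8}. y = prM k (prM (tag c (prM u u')) (tag c (prM v v')))))"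

definition RLift :: "('m \<Rightarrow> bool) \<Rightarrow> 'm \<Rightarrow> bool" where
  "RLift E y \<longleftrightarrow> RHomo E y \<or>
    (\<exists>k i. i \<prec> k \<and> y = prM k (prM (tag 0 i) (tag 0 i))) \<or>
    (\<exists>k i. \<not> i \<prec> k \<and> y = prM k (prM (tag 0 i) (tag 0 (sc i)))) \<or>
    (\<exists>k u v. E (prM (sc k) (prM u v)) \<and> y = prM k (prM (tag 9 u) (tag 9 v)))"

definition "liftM k u v \<longleftrightarrow> derM RLift (prM k (prM u v))"

definition RSub :: "('m \<Rightarrow> bool) \<Rightarrow> 'm \<Rightarrow> bool" where
  "RSub E y \<longleftrightarrow> RHomo E y \<or>
    (\<exists>k t i. i \<prec> k \<and> y = prM (prM k t) (prM (tag 0 i) (tag 0 i))) \<or>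
    (\<exists>k t. y = prM (prM k t) (prM (tag 0 k) t)) \<or>
    (\<exists>k t i. \<not> i \<prec> k \<and> y = prM (prM k t) (prM (tag 0 (sc i)) (tag 0 i))) \<or>
    (\<exists>k t t' u v. liftM \<zero> t t' \<and> E (prM (prM (sc k) t') (prM u v)) \<and>
      y = prM (prM k t) (prM (tag 9 u) (tag 9 v)))"

definition "subM k t u v \<longleftrightarrow> derM RSub (prM (prM k t) (prM u v))"

definition "termM u \<longleftrightarrow> (\<exists>n. tmM n u)"
definition "formM u \<longleftrightarrow> (\<exists>n. fmM n u)"

abbreviation "impM u v \<equiv> tag 8 (prM u v)"
abbreviation "negM u \<equiv> tag 7 u"
abbreviation "allM u \<equiv> tag 9 u"

definition logM :: "'m \<Rightarrow> bool" where
  "logM y \<longleftrightarrow>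
    (\<exists>p q. formM p \<and> formM q \<and> y = impM p (impM q p)) \<or>
    (\<exists>p q r. formM p \<and> formM q \<and> formM r \<and>
      y = impM (impM p (impM q r)) (impM (impM p q) (impM p r))) \<or>
    (\<exists>p q. formM p \<and> formM q \<and> y = impM (impM (negM p) (negM q)) (impM q p)) \<or>
    (\<exists>p t q. formM p \<and> termM t \<and> subM \<zero> t p q \<and> y = impM (allM p) q) \<or>
    (\<exists>p q. formM p \<and> formM q \<and> y = impM (allM (impM p q)) (impM (allM p) (allM q))) \<or>
    (\<exists>p q. formM p \<and> liftM \<zero> p q \<and> y = impM p (allM q)) \<or>
    (\<exists>t. termM t \<and> y = tag 5 (prM t t)) \<or>
    (\<exists>p s t q r. formM p \<and> termM s \<and> termM t \<and> subM \<zero> s p q \<and> subM \<zero> t p r \<and>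
      y = impM (tag 5 (prM s t)) (impM q r))"

definition RPr :: "fm \<Rightarrow> ('m \<Rightarrow> bool) \<Rightarrow> 'm \<Rightarrow> bool" where
  "RPr \<tau> E y \<longleftrightarrow> fmM \<zero> y \<and> holds M (\<lambda>_. y) \<tau> \<or> logM y \<or> (\<exists>u. E (impM u y) \<and> E u) \<or>
    (\<exists>u. E u \<and> y = allM u)"

definition "prvM \<tau> u \<longleftrightarrow> derM (RPr \<tau>) u"

definition "numR n z \<longleftrightarrow> derM RNum (prM n z)"

lemma monoI_pred: "(\<And>E E' y. (\<And>v. E v \<Longrightarrow> E' v) \<Longrightarrow> R E y \<Longrightarrow> R E' y) \<Longrightarrow> mono R"
  by (rule monoI, rule predicate1I) (blast dest: predicate1D)

lemma mono_R:
  "mono RNum" "mono RTm" "mono RFm" "mono RLift" "mono RSub" "mono (RPr \<tau>)"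
proof -
  show "mono RNum"
    by (rule monoI_pred, unfold RNum_def, elim disj_forward ex_forward conj_forward) simp_all
  show "mono RTm"
    by (rule monoI_pred, unfold RTm_def, elim disj_forward ex_forward conj_forward) simp_all
  show "mono RFm"
    by (rule monoI_pred, unfold RFm_def, elim disj_forward ex_forward conj_forward) simp_all
  have H: "RHomo E' y" if "\<And>v. E v \<Longrightarrow> E' v" "RHomo E y" for E E' y
    using that(2) unfolding RHomo_def
    by (elim disj_forward ex_forward conj_forward) (simp_all add: that(1))
  show "mono RLift"
    by (rule monoI_pred, unfold RLift_def, elim disj_forward ex_forward conj_forward) (erule H[rotated], simp_all)
  show "mono RSub"
    by (rule monoI_pred, unfold RSub_def, elim disj_forward ex_forward conj_forward) (erule H[rotated], simp_all)
  show "mono (RPr \<tau>)"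
    by (rule monoI_pred, unfold RPr_def, elim disj_forward ex_forward conj_forward) simp_all
qed

lemma holds_Num [simp]: "holds M e (Num n z) \<longleftrightarrow> numR (ev M e n) (ev M e z)"
  unfolding Num_def numR_def
  by (subst holds_Derivable[where R' = RNum]) (simp_all add: RNum_def disj_imp)

lemma holds_Tm [simp]: "holds M e (Tm n u) \<longleftrightarrow> tmM (ev M e n) (ev M e u)"
  unfolding Tm_def tmM_def
  by (subst holds_Derivable[where R' = RTm]) (simp_all add: RTm_def disj_imp)

lemma holds_Fm [simp]: "holds M e (Fm n u) \<longleftrightarrow> fmM (ev M e n) (ev M e u)"
  unfolding Fm_def fmM_def
  by (subst holds_Derivable[where R' = RFm]) (simp_all add: RFm_def disj_imp)

lemma holds_Term [simp]: "holds M e (Term u) \<longleftrightarrow> termM (ev M e u)"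
  and holds_Form [simp]: "holds M e (Form u) \<longleftrightarrow> formM (ev M e u)"
  by (simp_all add: Term_def Form_def termM_def formM_def)

lemma holds_Homo: "holds M (y ## i ## l ## b ## a ## e)
    (Homo (\<lambda>d v. Listed (V (4 + d)) (V (3 + d)) (V (1 + d)) v)) = RHomo (lst a b i) y"
  unfolding Homo_def RHomo_def by (simp add: disj_imp)

lemma holds_Lift [simp]: "holds M e (Lift k u v) \<longleftrightarrow> liftM (ev M e k) (ev M e u) (ev M e v)"
  unfolding Lift_def liftM_def
  by (subst holds_Derivable[where R' = RLift]) (simp_all add: RLift_def holds_Homo[simplified] disj_imp)

lemma holds_Sub [simp]: "holds M e (Sub k t u v) \<longleftrightarrow> subM (ev M e k) (ev M e t) (ev M e u) (ev M e v)"
  unfolding Sub_def subM_def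
  by (subst holds_Derivable[where R' = RSub]) (simp_all add: RSub_def holds_Homo[simplified] disj_imp)

lemma holds_LogAx [simp]: "holds M e LogAx \<longleftrightarrow> logM (e 0)"
  unfolding LogAx_def logM_def by (simp add: disj_imp)

lemma holds_Pr [simp]:
  assumes "frees \<tau> \<subseteq> {0}"
  shows "holds M e (Pr \<tau> x) \<longleftrightarrow> prvM \<tau> (ev M e x)"
proof -
  have "holds M (y ## e) \<tau> = holds M (\<lambda>_. y) \<tau>" for y e
    by (rule holds_cong) (use assms in auto)
  then show ?thesis
    unfolding Pr_def prvM_def
    by (subst holds_Derivable[where R' = "RPr \<tau>"]) (simp_all add: RPr_def disj_imp)
qed

end

section \<open>Complexity of the arithmetised predicates\<close>

lemma Sg_atoms: "Sg (s \<^bold>= t)" "Sg (s \<^bold>< t)" "Sg (\<^bold>\<not> s \<^bold>< t)"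
  by (intro Sg.Delta0 Delta0.intros)+

lemma Sg_Beta: "Sg (Beta a b i z)"
  unfolding Beta_def Let_def by (intro Sg.And Sg.Ex Sg_atoms)

lemma Sg_Listed: "Sg (Listed a b l x)"
  unfolding Listed_def by (intro Sg.And Sg.Ex Sg_atoms Sg_Beta)

lemmas Sg_intros = Sg.And Sg.Or Sg.Ex Sg_ball Sg_atoms Sg_Beta Sg_Listed

lemma Sg_Derivable:
  assumes "Sg (R (\<lambda>d v. Listed (V (4 + d)) (V (3 + d)) (V (1 + d)) v))"
  shows "Sg (Derivable R x)"
  unfolding Derivable_def One_nat_def using assms by (intro Sg_intros) simp

lemma Sg_Num: "Sg (Num n z)"
  unfolding Num_def by (rule Sg_Derivable) (intro Sg_intros)

lemma Sg_Tm: "Sg (Tm n u)"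
  unfolding Tm_def by (rule Sg_Derivable) (intro Sg_intros)

lemma Sg_Fm: "Sg (Fm n u)"
  unfolding Fm_def by (rule Sg_Derivable) (intro Sg_intros Sg_Tm)

lemma Sg_Lift: "Sg (Lift k u v)"
  unfolding Lift_def Homo_def by (rule Sg_Derivable) (intro Sg_intros)

lemma Sg_Sub: "Sg (Sub k t u v)"
  unfolding Sub_def Homo_def by (rule Sg_Derivable) (intro Sg_intros Sg_Lift)

lemma Sg_LogAx: "Sg LogAx"
  unfolding LogAx_def Form_def Term_def by (intro Sg_intros Sg_Fm Sg_Tm Sg_Sub Sg_Lift)

lemma Sg_Pr: "Sigma1 \<tau> \<Longrightarrow> Sg (Pr \<tau> x)"
  unfolding Pr_def by (rule Sg_Derivable) (intro Sg_intros Sg_Fm Sg_LogAx Sg_Sigma1)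

context is1 begin

lemma s1_numR: "td f \<Longrightarrow> td g \<Longrightarrow> s1 M (\<lambda>e. numR (f e) (g e))"
  using s1_holds[OF Sg_Num, of M "\<lambda>e. f e ## g e ## (\<lambda>_. \<zero>)" "V 0" "V 1"]
  by (simp add: tdef_scons tdef_const)

lemma s1_tmM: "td f \<Longrightarrow> td g \<Longrightarrow> s1 M (\<lambda>e. tmM (f e) (g e))"
  using s1_holds[OF Sg_Tm, of M "\<lambda>e. f e ## g e ## (\<lambda>_. \<zero>)" "V 0" "V 1"]
  by (simp add: tdef_scons tdef_const)

lemma s1_liftM: "td f \<Longrightarrow> td g \<Longrightarrow> td h \<Longrightarrow> s1 M (\<lambda>e. liftM (f e) (g e) (h e))"
  using s1_holds[OF Sg_Lift, of M "\<lambda>e. f e ## g e ## h e ## (\<lambda>_. \<zero>)" "V 0" "V 1" "V 2"]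
  by (simp add: tdef_scons tdef_const)

lemma s1_subM: "td f \<Longrightarrow> td g \<Longrightarrow> td h \<Longrightarrow> td k \<Longrightarrow> s1 M (\<lambda>e. subM (f e) (g e) (h e) (k e))"
  using s1_holds[OF Sg_Sub, of M "\<lambda>e. f e ## g e ## h e ## k e ## (\<lambda>_. \<zero>)" "V 0" "V 1" "V 2" "V 3"]
  by (simp add: tdef_scons tdef_const)

lemma s1_neq: "td f \<Longrightarrow> td g \<Longrightarrow> s1 M (\<lambda>e. f e \<noteq> g e)"
  by (intro s1_d0 d0_intros)

section \<open>Closure rules of the arithmetised predicates\<close>

lemma tm_var: "i \<prec> n \<Longrightarrow> tmM n (tag 0 i)"
  and tm_zero: "tmM n (tag 1 \<zero>)"
  unfolding tmM_def by (rule derM_intro0, auto simp: RTm_def)+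

lemma tm_succ: "tmM n u \<Longrightarrow> tmM n (tag 2 u)"
  unfolding tmM_def by (erule derM_intro1[OF mono_R(2)]) (auto simp: RTm_def)

lemma tm_op: "c \<in> {3, 4} \<Longrightarrow> tmM n u \<Longrightarrow> tmM n v \<Longrightarrow> tmM n (tag c (prM u v))"
  unfolding tmM_def by (rule derM_intro2[OF mono_R(2)], assumption+) (auto simp: RTm_def)

lemma fm_atom: "c \<in> {5, 6} \<Longrightarrow> tmM n u \<Longrightarrow> tmM n v \<Longrightarrow> fmM n (tag c (prM u v))"
  unfolding fmM_def by (rule derM_intro0) (auto simp: RFm_def)

lemma fm_neg: "fmM n u \<Longrightarrow> fmM n (negM u)"
  unfolding fmM_def by (erule derM_intro1[OF mono_R(3)]) (auto simp: RFm_def)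

lemma fm_imp: "fmM n u \<Longrightarrow> fmM n v \<Longrightarrow> fmM n (impM u v)"
  unfolding fmM_def by (rule derM_intro2[OF mono_R(3)], assumption+) (simp add: RFm_def)

lemma fm_all: "fmM (sc n) u \<Longrightarrow> fmM n (allM u)"
  unfolding fmM_def by (erule derM_intro1[OF mono_R(3)]) (auto simp: RFm_def)

lemma lift_zero: "liftM k (tag 1 \<zero>) (tag 1 \<zero>)"
  and lift_var_less: "i \<prec> k \<Longrightarrow> liftM k (tag 0 i) (tag 0 i)"
  and lift_var_ge: "\<not> i \<prec> k \<Longrightarrow> liftM k (tag 0 i) (tag 0 (sc i))"
  unfolding liftM_def by (rule derM_intro0, auto simp: RLift_def RHomo_def)+

lemma lift_unary: "c \<in> {2, 7} \<Longrightarrow> liftM k u v \<Longrightarrow> liftM k (tag c u) (tag c v)"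
  unfolding liftM_def by (erule derM_intro1[OF mono_R(4)]) (auto simp: RLift_def RHomo_def)

lemma lift_binary: "c \<in> {3, 4, 5, 6, 8} \<Longrightarrow> liftM k u v \<Longrightarrow> liftM k u' v' \<Longrightarrow>
    liftM k (tag c (prM u u')) (tag c (prM v v'))"
  unfolding liftM_def
  by (rule derM_intro2[OF mono_R(4)], assumption+) (simp add: RLift_def RHomo_def)

lemma lift_all: "liftM (sc k) u v \<Longrightarrow> liftM k (allM u) (allM v)"
  unfolding liftM_def by (erule derM_intro1[OF mono_R(4)]) (simp add: RLift_def RHomo_def)

lemma sub_zero: "subM k t (tag 1 \<zero>) (tag 1 \<zero>)"
  and sub_var_less: "i \<prec> k \<Longrightarrow> subM k t (tag 0 i) (tag 0 i)"
  and sub_var_eq: "subM k t (tag 0 k) t"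
  and sub_var_greater: "\<not> i \<prec> k \<Longrightarrow> subM k t (tag 0 (sc i)) (tag 0 i)"
  unfolding subM_def by (rule derM_intro0, auto simp: RSub_def RHomo_def)+

lemma sub_unary: "c \<in> {2, 7} \<Longrightarrow> subM k t u v \<Longrightarrow> subM k t (tag c u) (tag c v)"
  unfolding subM_def by (erule derM_intro1[OF mono_R(5)]) (auto simp: RSub_def RHomo_def)

lemma sub_binary: "c \<in> {3, 4, 5, 6, 8} \<Longrightarrow> subM k t u v \<Longrightarrow> subM k t u' v' \<Longrightarrow>
    subM k t (tag c (prM u u')) (tag c (prM v v'))"
  unfolding subM_def
  by (rule derM_intro2[OF mono_R(5)], assumption+) (simp add: RSub_def RHomo_def)

lemma sub_all: "liftM \<zero> t t' \<Longrightarrow> subM (sc k) t' u v \<Longrightarrow> subM k t (allM u) (allM v)"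
  unfolding subM_def by (erule derM_intro1[OF mono_R(5)]) (simp add: RSub_def RHomo_def)

lemma prv_axiom: "fmM \<zero> u \<Longrightarrow> holds M (\<lambda>_. u) \<tau> \<Longrightarrow> prvM \<tau> u"
  and prv_logic: "logM u \<Longrightarrow> prvM \<tau> u"
  unfolding prvM_def by (rule derM_intro0, simp add: RPr_def)+

lemma prv_mp: "prvM \<tau> (impM u v) \<Longrightarrow> prvM \<tau> u \<Longrightarrow> prvM \<tau> v"
  unfolding prvM_def by (rule derM_intro2[OF mono_R(6)], assumption+) (auto simp: RPr_def)

lemma prv_gen: "prvM \<tau> u \<Longrightarrow> prvM \<tau> (allM u)"
  unfolding prvM_def by (erule derM_intro1[OF mono_R(6)]) (simp add: RPr_def)

section \<open>Codes of numerals, standard or not\<close>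

lemma num_zero: "numR \<zero> (tag 1 \<zero>)"
  unfolding numR_def by (rule derM_intro0) (simp add: RNum_def)

lemma num_succ: "numR n z \<Longrightarrow> numR (sc n) (tag 2 z)"
  unfolding numR_def by (erule derM_intro1[OF mono_R(1)]) (simp add: RNum_def)

lemma num_cases: "numR n z \<Longrightarrow> (n = \<zero> \<and> z = tag 1 \<zero>) \<or> (\<exists>n' z'. numR n' z' \<and> n = sc n' \<and> z = tag 2 z')"
  using derM_unfold[OF mono_R(1), of "prM n z"] unfolding numR_def by (auto simp: RNum_def)

lemma num_total: "\<exists>z. numR n z"
proof (induction n rule: induct_s1)
  case definable
  show ?case by (intro s1_intros s1_numR)
qed (use num_zero num_succ in blast)+

lemma num_unique: "numR n z \<Longrightarrow> numR n z' \<Longrightarrow> z = z'"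
proof -
  \<comment> \<open>Uniqueness is the negation of a \<Sigma>1 statement, hence the induction for
    complements.\<close>
  have "\<not> (\<exists>z z'. numR n z \<and> numR n z' \<and> z \<noteq> z')"
  proof (induction n rule: induct_p1)
    case definable
    show ?case unfolding not_not by (intro s1_intros s1_numR s1_neq)
  next
    case zero
    show ?case using num_cases[of \<zero>] by auto
  next
    case (succ n)
    have "z = z'" if "numR (sc n) z" "numR (sc n) z'" for z z'
      using num_cases[OF that(1)] num_cases[OF that(2)] succ by auto
    then show ?case by blast
  qed
  then show "numR n z \<Longrightarrow> numR n z' \<Longrightarrow> z = z'" by blast
qed

definition numM :: "'m \<Rightarrow> 'm" where "numM n = (THE z. numR n z)"

lemma numR_numM: "numR n z \<longleftrightarrow> z = numM n"
proof -
  obtain z0 where "numR n z0" using num_total by blast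
  then have "numM n = z0" unfolding numM_def using num_unique by blast
  then show ?thesis using \<open>numR n z0\<close> num_unique by blast
qed

lemma numM_zero [simp]: "numM \<zero> = tag 1 \<zero>"
  and numM_succ [simp]: "numM (sc n) = tag 2 (numM n)"
  using num_zero num_succ[of n "numM n"] unfolding numR_numM by simp_all

lemma induct_numM:
  assumes "s1 M (\<lambda>e. P (e 0))" "P (tag 1 \<zero>)" "\<And>z. P z \<Longrightarrow> P (tag 2 z)"
  shows "P (numM x)"
proof -
  have "\<exists>z. numR x z \<and> P z"
  proof (induction x rule: induct_s1)
    case definable
    show ?case by (intro s1_intros s1_numR s1_comp1[OF assms(1)])
  qed (use num_zero num_succ assms in blast)+
  then show ?thesis unfolding numR_numM by blast
qed

lemma tm_numM: "tmM n (numM x)"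
  by (rule induct_numM[of "tmM n"]) (intro s1_tmM tdef_intros tm_zero tm_succ | assumption)+

lemma lift_numM: "liftM k (numM x) (numM x)"
  by (rule induct_numM[of "\<lambda>z. liftM k z z"]) (intro s1_liftM tdef_intros lift_zero lift_unary | simp)+

lemma sub_numM: "subM k t (numM x) (numM x)"
  by (rule induct_numM[of "\<lambda>z. subM k t z z"]) (intro s1_subM tdef_intros sub_zero sub_unary | simp)+

text \<open>\<open>ctm \<rho> t\<close> is the code of \<open>t\<close> with \<open>\<rho> i\<close> as the code of its variable \<open>i\<close>. In \<open>cfm \<sigma> d p\<close> there are \<open>d\<close>
  quantifiers outside of \<open>p\<close>, and \<open>\<sigma> d i\<close> is the code of what stands for the free variable \<open>i\<close>
  when lifted past \<open>d\<close> quantifiers.\<close>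

primrec ctm :: "(nat \<Rightarrow> 'm) \<Rightarrow> tm \<Rightarrow> 'm" where
  "ctm \<rho> (V i) = \<rho> i"
| "ctm \<rho> Zero = tag 1 \<zero>"
| "ctm \<rho> (Succ t) = tag 2 (ctm \<rho> t)"
| "ctm \<rho> (Add s t) = tag 3 (prM (ctm \<rho> s) (ctm \<rho> t))"
| "ctm \<rho> (Mul s t) = tag 4 (prM (ctm \<rho> s) (ctm \<rho> t))"

definition under :: "nat \<Rightarrow> (nat \<Rightarrow> nat \<Rightarrow> 'm) \<Rightarrow> nat \<Rightarrow> 'm" where
  "under d \<sigma> i = (if i < d then tag 0 (nm i) else \<sigma> d (i - d))"

primrec cfm :: "(nat \<Rightarrow> nat \<Rightarrow> 'm) \<Rightarrow> nat \<Rightarrow> fm \<Rightarrow> 'm" where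
  "cfm \<sigma> d (s \<^bold>= t) = tag 5 (prM (ctm (under d \<sigma>) s) (ctm (under d \<sigma>) t))"
| "cfm \<sigma> d (s \<^bold>< t) = tag 6 (prM (ctm (under d \<sigma>) s) (ctm (under d \<sigma>) t))"
| "cfm \<sigma> d (\<^bold>\<not> p) = negM (cfm \<sigma> d p)"
| "cfm \<sigma> d (p \<^bold>\<longrightarrow> q) = impM (cfm \<sigma> d p) (cfm \<sigma> d q)"
| "cfm \<sigma> d (\<^bold>\<forall> p) = allM (cfm \<sigma> (Suc d) p)"

lemma ctm_cong: "(\<And>i. i \<in> freest t \<Longrightarrow> \<rho> i = \<rho>' i) \<Longrightarrow> ctm \<rho> t = ctm \<rho>' t"
  by (induction t) auto

lemma tm_ctm: "(\<And>i. i \<in> freest t \<Longrightarrow> tmM n (\<rho> i)) \<Longrightarrow> tmM n (ctm \<rho> t)"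
  by (induction t) (auto intro: tm_zero[simplified] tm_succ tm_op)

lemma fm_cfm:
  "(\<And>d i. i \<in> F \<Longrightarrow> tmM (nm (n + d)) (\<sigma> d i)) \<Longrightarrow> {i. i + d \<in> frees p} \<subseteq> F \<Longrightarrow> fmM (nm (n + d)) (cfm \<sigma> d p)"
proof (induction p arbitrary: d)
  case (Forall p)
  have "{i. i + Suc d \<in> frees p} \<subseteq> F" using Forall.prems(2) by auto
  then have "fmM (nm (n + Suc d)) (cfm \<sigma> (Suc d) p)" using Forall by blast
  then show ?case by (simp add: fm_all nm.simps)
next
  case (Imp p q)
  have "{i. i + d \<in> frees p} \<subseteq> F" "{i. i + d \<in> frees q} \<subseteq> F" using Imp.prems(2) by auto
  then show ?case using Imp by (simp add: fm_imp)
next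
  case (Neg p)
  then show ?case by (simp add: fm_neg)
next
  case (Eq s t)
  have "tmM (nm (n + d)) (under d \<sigma> i)" if "i \<in> frees (s \<^bold>= t)" for i
  proof (cases "i < d")
    case False
    then have "i - d \<in> F" using that Eq.prems(2) by (auto intro!: subsetD[OF Eq.prems(2)])
    then show ?thesis using False Eq.prems(1) by (simp add: under_def)
  qed (simp add: under_def tm_var)
  then show ?case by (auto intro!: fm_atom tm_ctm)
next
  case (Less s t)
  have "tmM (nm (n + d)) (under d \<sigma> i)" if "i \<in> frees (s \<^bold>< t)" for i
  proof (cases "i < d")
    case False
    then have "i - d \<in> F" using that Less.prems(2) by (auto intro!: subsetD[OF Less.prems(2)])
    then show ?thesis using False Less.prems(1) by (simp add: under_def)
  qed (simp add: under_def tm_var)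
  then show ?case by (auto intro!: fm_atom tm_ctm)
qed

lemma lift_ctm: "(\<And>i. liftM k (\<rho> i) (\<rho>' i)) \<Longrightarrow> liftM k (ctm \<rho> t) (ctm \<rho>' t)"
  by (induction t) (auto intro: lift_zero[simplified] lift_unary lift_binary)

lemma lift_cfm:
  "(\<And>d i. liftM (nm d) (\<sigma> d i) (\<sigma>' d i)) \<Longrightarrow> liftM (nm d) (cfm \<sigma> d p) (cfm \<sigma>' d p)"
proof (induction p arbitrary: d)
  case (Forall p)
  then have "liftM (nm (Suc d)) (cfm \<sigma> (Suc d) p) (cfm \<sigma>' (Suc d) p)" by blast
  then show ?case by (simp add: lift_all nm.simps)
next
  case (Eq s t)
  have "liftM (nm d) (under d \<sigma> i) (under d \<sigma>' i)" for i
    using Eq by (auto simp: under_def intro!: lift_var_less)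
  then show ?case by (auto intro!: lift_binary lift_ctm)
next
  case (Less s t)
  have "liftM (nm d) (under d \<sigma> i) (under d \<sigma>' i)" for i
    using Less by (auto simp: under_def intro!: lift_var_less)
  then show ?case by (auto intro!: lift_binary lift_ctm)
next
  case (Neg p)
  then show ?case by (simp add: lift_unary)
next
  case (Imp p q)
  then show ?case by (simp add: lift_binary)
qed

lemma sub_ctm: "(\<And>i. subM k u (\<rho> i) (\<rho>' i)) \<Longrightarrow> subM k u (ctm \<rho> t) (ctm \<rho>' t)"
  by (induction t) (auto intro: sub_zero[simplified] sub_unary sub_binary)

text \<open>\<open>s d\<close> is the code of the substituted term past \<open>d\<close>
  quantifiers: the clause of \<open>Sub\<close> for quantifiers lifts it once more at each of
  them.\<close>

lemma sub_cfm:
  assumes s: "\<And>d. liftM \<zero> (s d) (s (Suc d))" and \<sigma>: "\<And>d i. subM (nm d) (s d) (\<sigma> d i) (\<sigma>' d i)"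
  shows "subM (nm d) (s d) (cfm \<sigma> d p) (cfm \<sigma>' d p)"
proof (induction p arbitrary: d)
  case (Forall p)
  show ?case using sub_all[OF s[of d], of "nm d"] Forall[of "Suc d"] by (simp add: nm.simps)
next
  case (Eq u v)
  have "subM (nm d) (s d) (under d \<sigma> i) (under d \<sigma>' i)" for i
    using \<sigma> by (auto simp: under_def intro!: sub_var_less)
  then show ?case by (auto intro!: sub_binary sub_ctm)
next
  case (Less u v)
  have "subM (nm d) (s d) (under d \<sigma> i) (under d \<sigma>' i)" for i
    using \<sigma> by (auto simp: under_def intro!: sub_var_less)
  then show ?case by (auto intro!: sub_binary sub_ctm)
next
  case (Neg p)
  then show ?case by (simp add: sub_unary)
next
  case (Imp p q)
  then show ?case by (simp add: sub_binary)
qed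

lemma up_iter: "(up ^^ d) \<sigma> i = (if i < d then V i else lift d (\<sigma> (i - d)))"
proof (induction d arbitrary: i)
  case 0
  show ?case by (simp add: lift_def)
next
  case (Suc d)
  show ?case
    by (cases i) (simp_all add: Suc, simp add: lift_def substt_substt)
qed

lemma nm_gnt_substt: "nm (gnt (substt \<sigma> t)) = ctm (\<lambda>i. nm (gnt (\<sigma> i))) t"
  by (induction t) (simp_all add: nm_pr nm.simps(1))

definition cvar :: "(nat \<Rightarrow> tm) \<Rightarrow> nat \<Rightarrow> nat \<Rightarrow> 'm" where
  "cvar \<rho> d i = nm (gnt (lift d (\<rho> i)))"

lemma under_cvar: "(\<lambda>i. nm (gnt ((up ^^ d) \<rho> i))) = under d (cvar \<rho>)"
  by (rule ext) (simp add: up_iter under_def cvar_def nm_pr)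

lemma nm_gn_subst: "nm (gn (subst ((up ^^ d) \<rho>) p)) = cfm (cvar \<rho>) d p"
proof (induction p arbitrary: d)
  case (Forall p)
  show ?case using Forall[of "Suc d"] by (simp add: nm_pr)
qed (simp_all add: nm_pr nm_gnt_substt under_cvar)

lemma nm_gn_subst0: "nm (gn (subst \<rho> p)) = cfm (cvar \<rho>) 0 p"
  using nm_gn_subst[of 0 \<rho> p] by simp

lemma nm_gn: "nm (gn p) = cfm (cvar V) 0 p"
  using nm_gn_subst0[of V p] by simp

lemma nm_gnt: "nm (gnt t) = ctm (\<lambda>i. tag 0 (nm i)) t"
  using nm_gnt_substt[of V t] by (simp add: nm_pr)

lemma cvar_V: "cvar V d i = tag 0 (nm (i + d))"
  by (simp add: cvar_def nm_pr)

lemma term_nm: "termM (nm (gnt t))"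
proof -
  obtain n where "\<forall>i\<in>freest t. i < n" using finite_nat_set_iff_bounded[of "freest t"] by auto
  then have "tmM (nm n) (nm (gnt t))" unfolding nm_gnt by (intro tm_ctm tm_var) simp
  then show ?thesis unfolding termM_def by blast
qed

lemma fm_nm: "frees p \<subseteq> {..<n} \<Longrightarrow> fmM (nm n) (nm (gn p))"
  using fm_cfm[where F = "{..<n}" and n = n and \<sigma> = "cvar V" and p = p and d = 0]
  by (simp add: nm_gn cvar_V tm_var)

lemma form_nm: "formM (nm (gn p))"
  using fm_nm[OF frees_bound] unfolding formM_def by blast

lemma lift_nm_gnt: "liftM \<zero> (nm (gnt (lift d t))) (nm (gnt (lift (Suc d) t)))"
  unfolding lift_def nm_gnt_substt
  by (rule lift_ctm) (simp add: nm_pr nm.simps(2) lift_var_ge)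

lemma sub_inst: "subM \<zero> (nm (gnt t)) (nm (gn p)) (nm (gn (inst p t)))"
proof -
  have "subM (nm d) (nm (gnt (lift d t))) (cvar V d i) (cvar (t ## V) d i)" for d i
    by (cases i) (simp_all add: cvar_def nm_pr sub_var_eq nm.simps(2) sub_var_greater)
  from sub_cfm[where s = "\<lambda>d. nm (gnt (lift d t))" and \<sigma> = "cvar V" and \<sigma>' = "cvar (t ## V)", OF lift_nm_gnt this,
      of 0 p] show ?thesis
    unfolding inst_def nm_gn_subst0 nm_gn[of p] by (simp add: nm.simps(1)) (simp add: lift_def)
qed

lemma lift_liftf: "liftM \<zero> (nm (gn p)) (nm (gn (liftf p)))"
proof -
  have "liftM (nm d) (cvar V d i) (cvar (\<lambda>i. V (Suc i)) d i)" for d i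
    by (simp add: cvar_def nm_pr nm.simps(2) lift_var_ge)
  from lift_cfm[where \<sigma> = "cvar V" and \<sigma>' = "cvar (\<lambda>i. V (Suc i))", OF this, of 0 p] show ?thesis
    unfolding liftf_def nm_gn_subst0 nm_gn[of p] by (simp add: nm.simps(1))
qed

lemma logM_nm: "logax p \<Longrightarrow> logM (nm (gn p))"
proof (induction rule: logax.induct)
  case (1 p q) then show ?case using form_nm by (simp add: logM_def nm_pr) 
next
  case (2 p q r) then show ?case using form_nm by (simp add: logM_def nm_pr)
next
  case (3 p q) then show ?case using form_nm by (simp add: logM_def nm_pr)
next
  case (4 p t) then show ?case using form_nm[of p] term_nm[of t] sub_inst[of t p] by (auto simp: logM_def nm_pr)
next
  case (5 p q) then show ?case using form_nm by (simp add: logM_def nm_pr)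
next
  case (6 p) then show ?case using form_nm[of p] lift_liftf[of p] by (simp add: logM_def nm_pr)
next
  case (7 t) then show ?case using term_nm by (simp add: logM_def nm_pr)
next
  case (8 s t p) then show ?case
    using form_nm[of p] term_nm[of t] term_nm[of s] sub_inst[of t p] sub_inst[of s p]
    by (auto simp: logM_def nm_pr)
qed

end

section \<open>Provability in models\<close>

context is1 begin

definition code :: "(nat \<Rightarrow> 'm) \<Rightarrow> fm \<Rightarrow> 'm" where
  "code e p = cfm (\<lambda>_ i. numM (e i)) 0 p"

definition PrM :: "fm \<Rightarrow> (nat \<Rightarrow> 'm) \<Rightarrow> fm \<Rightarrow> bool" where
  "PrM \<tau> e p \<longleftrightarrow> prvM \<tau> (code e p)"

lemma ctm_lift [simp]: "ctm \<rho> (lift d t) = ctm (\<lambda>i. \<rho> (i + d)) t"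
  by (induction t) simp_all

lemma ctm_substt: "ctm \<rho> (substt \<sigma> t) = ctm (\<lambda>i. ctm \<rho> (\<sigma> i)) t"
  by (induction t) simp_all

lemma cfm_cong:
  "(\<And>d' i. i + d \<in> frees p \<Longrightarrow> \<sigma> d' i = \<sigma>' d' i) \<Longrightarrow> cfm \<sigma> d p = cfm \<sigma>' d p"
proof (induction p arbitrary: d)
  case (Eq s t)
  have "ctm (under d \<sigma>) s = ctm (under d \<sigma>') s" "ctm (under d \<sigma>) t = ctm (under d \<sigma>') t"
    by (rule ctm_cong, use Eq in \<open>auto simp: under_def\<close>)+
  then show ?case by simp
next
  case (Less s t)
  have "ctm (under d \<sigma>) s = ctm (under d \<sigma>') s" "ctm (under d \<sigma>) t = ctm (under d \<sigma>') t"
    by (rule ctm_cong, use Less in \<open>auto simp: under_def\<close>)+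
  then show ?case by simp
next
  case (Imp p q)
  have "cfm \<sigma> d p = cfm \<sigma>' d p" "cfm \<sigma> d q = cfm \<sigma>' d q"
    by (rule Imp.IH, simp add: Imp.prems)+
  then show ?case by simp
next
  case (Neg p)
  have "cfm \<sigma> d p = cfm \<sigma>' d p"
    by (rule Neg.IH) (simp add: Neg.prems)
  then show ?case by simp
next
  case (Forall p)
  have "cfm \<sigma> (Suc d) p = cfm \<sigma>' (Suc d) p"
    by (rule Forall.IH) (simp add: Forall.prems)
  then show ?case by simp
qed

text \<open>A substitution can be moved into the environment where the substituted terms have
  numerals as codes, as with variables, zero and successors. The code of a sum is not that of the
  numeral of its value, so \<open>PrM_term\<close> has to bridge this gap by provable
  equations.\<close>

lemma cfm_subst:
  assumes "\<And>i. i + d \<in> frees p \<Longrightarrow> ctm (\<lambda>i. numM (e i)) (\<rho> i) = numM (e' i)"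
  shows "cfm (\<lambda>_ i. numM (e i)) d (subst ((up ^^ d) \<rho>) p) = cfm (\<lambda>_ i. numM (e' i)) d p"
  using assms
proof (induction p arbitrary: d)
  case (Eq s t)
  have "ctm (under d (\<lambda>_ i. numM (e i))) ((up ^^ d) \<rho> i) = under d (\<lambda>_ i. numM (e' i)) i" if "i \<in> frees (s \<^bold>= t)" for i
    using Eq[of "i - d"] that by (cases "i < d") (auto simp: up_iter under_def)
  then have "ctm (\<lambda>i. ctm (under d (\<lambda>_ i. numM (e i))) ((up ^^ d) \<rho> i)) u = ctm (under d (\<lambda>_ i. numM (e' i))) u"
    if "freest u \<subseteq> frees (s \<^bold>= t)" for u using that by (intro ctm_cong) blast
  then show ?case by (simp add: ctm_substt)
next
  case (Less s t)
  have "ctm (under d (\<lambda>_ i. numM (e i))) ((up ^^ d) \<rho> i) = under d (\<lambda>_ i. numM (e' i)) i" if "i \<in> frees (s \<^bold>< t)" for i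
    using Less[of "i - d"] that by (cases "i < d") (auto simp: up_iter under_def)
  then have "ctm (\<lambda>i. ctm (under d (\<lambda>_ i. numM (e i))) ((up ^^ d) \<rho> i)) u = ctm (under d (\<lambda>_ i. numM (e' i))) u"
    if "freest u \<subseteq> frees (s \<^bold>< t)" for u using that by (intro ctm_cong) blast
  then show ?case by (simp add: ctm_substt)
next
  case (Forall p)
  have "cfm (\<lambda>_ i. numM (e i)) (Suc d) (subst ((up ^^ Suc d) \<rho>) p) = cfm (\<lambda>_ i. numM (e' i)) (Suc d) p"
    by (rule Forall.IH) (simp add: Forall.prems)
  then show ?case by simp
qed simp_all

lemma code_subst:
  "(\<And>i. i \<in> frees p \<Longrightarrow> ctm (\<lambda>i. numM (e i)) (\<rho> i) = numM (e' i)) \<Longrightarrow> code e (subst \<rho> p) = code e' p"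
  using cfm_subst[of 0 p e \<rho> e'] by (simp add: code_def)

lemma PrM_subst:
  "(\<And>i. i \<in> frees p \<Longrightarrow> ctm (\<lambda>i. numM (e i)) (\<rho> i) = numM (e' i)) \<Longrightarrow> PrM \<tau> e (subst \<rho> p) = PrM \<tau> e' p"
  by (simp add: PrM_def code_subst)

lemma PrM_cong: "(\<And>i. i \<in> frees p \<Longrightarrow> e i = e' i) \<Longrightarrow> PrM \<tau> e p = PrM \<tau> e' p"
  using PrM_subst[of p e V e'] by simp

lemma PrM_liftf: "PrM \<tau> (x ## e) (liftf p) = PrM \<tau> e p"
  unfolding liftf_def by (rule PrM_subst) simp

lemma code_sentence: "sentence p \<Longrightarrow> code e p = nm (gn p)"
  unfolding code_def nm_gn by (rule cfm_cong) simp

lemma code_simps [simp]: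
  "code e (s \<^bold>= t) = tag 5 (prM (ctm (\<lambda>i. numM (e i)) s) (ctm (\<lambda>i. numM (e i)) t))"
  "code e (s \<^bold>< t) = tag 6 (prM (ctm (\<lambda>i. numM (e i)) s) (ctm (\<lambda>i. numM (e i)) t))"
  "code e (\<^bold>\<not> p) = negM (code e p)"
  "code e (p \<^bold>\<longrightarrow> q) = impM (code e p) (code e q)"
proof -
  have "under 0 (\<lambda>_ i. numM (e i)) = (\<lambda>i. numM (e i))" by (rule ext) (simp add: under_def)
  then show "code e (s \<^bold>= t) = tag 5 (prM (ctm (\<lambda>i. numM (e i)) s) (ctm (\<lambda>i. numM (e i)) t))"
    "code e (s \<^bold>< t) = tag 6 (prM (ctm (\<lambda>i. numM (e i)) s) (ctm (\<lambda>i. numM (e i)) t))"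
    by (simp_all add: code_def)
qed (simp_all add: code_def)

lemma PrM_mp: "PrM \<tau> e (p \<^bold>\<longrightarrow> q) \<Longrightarrow> PrM \<tau> e p \<Longrightarrow> PrM \<tau> e q"
  unfolding PrM_def by (auto dest: prv_mp)

text \<open>A formula below one more quantifier, regarded as having one more free variable: past
  \<open>d\<close> inner quantifiers, the variable bound outermost has index
  \<open>d\<close>.\<close>

definition cscons :: "(nat \<Rightarrow> nat \<Rightarrow> 'm) \<Rightarrow> nat \<Rightarrow> nat \<Rightarrow> 'm" where
  "cscons \<sigma> d i = (case i of 0 \<Rightarrow> tag 0 (nm d) | Suc j \<Rightarrow> \<sigma> (Suc d) j)"

lemma cfm_Suc: "cfm \<sigma> (Suc d) p = cfm (cscons \<sigma>) d p"
proof (induction p arbitrary: d)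
  have *: "under (Suc d) \<sigma> = under d (cscons \<sigma>)" for d
  proof
    fix i
    show "under (Suc d) \<sigma> i = under d (cscons \<sigma>) i"
    proof (cases "i - d")
      case 0
      then show ?thesis by (cases "i = d") (auto simp: under_def cscons_def)
    next
      case (Suc j)
      then have "i - Suc d = j" "\<not> i < Suc d" by auto
      then show ?thesis using Suc by (simp add: under_def cscons_def)
    qed
  qed
  {
    case (Eq s t) then show ?case by (simp add: *)
  next
    case (Less s t) then show ?case by (simp add: *)
  }
qed simp_all

text \<open>\<open>x\<close> may be nonstandard, so no derivation outside \<open>M\<close> provides
  this. The instantiation axiom is checked inside \<open>M\<close>, where numerals are unchanged by
  lifting and substitution.\<close>

lemma PrM_Forall_inst:
  assumes "PrM \<tau> e (\<^bold>\<forall> p)"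
  shows "PrM \<tau> (x ## e) p"
proof -
  define \<sigma> where "\<sigma> = cscons (\<lambda>_ i. numM (e i))"
  have c: "code e (\<^bold>\<forall> p) = allM (cfm \<sigma> 0 p)" by (simp add: code_def cfm_Suc \<sigma>_def)
  have "tmM (nm (1 + d)) (\<sigma> d i)" for d i
    by (cases i) (simp_all add: \<sigma>_def cscons_def tm_numM tm_var)
  then have "fmM (nm 1) (cfm \<sigma> 0 p)"
    using fm_cfm[where F = UNIV and n = 1 and d = 0 and \<sigma> = \<sigma> and p = p] by simp
  then have f: "formM (cfm \<sigma> 0 p)" unfolding formM_def by blast
  have t: "termM (numM x)" unfolding termM_def using tm_numM by blast
  have "subM (nm d) (numM x) (\<sigma> d i) (numM ((x ## e) i))" for d i
    by (cases i) (simp_all add: \<sigma>_def cscons_def sub_var_eq sub_numM)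
  from sub_cfm[where s = "\<lambda>_. numM x" and \<sigma> = \<sigma> and \<sigma>' = "\<lambda>_ i. numM ((x ## e) i)", OF lift_numM this, of 0 p]
  have "subM \<zero> (numM x) (cfm \<sigma> 0 p) (code (x ## e) p)" by (simp add: code_def nm.simps(1))
  then have "logM (impM (code e (\<^bold>\<forall> p)) (code (x ## e) p))"
    unfolding c logM_def using f t by blast
  then show ?thesis using assms prv_mp prv_logic unfolding PrM_def by blast
qed

lemma PrM_closure:
  assumes "\<And>e. PrM \<tau> e ((Forall ^^ n) p)"
  shows "PrM \<tau> e p"
  using assms
proof (induction n arbitrary: e)
  case (Suc n)
  have "PrM \<tau> e ((Forall ^^ n) p)" for e
    using PrM_Forall_inst[of \<tau> "\<lambda>i. e (Suc i)" "(Forall ^^ n) p" "e 0"] Suc.prems by simp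
  then show ?case by (rule Suc.IH)
qed simp

lemma holds_Exists_iter:
  "holds M e ((Exists ^^ n) q) \<longleftrightarrow> (\<exists>z. holds M (\<lambda>i. if i < n then z i else e (i - n)) q)"
proof (induction n arbitrary: e)
  case (Suc n)
  have "(\<exists>x z. holds M (\<lambda>i. if i < n then z i else (x ## e) (i - n)) q) \<longleftrightarrow>
    (\<exists>z. holds M (\<lambda>i. if i < Suc n then z i else e (i - Suc n)) q)" (is "?L \<longleftrightarrow> ?R")
  proof
    assume ?L
    then obtain x z where h: "holds M (\<lambda>i. if i < n then z i else (x ## e) (i - n)) q" by blast
    have "(\<lambda>i. if i < n then z i else (x ## e) (i - n)) =
        (\<lambda>i. if i < Suc n then (z(n := x)) i else e (i - Suc n))"
      by (rule ext) (auto simp: less_Suc_eq not_less split: nat.split intro!: arg_cong[of _ _ e])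
    then show ?R using h by metis
  next
    assume ?R
    then obtain z where h: "holds M (\<lambda>i. if i < Suc n then z i else e (i - Suc n)) q" by blast
    have "(\<lambda>i. if i < Suc n then z i else e (i - Suc n)) =
        (\<lambda>i. if i < n then z i else (z n ## e) (i - n))"
      by (rule ext) (auto simp: less_Suc_eq not_less split: nat.split intro!: arg_cong[of _ _ e])
    then show ?L using h by metis
  qed
  then show ?case by (simp add: Suc)
qed simp

lemma holds_foldr_And: "holds M e (foldr And ps q) \<longleftrightarrow> (\<forall>p\<in>set ps. holds M e p) \<and> holds M e q"
  by (induction ps) auto

lemma ev_dott: "ev M \<rho> (dott d t) = ctm (under d (\<lambda>_. \<rho>)) t"
  by (induction t) (auto simp: under_def)

lemma ev_dotf: "ev M \<rho> (dotf d p) = cfm (\<lambda>_. \<rho>) d p"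
  by (induction p arbitrary: d) (simp_all add: ev_dott)

lemma holds_Prdot [simp]:
  assumes "frees \<tau> \<subseteq> {0}"
  shows "holds M e (Prdot \<tau> p) \<longleftrightarrow> PrM \<tau> e p"
proof -
  define n where "n = bound p"
  have n: "frees p \<subseteq> {..<n}" unfolding n_def by (rule frees_bound)
  let ?e = "\<lambda>z i. if i < n then z i else e (i - n)"
  \<comment> \<open>\<open>Prdot\<close> leaves the entries outside \<open>frees p\<close>
    unconstrained; the code of \<open>p\<close> does not depend on them.\<close>
  have "holds M e (Prdot \<tau> p) \<longleftrightarrow>
    (\<exists>z. (\<forall>i\<in>frees p. z i = numM (e i)) \<and> prvM \<tau> (cfm (\<lambda>_. ?e z) 0 p))"
  proof -
    have "{0..<n} \<inter> frees p = frees p" using n by auto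
    then have *: "(\<forall>q\<in>set [Num (V (n + i)) (V i). i \<leftarrow> [0..<n], i \<in> frees p]. holds M (?e z) q) \<longleftrightarrow>
        (\<forall>i\<in>frees p. z i = numM (e i))" for z
      using n by (simp add: numR_numM subset_iff)
    show ?thesis
      unfolding Prdot_def Let_def n_def[symmetric] holds_Exists_iter holds_foldr_And *
      by (simp add: assms ev_dotf)
  qed
  also have "\<dots> \<longleftrightarrow> (\<exists>z. (\<forall>i\<in>frees p. z i = numM (e i)) \<and> prvM \<tau> (code e p))"
  proof (rule ex_cong1, rule conj_cong[OF refl])
    fix z assume "\<forall>i\<in>frees p. z i = numM (e i)"
    then have "cfm (\<lambda>_. ?e z) 0 p = code e p" unfolding code_def using n by (intro cfm_cong) auto
    then show "prvM \<tau> (cfm (\<lambda>_. ?e z) 0 p) = prvM \<tau> (code e p)" by simp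
  qed
  also have "\<dots> \<longleftrightarrow> PrM \<tau> e p" unfolding PrM_def by auto
  finally show ?thesis .
qed

lemma holds_Con:
  assumes "frees \<tau> \<subseteq> {0}"
  shows "holds M e (Con \<tau>) \<longleftrightarrow> \<not> PrM \<tau> e (Zero \<^bold>= num 1)"
  unfolding Con_def using assms by (simp add: PrM_def code_sentence del: code_simps)

end

lemma Sg_foldr_And: "(\<And>p. p \<in> set ps \<Longrightarrow> Sg p) \<Longrightarrow> Sg q \<Longrightarrow> Sg (foldr And ps q)"
  by (induction ps) (auto intro: Sg.And)

lemma Sg_Prdot: "Sigma1 \<tau> \<Longrightarrow> Sg (Prdot \<tau> p)"
proof -
  assume "Sigma1 \<tau>"
  then have "Sg (foldr And [Num (V (n + i)) (V i). i \<leftarrow> [0..<n], i \<in> frees p] (Pr \<tau> (dotf 0 p)))" for n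
    by (intro Sg_foldr_And Sg_Pr) (auto intro: Sg_Num)
  moreover have "Sg q \<Longrightarrow> Sg ((Exists ^^ n) q)" for n q
    by (induction n) (auto intro: Sg.Ex)
  ultimately show ?thesis unfolding Prdot_def Let_def by blast
qed

section \<open>Theories and their provability in a model\<close>

locale arith_theory =
  fixes T :: "fm set" and \<tau> :: fm
  assumes sentences: "\<forall>p\<in>T. sentence p"
    and extends: "p \<in> ISigma1 \<Longrightarrow> T \<turnstile> p"
    and Sigma1: "Sigma1 \<tau>"
    and tau: "defines_theory \<tau> T"
begin

lemma frees_subset [simp]: "frees \<tau> \<subseteq> {0}"
  using tau by (simp add: defines_theory_def)

lemma models_ISigma1: "models M T \<Longrightarrow> models M ISigma1"
  unfolding models_def[of M ISigma1] using soundness[OF extends] by blast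

lemma complete: "(\<And>(M :: nat str) e. models M T \<Longrightarrow> holds M e p) \<Longrightarrow> T \<turnstile> p"
  by (rule completeness[OF sentences extends]) (simp_all add: ISigma1_def)

end

text \<open>\<open>M\<close> is a model of \<open>ISigma1\<close> and possibly not of
  \<open>T\<close>; thus two arithmetised theories can be compared in one model.\<close>

locale theory_in = is1 M + arith_theory T \<tau> for M :: "'m::countable str" and T \<tau>
begin

text \<open>The code of an axiom satisfies \<open>\<tau>\<close> in the standard model and
  therefore, \<open>\<tau>\<close> being \<Sigma>1, in \<open>M\<close>.\<close>

lemma prv_nm: "T \<turnstile> p \<Longrightarrow> prvM \<tau> (nm (gn p))"
proof (induction rule: proves.induct)
  case (Ax p)
  have "sat (\<lambda>_. 0) (inst \<tau> (num (gn p)))"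
    using tau Ax by (auto simp: defines_theory_def)
  moreover have "Sigma1 q \<Longrightarrow> Sigma1 (subst \<sigma> q)" for q \<sigma>
    by (induction arbitrary: \<sigma> rule: Sigma1.induct) (simp_all add: Sigma1.intros Delta0_subst)
  ultimately have "holds M (\<lambda>_. nm 0) (inst \<tau> (num (gn p)))"
    using Sigma1_nm[of "inst \<tau> (num (gn p))" "\<lambda>_. 0"] Sigma1 by (simp add: inst_def)
  then have "holds M (nm (gn p) ## (\<lambda>_. nm 0)) \<tau>" by simp
  moreover have "holds M (nm (gn p) ## (\<lambda>_. nm 0)) \<tau> = holds M (\<lambda>_. nm (gn p)) \<tau>"
    by (rule holds_cong) (use subsetD[OF frees_subset] in \<open>auto split: nat.split\<close>)
  moreover have "fmM \<zero> (nm (gn p))" using fm_nm[of p 0] sentences Ax by (simp add: nm.simps(1))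
  ultimately show ?case by (simp add: prv_axiom)
next
  case (Logic p)
  then show ?case by (simp add: prv_logic logM_nm)
next
  case (MP p q)
  then show ?case using prv_mp by (simp add: nm_pr)
next
  case (Gen p)
  then show ?case by (simp add: nm_pr prv_gen)
qed

text \<open>The derivation yields the provability in \<open>M\<close> of the closure, a sentence
  with standard code, which is then instantiated inside \<open>M\<close> at arbitrary
  elements.\<close>

lemma PrM_proves:
  assumes "T \<turnstile> p"
  shows "PrM \<tau> e p"
proof -
  have "T \<turnstile> (Forall ^^ n) p" for n
    by (induction n) (auto intro: assms Gen)
  then have "T \<turnstile> closure p" unfolding closure_def .
  then have "PrM \<tau> e (closure p)" for e
    unfolding PrM_def code_sentence[OF sentence_closure] by (rule prv_nm)
  then show ?thesis unfolding closure_def by (rule PrM_closure)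
qed

text \<open>Replaces derivations inside \<open>M\<close>: it suffices to argue in all models of
  \<open>T\<close>, by completeness.\<close>

lemma PrM_valid: "(\<And>(N :: nat str) e. models N T \<Longrightarrow> holds N e p) \<Longrightarrow> PrM \<tau> e p"
  by (rule PrM_proves[OF complete])

lemma PrM_valid1:
  assumes "PrM \<tau> e p" "\<And>(N :: nat str) e. models N T \<Longrightarrow> holds N e p \<Longrightarrow> holds N e q"
  shows "PrM \<tau> e q"
  by (rule PrM_mp[OF PrM_valid assms(1)]) (simp add: assms(2))

lemma PrM_valid2:
  assumes "PrM \<tau> e p" "PrM \<tau> e q"
    "\<And>(N :: nat str) e. models N T \<Longrightarrow> holds N e p \<Longrightarrow> holds N e q \<Longrightarrow> holds N e r"
  shows "PrM \<tau> e r"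
  by (rule PrM_mp[OF PrM_mp[OF PrM_valid assms(1)] assms(2)]) (simp add: assms(3))

lemma s1_PrM:
  assumes "\<And>i. td (\<lambda>e. f e i)"
  shows "s1 M (\<lambda>e. PrM \<tau> (f e) p)"
  using s1_holds[OF Sg_Prdot[OF Sigma1], of M f p] assms by simp

section \<open>Provable \<Sigma>1-completeness\<close>

lemma PrM_add: "PrM \<tau> (x ## y ## (x \<oplus> y) ## e) (Add (V 0) (V 1) \<^bold>= V 2)"
proof (induction y rule: induct_s1)
  case definable
  show ?case by (intro s1_PrM tdef_scons tdef_intros)
next
  case zero
  have "PrM \<tau> (x ## e) (Add (V 0) Zero \<^bold>= V 0)"
  proof (rule PrM_valid)
    fix N :: "nat str" and e assume "models N T"
    then interpret N: is1 N using models_ISigma1 by unfold_locales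
    show "holds N e (Add (V 0) Zero \<^bold>= V 0)" by simp
  qed
  then show ?case by (simp add: PrM_def)
next
  case (succ y)
  have "PrM \<tau> (x ## y ## (x \<oplus> y) ## e) (Add (V 0) (Succ (V 1)) \<^bold>= Succ (V 2))"
    using succ
  proof (rule PrM_valid1)
    fix N :: "nat str" and e assume "models N T" and h: "holds N e (Add (V 0) (V 1) \<^bold>= V 2)"
    then interpret N: is1 N using models_ISigma1 by unfold_locales
    show "holds N e (Add (V 0) (Succ (V 1)) \<^bold>= Succ (V 2))" using h by simp
  qed
  then show ?case by (simp add: PrM_def)
qed

lemma PrM_mul: "PrM \<tau> (x ## y ## (x \<otimes> y) ## e) (Mul (V 0) (V 1) \<^bold>= V 2)"
proof (induction y rule: induct_s1)
  case definable
  show ?case by (intro s1_PrM tdef_scons tdef_intros)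
next
  case zero
  have "PrM \<tau> (x ## e) (Mul (V 0) Zero \<^bold>= Zero)"
  proof (rule PrM_valid)
    fix N :: "nat str" and e assume "models N T"
    then interpret N: is1 N using models_ISigma1 by unfold_locales
    show "holds N e (Mul (V 0) Zero \<^bold>= Zero)" by simp
  qed
  then show ?case by (simp add: PrM_def)
next
  case (succ y)
  let ?e = "x ## y ## (x \<otimes> y) ## (x \<otimes> y \<oplus> x) ## e"
  have 1: "PrM \<tau> ?e (Mul (V 0) (V 1) \<^bold>= V 2)" using succ by (simp add: PrM_def)
  have 2: "PrM \<tau> ?e (Add (V 2) (V 0) \<^bold>= V 3)" using PrM_add[of "x \<otimes> y" x] by (simp add: PrM_def)
  from 1 2 have "PrM \<tau> ?e (Mul (V 0) (Succ (V 1)) \<^bold>= V 3)"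
  proof (rule PrM_valid2)
    fix N :: "nat str" and e assume "models N T"
      and h: "holds N e (Mul (V 0) (V 1) \<^bold>= V 2)" "holds N e (Add (V 2) (V 0) \<^bold>= V 3)"
    then interpret N: is1 N using models_ISigma1 by unfold_locales
    show "holds N e (Mul (V 0) (Succ (V 1)) \<^bold>= V 3)" using h by simp
  qed
  then show ?case by (simp add: PrM_def)
qed

lemma PrM_term: "PrM \<tau> (ev M e t ## e) (lift 1 t \<^bold>= V 0)"
proof (induction t)
  case (V i)
  have "PrM \<tau> e (V i \<^bold>= V i)" by (rule PrM_valid) simp
  then show ?case by (simp add: PrM_def)
next
  case Zero
  have "PrM \<tau> e (Zero \<^bold>= Zero)" by (rule PrM_valid) simp
  then show ?case by (simp add: PrM_def)
next
  case (Succ t)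
  then have "PrM \<tau> (ev M e t ## e) (Succ (lift 1 t) \<^bold>= Succ (V 0))"
    by (rule PrM_valid1) simp
  then show ?case by (simp add: PrM_def)
next
  case (Add s t)
  let ?e = "ev M e s ## ev M e t ## (ev M e s \<oplus> ev M e t) ## e"
  have 1: "PrM \<tau> ?e (lift 3 s \<^bold>= V 0)" "PrM \<tau> ?e (lift 3 t \<^bold>= V 1)"
    using Add by (simp_all add: PrM_def numeral_3_eq_3)
  have "PrM \<tau> ?e (Add (lift 3 s) (lift 3 t) \<^bold>= Add (V 0) (V 1))"
    by (rule PrM_valid2[OF 1]) simp
  then have "PrM \<tau> ?e (Add (lift 3 s) (lift 3 t) \<^bold>= V 2)"
    by (rule PrM_valid2[OF _ PrM_add]) simp
  then show ?case by (simp add: PrM_def numeral_3_eq_3)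
next
  case (Mul s t)
  let ?e = "ev M e s ## ev M e t ## (ev M e s \<otimes> ev M e t) ## e"
  have 1: "PrM \<tau> ?e (lift 3 s \<^bold>= V 0)" "PrM \<tau> ?e (lift 3 t \<^bold>= V 1)"
    using Mul by (simp_all add: PrM_def numeral_3_eq_3)
  have "PrM \<tau> ?e (Mul (lift 3 s) (lift 3 t) \<^bold>= Mul (V 0) (V 1))"
    by (rule PrM_valid2[OF 1]) simp
  then have "PrM \<tau> ?e (Mul (lift 3 s) (lift 3 t) \<^bold>= V 2)"
    by (rule PrM_valid2[OF _ PrM_mul]) simp
  then show ?case by (simp add: PrM_def numeral_3_eq_3)
qed

text \<open>A claim about terms is proved for the numerals of their values and transferred by the
  equations of \<open>PrM_term\<close>.\<close>

lemma PrM_terms: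
  assumes "PrM \<tau> (ev M e s ## ev M e t ## e) p"
    and "\<And>(N :: nat str) e. models N T \<Longrightarrow> holds N (ev N e s ## ev N e t ## e) p \<Longrightarrow> holds N e q"
  shows "PrM \<tau> e q"
proof -
  let ?e = "ev M e s ## ev M e t ## e"
  let ?L = "lift 2 s \<^bold>= V 0 \<^bold>\<and> lift 2 t \<^bold>= V 1"
  have 1: "PrM \<tau> ?e (lift 2 s \<^bold>= V 0)" "PrM \<tau> ?e (lift 2 t \<^bold>= V 1)"
    using PrM_term[of e s] PrM_term[of e t] by (simp_all add: PrM_def numeral_2_eq_2)
  have "PrM \<tau> ?e ?L" by (rule PrM_valid2[OF 1]) simp
  then have "PrM \<tau> ?e (liftf (liftf q))"
  proof (rule PrM_valid2[OF assms(1)])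
    fix N :: "nat str" and e assume N: "models N T" and h: "holds N e p" "holds N e ?L"
    then have "e = ev N (\<lambda>i. e (i + 2)) s ## ev N (\<lambda>i. e (i + 2)) t ## (\<lambda>i. e (i + 2))"
      by (auto simp: fun_eq_iff numeral_2_eq_2 split: nat.split)
    then have "holds N (\<lambda>i. e (i + 2)) q" using assms(2)[OF N] h(1) by metis
    then show "holds N e (liftf (liftf q))" by (simp add: numeral_2_eq_2)
  qed
  then show ?thesis by (simp add: PrM_liftf)
qed

lemma PrM_refl: "PrM \<tau> (x ## x ## e) (V 0 \<^bold>= V 1)"
proof -
  have "PrM \<tau> (x ## x ## e) (V 0 \<^bold>= V 0)" by (rule PrM_valid) simp
  then show ?thesis by (simp add: PrM_def)
qed

lemma PrM_less: "x \<prec> y \<Longrightarrow> PrM \<tau> (x ## y ## e) (V 0 \<^bold>< V 1)"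
proof -
  assume "x \<prec> y"
  then obtain z where y: "y = sc (x \<oplus> z)" using less_ex_add by blast
  have "PrM \<tau> (x ## z ## (x \<oplus> z) ## e) (V 0 \<^bold>< Succ (V 2))"
  proof (rule PrM_valid1[OF PrM_add])
    fix N :: "nat str" and e assume "models N T" and h: "holds N e (Add (V 0) (V 1) \<^bold>= V 2)"
    then interpret N: is1 N using models_ISigma1 by unfold_locales
    show "holds N e (V 0 \<^bold>< Succ (V 2))" using h N.less_add_succ(1)[of "e 0" "e 1"] by auto
  qed
  then show ?thesis by (simp add: PrM_def y)
qed

text \<open>The bound is made a parameter \<open>y\<close> and raised by induction in
  \<open>M\<close> up to the value of \<open>t\<close>; in \<open>T\<close>, below
  \<open>sc y\<close> means below \<open>y\<close> or equal to \<open>y\<close>.\<close>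

lemma PrM_ball:
  assumes "\<And>x. x \<prec> ev M e t \<Longrightarrow> PrM \<tau> (x ## e) p"
  shows "PrM \<tau> e (\<^bold>\<forall> (V 0 \<^bold>< lift 1 t \<^bold>\<longrightarrow> p))"
proof -
  let ?q = "\<^bold>\<forall> (V 0 \<^bold>< V 1 \<^bold>\<longrightarrow> subst (V 0 ## (\<lambda>i. V (Suc (Suc i)))) p)"
  let ?S = "Succ (V 0) ## (\<lambda>i. V (Suc i))"
  have q: "holds N e ?q \<longleftrightarrow> (\<forall>x. mless N x (e 0) \<longrightarrow> holds N (x ## (\<lambda>i. e (Suc i))) p)" for N :: "'a str" and e
    by (simp add: holds_subst scons_ev)
  have "ev M e t \<prec> y \<or> PrM \<tau> (y ## e) ?q" for y
  proof (induction y rule: induct_s1)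
    case definable
    show ?case by (intro s1_intros s1_PrM tdef_scons)
  next
    case zero
    have "PrM \<tau> e (subst (Zero ## V) ?q)"
    proof (rule PrM_valid)
      fix N :: "nat str" and e assume "models N T"
      then interpret N: is1 N using models_ISigma1 by unfold_locales
      show "holds N e (subst (Zero ## V) ?q)" unfolding holds_subst q by simp
    qed
    moreover have "PrM \<tau> e (subst (Zero ## V) ?q) = PrM \<tau> (\<zero> ## e) ?q"
      by (rule PrM_subst) (simp split: nat.split)
    ultimately show ?case by blast
  next
    case (succ y)
    show ?case
    proof (cases "y \<prec> ev M e t")
      case True
      then have "PrM \<tau> (y ## e) ?q" "PrM \<tau> (y ## e) p" using succ assms less_asym by blast+
      then have "PrM \<tau> (y ## e) (subst ?S ?q)"
      proof (rule PrM_valid2)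
        fix N :: "nat str" and e assume "models N T" and h: "holds N e ?q" "holds N e p"
        then interpret N: is1 N using models_ISigma1 by unfold_locales
        show "holds N e (subst ?S ?q)" using h unfolding holds_subst scons_ev q by auto
      qed
      moreover have "PrM \<tau> (y ## e) (subst ?S ?q) = PrM \<tau> (sc y ## e) ?q"
        by (rule PrM_subst) (simp split: nat.split)
      ultimately show ?thesis by blast
    next
      case False
      then show ?thesis using less_linear[of y "ev M e t"] by auto
    qed
  qed
  then have "PrM \<tau> (ev M e t ## e) ?q" using less_irrefl by blast
  \<comment> \<open>\<open>PrM_terms\<close> trades two numerals for terms. Only one is at stake
    here, so \<open>t\<close> fills both places and the formula skips the second.\<close>
  then have "PrM \<tau> (ev M e t ## ev M e t ## e) (subst (V 0 ## (\<lambda>i. V (Suc (Suc i)))) ?q)"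
    using PrM_subst[of ?q "ev M e t ## ev M e t ## e" "V 0 ## (\<lambda>i. V (Suc (Suc i)))" "ev M e t ## e"]
    by (simp split: nat.split del: subst.simps)
  then show ?thesis
    by (rule PrM_terms) (unfold holds_subst scons_ev q, simp)
qed

lemma PrM_bex:
  assumes "x \<prec> ev M e t" "PrM \<tau> (x ## e) p"
    and q: "\<And>(N :: nat str) e x. models N T \<Longrightarrow> mless N x (ev N e t) \<Longrightarrow> holds N (x ## e) p \<Longrightarrow> holds N e q"
  shows "PrM \<tau> e q"
proof -
  have "PrM \<tau> (ev M (x ## e) (V 0) ## ev M (x ## e) (lift 1 t) ## x ## e) (V 0 \<^bold>< V 1)"
    using PrM_less[OF assms(1)] by simp
  then have "PrM \<tau> (x ## e) (V 0 \<^bold>< lift 1 t)" by (rule PrM_terms) simp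
  then have "PrM \<tau> (x ## e) (liftf q)"
  proof (rule PrM_valid2[OF assms(2)])
    fix N :: "nat str" and e assume N: "models N T" and h: "holds N e p" "holds N e (V 0 \<^bold>< lift 1 t)"
    show "holds N e (liftf q)"
      using q[OF N, of "e 0" "\<lambda>i. e (Suc i)"] h by simp
  qed
  then show ?thesis by (simp add: PrM_liftf)
qed

text \<open>Truth and falsity go together because \<Delta>0 is closed under negation.\<close>

lemma Delta0_complete:
  "Delta0 p \<Longrightarrow> (holds M e p \<longrightarrow> PrM \<tau> e p) \<and> (\<not> holds M e p \<longrightarrow> PrM \<tau> e (\<^bold>\<not> p))"
proof (induction arbitrary: e rule: Delta0.induct)
  case (1 s t)
  show ?case
  proof (intro conjI impI)
    assume "holds M e (s \<^bold>= t)"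
    then have "PrM \<tau> (ev M e s ## ev M e t ## e) (V 0 \<^bold>= V 1)" using PrM_refl by simp
    then show "PrM \<tau> e (s \<^bold>= t)" by (rule PrM_terms) simp
  next
    assume "\<not> holds M e (s \<^bold>= t)"
    then consider "ev M e s \<prec> ev M e t" | "ev M e t \<prec> ev M e s" using less_linear by auto
    then show "PrM \<tau> e (\<^bold>\<not> s \<^bold>= t)"
    proof cases
      case 1
      show ?thesis
      proof (rule PrM_terms[OF PrM_less[OF 1]])
        fix N :: "nat str" and e assume "models N T" and h: "holds N (ev N e s ## ev N e t ## e) (V 0 \<^bold>< V 1)"
        then interpret N: is1 N using models_ISigma1 by unfold_locales
        show "holds N e (\<^bold>\<not> s \<^bold>= t)" using h by auto
      qed
    next
      case 2
      show ?thesis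
      proof (rule PrM_terms[OF PrM_less[OF 2]])
        fix N :: "nat str" and e assume "models N T" and h: "holds N (ev N e t ## ev N e s ## e) (V 0 \<^bold>< V 1)"
        then interpret N: is1 N using models_ISigma1 by unfold_locales
        show "holds N e (\<^bold>\<not> s \<^bold>= t)" using h by auto
      qed
    qed
  qed
next
  case (2 s t)
  show ?case
  proof (intro conjI impI)
    assume "holds M e (s \<^bold>< t)"
    then have "PrM \<tau> (ev M e s ## ev M e t ## e) (V 0 \<^bold>< V 1)" using PrM_less by simp
    then show "PrM \<tau> e (s \<^bold>< t)" by (rule PrM_terms) simp
  next
    assume "\<not> holds M e (s \<^bold>< t)"
    then consider "ev M e s = ev M e t" | "ev M e t \<prec> ev M e s" using less_linear by auto
    then show "PrM \<tau> e (\<^bold>\<not> s \<^bold>< t)"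
    proof cases
      case 1
      then have "PrM \<tau> (ev M e s ## ev M e t ## e) (V 0 \<^bold>= V 1)" using PrM_refl by simp
      then show ?thesis
      proof (rule PrM_terms)
        fix N :: "nat str" and e assume "models N T" and h: "holds N (ev N e s ## ev N e t ## e) (V 0 \<^bold>= V 1)"
        then interpret N: is1 N using models_ISigma1 by unfold_locales
        show "holds N e (\<^bold>\<not> s \<^bold>< t)" using h by auto
      qed
    next
      case 2
      show ?thesis
      proof (rule PrM_terms[OF PrM_less[OF 2]])
        fix N :: "nat str" and e assume "models N T" and h: "holds N (ev N e t ## ev N e s ## e) (V 0 \<^bold>< V 1)"
        then interpret N: is1 N using models_ISigma1 by unfold_locales
        show "holds N e (\<^bold>\<not> s \<^bold>< t)" using h N.less_asym by auto
      qed
    qed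
  qed
next
  case (3 p)
  then show ?case using PrM_valid1[of e p "\<^bold>\<not> \<^bold>\<not> p"] by simp
next
  case (4 p q)
  then show ?case
    using PrM_valid1[of e q "p \<^bold>\<longrightarrow> q"] PrM_valid1[of e "\<^bold>\<not> p" "p \<^bold>\<longrightarrow> q"]
      PrM_valid2[of e p "\<^bold>\<not> q" "\<^bold>\<not> (p \<^bold>\<longrightarrow> q)"] by simp blast
next
  case (5 p t)
  show ?case
  proof (intro conjI impI)
    assume "holds M e (\<^bold>\<forall> (V 0 \<^bold>< lift 1 t \<^bold>\<longrightarrow> p))"
    then show "PrM \<tau> e (\<^bold>\<forall> (V 0 \<^bold>< lift 1 t \<^bold>\<longrightarrow> p))" using 5 by (intro PrM_ball) simp
  next
    assume "\<not> holds M e (\<^bold>\<forall> (V 0 \<^bold>< lift 1 t \<^bold>\<longrightarrow> p))"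
    then obtain x where "x \<prec> ev M e t" "\<not> holds M (x ## e) p" by auto
    then show "PrM \<tau> e (\<^bold>\<not> (\<^bold>\<forall> (V 0 \<^bold>< lift 1 t \<^bold>\<longrightarrow> p)))"
      using 5 by (intro PrM_bex[of x e t "\<^bold>\<not> p"]) auto
  qed
next
  case (6 p t)
  show ?case
  proof (intro conjI impI)
    assume "holds M e (\<^bold>\<exists> (V 0 \<^bold>< lift 1 t \<^bold>\<and> p))"
    then obtain x where "x \<prec> ev M e t" "holds M (x ## e) p" by auto
    then show "PrM \<tau> e (\<^bold>\<exists> (V 0 \<^bold>< lift 1 t \<^bold>\<and> p))"
      using 6 by (intro PrM_bex[of x e t p]) auto
  next
    assume "\<not> holds M e (\<^bold>\<exists> (V 0 \<^bold>< lift 1 t \<^bold>\<and> p))"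
    then have "PrM \<tau> e (\<^bold>\<forall> (V 0 \<^bold>< lift 1 t \<^bold>\<longrightarrow> \<^bold>\<not> p))" using 6 by (intro PrM_ball) simp
    then show "PrM \<tau> e (\<^bold>\<not> (\<^bold>\<exists> (V 0 \<^bold>< lift 1 t \<^bold>\<and> p)))" by (rule PrM_valid1) simp
  qed
qed

lemma Sg_complete: "Sg p \<Longrightarrow> holds M e p \<Longrightarrow> PrM \<tau> e p"
proof (induction arbitrary: e rule: Sg.induct)
  case (Delta0 p)
  then show ?case using Delta0_complete by blast
next
  case (And p q)
  then have "PrM \<tau> e p" "PrM \<tau> e q" by auto
  then show ?case by (rule PrM_valid2) simp
next
  case (Or p q)
  then consider "PrM \<tau> e p" | "PrM \<tau> e q" by auto
  then show ?case by cases (erule PrM_valid1, simp)+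
next
  case (Ex p)
  then obtain x where "PrM \<tau> (x ## e) p" by auto
  then have "PrM \<tau> (x ## e) (liftf (\<^bold>\<exists> p))"
  proof (rule PrM_valid1)
    fix N :: "nat str" and e assume "holds N e p"
    then have "holds N (e 0 ## (\<lambda>i. e (Suc i))) p" by simp
    then show "holds N e (liftf (\<^bold>\<exists> p))" unfolding holds_liftf holds.simps by blast
  qed
  then show ?case by (simp add: PrM_liftf)
next
  case (Ball p t)
  then show ?case by (intro PrM_ball) simp
qed

end

section \<open>Relational structures given by arithmetical interpretations\<close>

text \<open>The modal language has neither function symbols nor equality, so every arithmetical
  symbol becomes a relation.\<close>

record 'n rstr =
  rzero :: "'n \<Rightarrow> bool"
  rsucc :: "'n \<Rightarrow> 'n \<Rightarrow> bool"
  radd :: "'n \<Rightarrow> 'n \<Rightarrow> 'n \<Rightarrow> bool"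
  rmul :: "'n \<Rightarrow> 'n \<Rightarrow> 'n \<Rightarrow> bool"
  rless :: "'n \<Rightarrow> 'n \<Rightarrow> bool"
  req :: "'n \<Rightarrow> 'n \<Rightarrow> bool"

primrec trel :: "'n rstr \<Rightarrow> (nat \<Rightarrow> 'n) \<Rightarrow> tm \<Rightarrow> 'n \<Rightarrow> bool" where
  "trel N e (V i) x \<longleftrightarrow> req N (e i) x"
| "trel N e Zero x \<longleftrightarrow> rzero N x"
| "trel N e (Succ t) x \<longleftrightarrow> (\<exists>u. trel N e t u \<and> rsucc N u x)"
| "trel N e (Add s t) x \<longleftrightarrow> (\<exists>u v. trel N e s u \<and> trel N e t v \<and> radd N u v x)"
| "trel N e (Mul s t) x \<longleftrightarrow> (\<exists>u v. trel N e s u \<and> trel N e t v \<and> rmul N u v x)"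

primrec rholds :: "'n rstr \<Rightarrow> (nat \<Rightarrow> 'n) \<Rightarrow> fm \<Rightarrow> bool" where
  "rholds N e (s \<^bold>= t) \<longleftrightarrow> (\<exists>u. trel N e s u \<and> trel N e t u)"
| "rholds N e (s \<^bold>< t) \<longleftrightarrow> (\<exists>u v. trel N e s u \<and> trel N e t v \<and> rless N u v)"
| "rholds N e (\<^bold>\<not> p) \<longleftrightarrow> \<not> rholds N e p"
| "rholds N e (p \<^bold>\<longrightarrow> q) \<longleftrightarrow> (rholds N e p \<longrightarrow> rholds N e q)"
| "rholds N e (\<^bold>\<forall> p) \<longleftrightarrow> (\<forall>x. rholds N (x ## e) p)"

abbreviation "MEx A \<equiv> MNeg (MAll (MNeg A))"
abbreviation "MAnd A B \<equiv> MNeg (MImp A (MNeg B))"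
abbreviation "MIff A B \<equiv> MAnd (MImp A B) (MImp B A)"

abbreviation "pZ x \<equiv> MPred 0 [x]"
abbreviation "pS x y \<equiv> MPred 1 [x, y]"
abbreviation "pA x y z \<equiv> MPred 2 [x, y, z]"
abbreviation "pM x y z \<equiv> MPred 3 [x, y, z]"
abbreviation "pL x y \<equiv> MPred 4 [x, y]"
abbreviation "pE x y \<equiv> MPred 5 [x, y]"

primrec mterm :: "(nat \<Rightarrow> nat) \<Rightarrow> tm \<Rightarrow> nat \<Rightarrow> mfm" where
  "mterm \<sigma> (V i) x = pE (\<sigma> i) x"
| "mterm \<sigma> Zero x = pZ x"
| "mterm \<sigma> (Succ t) x = MEx (MAnd (mterm (\<lambda>i. Suc (\<sigma> i)) t 0) (pS 0 (Suc x)))"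
| "mterm \<sigma> (Add s t) x = MEx (MEx (MAnd (mterm (\<lambda>i. Suc (Suc (\<sigma> i))) s 1)
     (MAnd (mterm (\<lambda>i. Suc (Suc (\<sigma> i))) t 0) (pA 1 0 (Suc (Suc x))))))"
| "mterm \<sigma> (Mul s t) x = MEx (MEx (MAnd (mterm (\<lambda>i. Suc (Suc (\<sigma> i))) s 1)
     (MAnd (mterm (\<lambda>i. Suc (Suc (\<sigma> i))) t 0) (pM 1 0 (Suc (Suc x))))))"

primrec mform :: "fm \<Rightarrow> mfm" where
  "mform (s \<^bold>= t) = MEx (MAnd (mterm Suc s 0) (mterm Suc t 0))"
| "mform (s \<^bold>< t) = MEx (MEx (MAnd (mterm (\<lambda>i. Suc (Suc i)) s 1) (MAnd (mterm (\<lambda>i. Suc (Suc i)) t 0) (pL 1 0))))"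
| "mform (\<^bold>\<not> p) = MNeg (mform p)"
| "mform (p \<^bold>\<longrightarrow> q) = MImp (mform p) (mform q)"
| "mform (\<^bold>\<forall> p) = MAll (mform p)"

lemma mfrees_mterm: "mfrees (mterm \<sigma> t x) \<subseteq> insert x (\<sigma> ` freest t)"
proof (induction t arbitrary: \<sigma> x)
  case (Succ t)
  show ?case using Succ[of "\<lambda>i. Suc (\<sigma> i)" 0] by auto
next
  case (Add s t)
  show ?case
    using Add(1)[of "\<lambda>i. Suc (Suc (\<sigma> i))" 1] Add(2)[of "\<lambda>i. Suc (Suc (\<sigma> i))" 0] by auto
next
  case (Mul s t)
  show ?case
    using Mul(1)[of "\<lambda>i. Suc (Suc (\<sigma> i))" 1] Mul(2)[of "\<lambda>i. Suc (Suc (\<sigma> i))" 0] by auto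
qed auto

lemma mfrees_mform: "mfrees (mform p) \<subseteq> frees p"
proof (induction p)
  case (Eq s t)
  then show ?case using mfrees_mterm[of Suc s 0] mfrees_mterm[of Suc t 0] by auto
next
  case (Less s t)
  then show ?case using mfrees_mterm[of "\<lambda>i. Suc (Suc i)" s 1] mfrees_mterm[of "\<lambda>i. Suc (Suc i)" t 0] by auto
qed auto

definition prd :: "'m str \<Rightarrow> (nat \<Rightarrow> nat \<Rightarrow> fm) \<Rightarrow> nat \<Rightarrow> 'm list \<Rightarrow> bool" where
  "prd M f p vs \<longleftrightarrow> holds M (\<lambda>i. vs ! i) (f p (length vs))"

definition rel_of :: "'m str \<Rightarrow> (nat \<Rightarrow> nat \<Rightarrow> fm) \<Rightarrow> 'm rstr" where
  "rel_of M f = \<lparr>rzero = (\<lambda>x. prd M f 0 [x]), rsucc = (\<lambda>x y. prd M f 1 [x, y]),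
    radd = (\<lambda>x y z. prd M f 2 [x, y, z]), rmul = (\<lambda>x y z. prd M f 3 [x, y, z]),
    rless = (\<lambda>x y. prd M f 4 [x, y]), req = (\<lambda>x y. prd M f 5 [x, y])\<rparr>"

lemma rel_of_simps [simp]:
  "rzero (rel_of M f) = (\<lambda>x. prd M f 0 [x])" "rsucc (rel_of M f) = (\<lambda>x y. prd M f 1 [x, y])"
  "radd (rel_of M f) = (\<lambda>x y z. prd M f 2 [x, y, z])" "rmul (rel_of M f) = (\<lambda>x y z. prd M f 3 [x, y, z])"
  "rless (rel_of M f) = (\<lambda>x y. prd M f 4 [x, y])" "req (rel_of M f) = (\<lambda>x y. prd M f 5 [x, y])"
  by (simp_all add: rel_of_def)

lemma holds_MPred:
  assumes "interpretation_of f"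
  shows "holds M e (interp \<tau> f (MPred p xs)) \<longleftrightarrow> prd M f p (map e xs)"
proof -
  have "holds M (\<lambda>i. e (xs ! i)) (f p (length xs)) = holds M (\<lambda>i. map e xs ! i) (f p (length xs))"
    by (rule holds_cong) (use assms in \<open>simp add: interpretation_of_def\<close>)
  then show ?thesis by (simp add: prd_def holds_subst)
qed

declare interp.simps(1) [simp del]

lemma holds_mterm:
  "interpretation_of f \<Longrightarrow> holds M e (interp \<tau> f (mterm \<sigma> t x)) \<longleftrightarrow> trel (rel_of M f) (\<lambda>i. e (\<sigma> i)) t (e x)"
  by (induction t arbitrary: e \<sigma> x) (simp_all add: holds_MPred)

lemma holds_mform:
  "interpretation_of f \<Longrightarrow> holds M e (interp \<tau> f (mform p)) \<longleftrightarrow> rholds (rel_of M f) e p"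
  by (induction p arbitrary: e) (simp_all add: holds_MPred holds_mterm)

text \<open>Sums and products are required to be unique but not to exist everywhere: they exist on
  the image of \<open>M\<close>, by induction in \<open>M\<close>. Linearity of the order lets
  elements outside the image be placed above it.\<close>

definition rax :: "'n rstr \<Rightarrow> bool" where
  "rax N \<longleftrightarrow>
    (\<forall>x. req N x x) \<and>
    (\<forall>x y. req N x y \<longrightarrow> req N y x) \<and>
    (\<forall>x y z. req N x y \<longrightarrow> req N y z \<longrightarrow> req N x z) \<and>
    (\<exists>x. rzero N x) \<and>
    (\<forall>x y. rzero N x \<longrightarrow> req N x y \<longrightarrow> rzero N y) \<and>
    (\<forall>x y. rzero N x \<longrightarrow> rzero N y \<longrightarrow> req N x y) \<and>
    (\<forall>x. \<exists>y. rsucc N x y) \<and>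
    (\<forall>x y z. rsucc N x y \<longrightarrow> req N y z \<longrightarrow> rsucc N x z) \<and>
    (\<forall>x y x' y'. rsucc N x y \<longrightarrow> rsucc N x' y' \<longrightarrow> req N x x' \<longrightarrow> req N y y') \<and>
    (\<forall>x y x' y'. rsucc N x y \<longrightarrow> rsucc N x' y' \<longrightarrow> req N y y' \<longrightarrow> req N x x') \<and>
    (\<forall>x y. rsucc N x y \<longrightarrow> \<not> rzero N y) \<and>
    (\<forall>x y z. rzero N y \<longrightarrow> req N x z \<longrightarrow> radd N x y z) \<and>
    (\<forall>x y z y' z'. radd N x y z \<longrightarrow> rsucc N y y' \<longrightarrow> rsucc N z z' \<longrightarrow> radd N x y' z') \<and>
    (\<forall>x y z z'. radd N x y z \<longrightarrow> radd N x y z' \<longrightarrow> req N z z') \<and>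
    (\<forall>x y z. rzero N y \<longrightarrow> rzero N z \<longrightarrow> rmul N x y z) \<and>
    (\<forall>x y z y' z'. rmul N x y z \<longrightarrow> rsucc N y y' \<longrightarrow> radd N z x z' \<longrightarrow> rmul N x y' z') \<and>
    (\<forall>x y z z'. rmul N x y z \<longrightarrow> rmul N x y z' \<longrightarrow> req N z z') \<and>
    (\<forall>x y. rzero N y \<longrightarrow> \<not> rless N x y) \<and>
    (\<forall>x y y'. rsucc N y y' \<longrightarrow> (rless N x y' \<longrightarrow> \<not> rless N x y \<longrightarrow> req N x y) \<and>
      (\<not> rless N x y \<and> \<not> req N x y \<or> rless N x y')) \<and>
    (\<forall>x y. \<not> rless N x y \<longrightarrow> \<not> req N x y \<longrightarrow> rless N y x)"

text \<open>Matches the conjuncts of \<open>rax\<close> in order. The number counts the universal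
  quantifiers, and the first quantified variable has the highest index.\<close>

definition maxioms :: "(nat \<times> mfm) list" where
  "maxioms = [
    (1, pE 0 0),
    (2, MImp (pE 1 0) (pE 0 1)),
    (3, MImp (pE 2 1) (MImp (pE 1 0) (pE 2 0))),
    (0, MEx (pZ 0)),
    (2, MImp (pZ 1) (MImp (pE 1 0) (pZ 0))),
    (2, MImp (pZ 1) (MImp (pZ 0) (pE 1 0))),
    (1, MEx (pS 1 0)),
    (3, MImp (pS 2 1) (MImp (pE 1 0) (pS 2 0))),
    (4, MImp (pS 3 2) (MImp (pS 1 0) (MImp (pE 3 1) (pE 2 0)))),
    (4, MImp (pS 3 2) (MImp (pS 1 0) (MImp (pE 2 0) (pE 3 1)))),
    (2, MImp (pS 1 0) (MNeg (pZ 0))),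
    (3, MImp (pZ 1) (MImp (pE 2 0) (pA 2 1 0))),
    (5, MImp (pA 4 3 2) (MImp (pS 3 1) (MImp (pS 2 0) (pA 4 1 0)))),
    (4, MImp (pA 3 2 1) (MImp (pA 3 2 0) (pE 1 0))),
    (3, MImp (pZ 1) (MImp (pZ 0) (pM 2 1 0))),
    (5, MImp (pM 4 3 2) (MImp (pS 3 1) (MImp (pA 2 4 0) (pM 4 1 0)))),
    (4, MImp (pM 3 2 1) (MImp (pM 3 2 0) (pE 1 0))),
    (2, MImp (pZ 0) (MNeg (pL 1 0))),
    (3, MImp (pS 1 0) (MIff (pL 2 0) (MImp (MNeg (pL 2 1)) (pE 2 1)))),
    (2, MImp (MNeg (pL 1 0)) (MImp (MNeg (pE 1 0)) (pL 0 1)))]"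

definition maxiom :: mfm where
  "maxiom = foldr MAnd (map (\<lambda>(k, A). (MAll ^^ k) A) maxioms) (MImp MBot MBot)"

lemma mfrees_maxiom: "mfrees maxiom = {}"
  by (simp add: maxiom_def maxioms_def eval_nat_numeral)

lemma holds_MAnd: "holds M e (interp \<tau> f (MAnd A B)) \<longleftrightarrow> holds M e (interp \<tau> f A) \<and> holds M e (interp \<tau> f B)"
  by simp

lemma holds_maxiom:
  assumes "interpretation_of f"
  shows "holds M e (interp \<tau> f maxiom) \<longleftrightarrow> rax (rel_of M f)"
  unfolding maxiom_def maxioms_def list.map foldr.simps comp_def id_apply prod.case holds_MAnd rax_def
  by (intro arg_cong2[where f = "(\<and>)"]) (simp_all add: eval_nat_numeral holds_MPred[OF assms])

text \<open>\<open>J\<close> embeds \<open>M\<close> onto an initial segment of \<open>N\<close>. It is a relation because equality is interpreted in \<open>N\<close> by an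
  equivalence relation.\<close>

locale embedding = is1 M for M :: "'m::countable str" +
  fixes N :: "'n rstr" and J :: "'m \<Rightarrow> 'n \<Rightarrow> bool"
  assumes J_zero: "J \<zero> x \<longleftrightarrow> rzero N x"
    and J_succ: "J (sc n) x \<longleftrightarrow> (\<exists>u. J n u \<and> rsucc N u x)"
    and J_total: "\<exists>x. J n x"
    and J_eq: "J n x \<Longrightarrow> J n y \<longleftrightarrow> req N x y"
    and req_sym: "req N x y \<Longrightarrow> req N y x"
    and J_inj: "J m x \<Longrightarrow> J n x \<Longrightarrow> m = n"
    and J_add: "J m x \<Longrightarrow> J n y \<Longrightarrow> radd N x y z \<longleftrightarrow> J (m \<oplus> n) z"
    and J_mul: "J m x \<Longrightarrow> J n y \<Longrightarrow> rmul N x y z \<longleftrightarrow> J (m \<otimes> n) z"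
    and J_less: "J m x \<Longrightarrow> J n y \<Longrightarrow> rless N x y \<longleftrightarrow> m \<prec> n"
    and J_initial: "J n y \<Longrightarrow> rless N x y \<Longrightarrow> \<exists>m. J m x"
begin

lemma trel_iff: "(\<And>i. i \<in> freest t \<Longrightarrow> J (e i) (e' i)) \<Longrightarrow> trel N e' t x \<longleftrightarrow> J (ev M e t) x"
proof (induction t arbitrary: x)
  case (V i)
  then show ?case using J_eq[of "e i" "e' i" x] by simp
next
  case Zero
  then show ?case by (simp add: J_zero)
next
  case (Succ t)
  then show ?case by (simp add: J_succ)
next
  case (Add s t)
  then have "trel N e' s u \<longleftrightarrow> J (ev M e s) u" "trel N e' t u \<longleftrightarrow> J (ev M e t) u" for u by simp_all
  moreover obtain u v where "J (ev M e s) u" "J (ev M e t) v" using J_total[of "ev M e s"] J_total[of "ev M e t"] by blast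
  ultimately show ?case using J_add[of "ev M e s" _ "ev M e t" _ x] by simp blast
next
  case (Mul s t)
  then have "trel N e' s u \<longleftrightarrow> J (ev M e s) u" "trel N e' t u \<longleftrightarrow> J (ev M e t) u" for u by simp_all
  moreover obtain u v where "J (ev M e s) u" "J (ev M e t) v" using J_total[of "ev M e s"] J_total[of "ev M e t"] by blast
  ultimately show ?case using J_mul[of "ev M e s" _ "ev M e t" _ x] by simp blast
qed

lemma rholds_eq:
  assumes "\<And>i. i \<in> frees (s \<^bold>= t) \<Longrightarrow> J (e i) (e' i)"
  shows "rholds N e' (s \<^bold>= t) \<longleftrightarrow> holds M e (s \<^bold>= t)"
proof -
  have "trel N e' s u \<longleftrightarrow> J (ev M e s) u" "trel N e' t u \<longleftrightarrow> J (ev M e t) u" for u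
    using assms by (simp_all add: trel_iff)
  moreover obtain u where "J (ev M e s) u" using J_total[of "ev M e s"] by blast
  ultimately show ?thesis using J_inj[of "ev M e s" _ "ev M e t"] by (auto dest: sym)
qed

lemma rholds_less:
  assumes "\<And>i. i \<in> frees (s \<^bold>< t) \<Longrightarrow> J (e i) (e' i)"
  shows "rholds N e' (s \<^bold>< t) \<longleftrightarrow> holds M e (s \<^bold>< t)"
proof -
  have "trel N e' s u \<longleftrightarrow> J (ev M e s) u" "trel N e' t u \<longleftrightarrow> J (ev M e t) u" for u
    using assms by (simp_all add: trel_iff)
  moreover obtain u v where "J (ev M e s) u" "J (ev M e t) v" using J_total[of "ev M e s"] J_total[of "ev M e t"] by blast
  ultimately show ?thesis using J_less[of "ev M e s" _ "ev M e t"] by simp blast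
qed

text \<open>The elements of \<open>N\<close> below a value in the range of \<open>J\<close> are
  again in the range, so the quantifier sees the same elements on both sides.\<close>

lemma rholds_ball:
  assumes t: "\<And>i. i \<in> freest t \<Longrightarrow> J (e i) (e' i)"
    and p: "\<And>x y. J x y \<Longrightarrow> rholds N (y ## e') p \<longleftrightarrow> P x"
  shows "rholds N e' (\<^bold>\<forall> (V 0 \<^bold>< lift 1 t \<^bold>\<longrightarrow> p)) \<longleftrightarrow> (\<forall>x. x \<prec> ev M e t \<longrightarrow> P x)"
proof -
  have tl: "trel N (y ## e') (lift 1 t) u \<longleftrightarrow> J (ev M e t) u" for y u
  proof -
    have "trel N (y ## e') (lift 1 t) u \<longleftrightarrow> trel N e' t u"
      by (induction t arbitrary: u) simp_all
    then show ?thesis using trel_iff[of t e e' u] t by simp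
  qed
  show ?thesis
  proof
    assume h: "rholds N e' (\<^bold>\<forall> (V 0 \<^bold>< lift 1 t \<^bold>\<longrightarrow> p))"
    show "\<forall>x. x \<prec> ev M e t \<longrightarrow> P x"
    proof (intro allI impI)
      fix x assume x: "x \<prec> ev M e t"
      obtain y u where y: "J x y" "J (ev M e t) u" using J_total by metis
      then have "rless N y u" using x J_less by blast
      moreover have "req N y y" using y J_eq by blast
      ultimately have "rholds N (y ## e') (V 0 \<^bold>< lift 1 t)" using y(2) tl by auto
      then have "rholds N (y ## e') p" using h by auto
      then show "P x" using p y by blast
    qed
  next
    assume h: "\<forall>x. x \<prec> ev M e t \<longrightarrow> P x"
    have "rholds N (y ## e') p" if "rholds N (y ## e') (V 0 \<^bold>< lift 1 t)" for y
    proof -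
      from that obtain y' u where u: "req N y y'" "J (ev M e t) u" "rless N y' u" using tl by auto
      then obtain x where x: "J x y'" using J_initial by blast
      then have "x \<prec> ev M e t" using u J_less by blast
      moreover have "J x y" using J_eq[OF x] req_sym[OF u(1)] by blast
      ultimately show ?thesis using h p by blast
    qed
    then show "rholds N e' (\<^bold>\<forall> (V 0 \<^bold>< lift 1 t \<^bold>\<longrightarrow> p))" by simp
  qed
qed

lemma rholds_Delta0:
  "Delta0 p \<Longrightarrow> (\<And>i. i \<in> frees p \<Longrightarrow> J (e i) (e' i)) \<Longrightarrow> rholds N e' p \<longleftrightarrow> holds M e p"
proof (induction arbitrary: e e' rule: Delta0.induct)
  case (1 s t)
  then show ?case by (rule rholds_eq)
next
  case (2 s t)
  then show ?case by (rule rholds_less)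
next
  case (3 p)
  have "rholds N e' p = holds M e p" by (rule 3) (simp add: 3)
  then show ?case by simp
next
  case (4 p q)
  have "rholds N e' p = holds M e p" "rholds N e' q = holds M e q" by (rule 4, simp add: 4)+
  then show ?case by simp
next
  case (5 p t)
  have t: "J (e i) (e' i)" if "i \<in> freest t" for i
  proof -
    have "Suc i \<in> freest (lift 1 t)" using that by (induction t) auto
    then show ?thesis using 5 by auto
  qed
  have p: "rholds N (y ## e') p \<longleftrightarrow> holds M (x ## e) p" if "J x y" for x y
    by (rule 5) (use that 5 in \<open>auto split: nat.split\<close>)
  show ?case using rholds_ball[where e = e and t = t, OF t p] by simp
next
  case (6 p t)
  have t: "J (e i) (e' i)" if "i \<in> freest t" for i
  proof -
    have "Suc i \<in> freest (lift 1 t)" using that by (induction t) auto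
    then show ?thesis using 6 by auto
  qed
  have p: "rholds N (y ## e') (\<^bold>\<not> p) \<longleftrightarrow> holds M (x ## e) (\<^bold>\<not> p)" if "J x y" for x y
  proof -
    have "rholds N (y ## e') p \<longleftrightarrow> holds M (x ## e) p"
      by (rule 6) (use that 6 in \<open>auto split: nat.split\<close>)
    then show ?thesis by simp
  qed
  have "rholds N e' (\<^bold>\<forall> (V 0 \<^bold>< lift 1 t \<^bold>\<longrightarrow> \<^bold>\<not> p)) \<longleftrightarrow> (\<forall>x. x \<prec> ev M e t \<longrightarrow> holds M (x ## e) (\<^bold>\<not> p))"
    by (rule rholds_ball[where e = e, OF t p])
  then have "rholds N e' (\<^bold>\<exists> (V 0 \<^bold>< lift 1 t \<^bold>\<and> p)) \<longleftrightarrow> \<not> (\<forall>x. x \<prec> ev M e t \<longrightarrow> holds M (x ## e) (\<^bold>\<not> p))"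
    unfolding rholds.simps by blast
  then show ?case by simp
qed

lemma rholds_surj:
  "(\<And>y. \<exists>x. J x y) \<Longrightarrow> (\<And>i. i \<in> frees p \<Longrightarrow> J (e i) (e' i)) \<Longrightarrow> rholds N e' p \<longleftrightarrow> holds M e p"
proof (induction p arbitrary: e e')
  case (Eq s t)
  then show ?case by (intro rholds_eq)
next
  case (Less s t)
  then show ?case by (intro rholds_less)
next
  case (Neg p)
  have "rholds N e' p = holds M e p" by (rule Neg.IH[OF Neg.prems(1)]) (simp add: Neg.prems(2))
  then show ?case by simp
next
  case (Imp p q)
  have "rholds N e' p = holds M e p" "rholds N e' q = holds M e q" 
    by (rule Imp.IH(1)[OF Imp.prems(1)], simp add: Imp.prems(2),
        rule Imp.IH(2)[OF Imp.prems(1)], simp add: Imp.prems(2))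
  then show ?case by simp
next
  case (Forall p)
  have "rholds N (y ## e') p \<longleftrightarrow> holds M (x ## e) p" if "J x y" for x y
    by (rule Forall.IH[OF Forall.prems(1)]) (use that Forall.prems(2) in \<open>auto split: nat.split\<close>)
  then show ?case using Forall.prems(1) J_total by (simp, metis)
qed

end

text \<open>\<open>interpretation_of\<close> prescribes the free variables also for symbols without
  arithmetical meaning; the last clause is a true formula with exactly these.\<close>

definition std :: "nat \<Rightarrow> nat \<Rightarrow> fm" where
  "std p n = (if (p, n) = (0, 1) then V 0 \<^bold>= Zero
    else if (p, n) = (1, 2) then Succ (V 0) \<^bold>= V 1
    else if (p, n) = (2, 3) then Add (V 0) (V 1) \<^bold>= V 2
    else if (p, n) = (3, 3) then Mul (V 0) (V 1) \<^bold>= V 2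
    else if (p, n) = (4, 2) then V 0 \<^bold>< V 1
    else if (p, n) = (5, 2) then V 0 \<^bold>= V 1
    else foldr And [V i \<^bold>= V i. i \<leftarrow> [0..<n]] (Zero \<^bold>= Zero))"

lemma interpretation_std: "interpretation_of std"
proof -
  have "frees (foldr And (map (\<lambda>i. V i \<^bold>= V i) xs) (Zero \<^bold>= Zero)) = set xs" for xs
    by (induction xs) auto
  then show ?thesis
    by (auto simp: interpretation_of_def std_def numeral_2_eq_2 numeral_3_eq_3)
qed

context is1 begin

lemma prd_std [simp]:
  "prd M std 0 [x] \<longleftrightarrow> x = \<zero>" "prd M std 1 [x, y] \<longleftrightarrow> sc x = y" "prd M std (Suc 0) [x, y] \<longleftrightarrow> sc x = y"
  "prd M std 2 [x, y, z] \<longleftrightarrow> x \<oplus> y = z" "prd M std 3 [x, y, z] \<longleftrightarrow> x \<otimes> y = z"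
  "prd M std 4 [x, y] \<longleftrightarrow> x \<prec> y" "prd M std 5 [x, y] \<longleftrightarrow> x = y"
  by (simp_all add: prd_def std_def eval_nat_numeral)

lemma embedding_std: "embedding M (rel_of M std) (=)"
  by unfold_locales (auto dest: less_imp_le simp: eq_commute)

lemma rholds_std: "rholds (rel_of M std) e p \<longleftrightarrow> holds M e p"
  by (rule embedding.rholds_surj[OF embedding_std]) auto

lemma holds_mform_std: "holds M e (interp \<tau> std (mform p)) \<longleftrightarrow> holds M e p"
  by (simp add: holds_mform interpretation_std rholds_std)

lemma rax_std: "rax (rel_of M std)"
  unfolding rax_def using less_linear by (auto simp: add_comm)

end

section \<open>Definability in models of \<open>PA\<close>\<close>

abbreviation "dd M \<equiv> definable M (\<lambda>_. True)"

lemma dd_eq: "tdef M f \<Longrightarrow> tdef M g \<Longrightarrow> dd M (\<lambda>e. f e = g e)"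
  unfolding tdef_def definable_def by (metis holds.simps(1))

lemma dd_not: "dd M P \<Longrightarrow> dd M (\<lambda>e. \<not> P e)"
  unfolding definable_def by (metis holds.simps(3))

lemma dd_imp: "dd M P \<Longrightarrow> dd M Q \<Longrightarrow> dd M (\<lambda>e. P e \<longrightarrow> Q e)"
  unfolding definable_def by (metis holds.simps(4))

lemma dd_conj: "dd M P \<Longrightarrow> dd M Q \<Longrightarrow> dd M (\<lambda>e. P e \<and> Q e)"
  using dd_not[OF dd_imp[OF _ dd_not], of M P Q] by simp

lemma dd_iff: "dd M P \<Longrightarrow> dd M Q \<Longrightarrow> dd M (\<lambda>e. P e \<longleftrightarrow> Q e)"
  unfolding iff_conv_conj_imp by (intro dd_conj dd_imp)

lemma dd_less: "tdef M f \<Longrightarrow> tdef M g \<Longrightarrow> dd M (\<lambda>e. mless M (f e) (g e))"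
  unfolding tdef_def definable_def by (metis holds.simps(2))

lemma dd_all: "dd M (\<lambda>e. P (\<lambda>i. e (Suc i)) (e 0)) \<Longrightarrow> dd M (\<lambda>e. \<forall>x. P e x)"
proof -
  assume "dd M (\<lambda>e. P (\<lambda>i. e (Suc i)) (e 0))"
  then obtain p where p: "\<And>e. holds M (mix e) p = P (\<lambda>i. e (Suc i)) (e 0)"
    unfolding definable_def by blast
  have "holds M (mix e) (\<^bold>\<forall> subst unmix p) = (\<forall>x. P e x)" for e
    by (simp add: holds_subst unmix p)
  then show ?thesis unfolding definable_def by blast
qed

lemma dd_ex: "dd M (\<lambda>e. P (\<lambda>i. e (Suc i)) (e 0)) \<Longrightarrow> dd M (\<lambda>e. \<exists>x. P e x)"
  using dd_not[OF dd_all[OF dd_not[of M "\<lambda>e. P (\<lambda>i. e (Suc i)) (e 0)"]]] by simp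

lemma dd_holds:
  assumes "\<And>i. tdef M (\<lambda>e. f e i)"
  shows "dd M (\<lambda>e. holds M (f e) q)"
proof -
  obtain \<sigma> where \<sigma>: "\<And>e. (\<lambda>i. ev M (mix e) (\<sigma> i)) = f e"
    using tdef_sequence[of M f] assms by blast
  show ?thesis unfolding definable_def
    by (rule exI[of _ "subst \<sigma> q"]) (simp add: holds_subst \<sigma>)
qed

lemmas dd_intros = dd_eq dd_less dd_not dd_conj dd_iff dd_imp dd_all dd_ex tdef_intros

lemma (in is1) induct_PA [case_names PA definable zero succ]:
  assumes "models M PA" "dd M (\<lambda>e. Q (e 0))" "Q \<zero>" "\<And>x. Q x \<Longrightarrow> Q (sc x)"
  shows "Q x"
proof -
  from assms(2) obtain p where p: "\<And>e. holds M (mix e) p = Q (e 0)"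
    unfolding definable_def by blast
  define e where "e = mix (\<lambda>_::nat. \<zero>)"
  define q where "q = subst unmix p"
  have q: "holds M (x ## e) q = Q x" for x
    unfolding e_def q_def holds_subst unmix by (simp add: p)
  have "\<forall>e. holds M e (ind_axiom q)" using assms(1) by (auto simp: models_def PA_def)
  then have "holds M e (inst q Zero \<^bold>\<longrightarrow>
     (\<^bold>\<forall> q \<^bold>\<longrightarrow> subst (case_nat (Succ (V 0)) (\<lambda>i. V (Suc i))) q) \<^bold>\<longrightarrow> (\<^bold>\<forall> q))"
    unfolding ind_axiom_def all_env_closure by blast
  moreover have "holds M (x ## e) (subst (case_nat (Succ (V 0)) (\<lambda>i. V (Suc i))) q) = holds M (sc x ## e) q" for x
    by (simp add: holds_subst scons_ev)
  ultimately show ?thesis using assms(3,4) by (simp add: q)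
qed

section \<open>The embedding into an interpreted structure\<close>

lemma freest_lift: "freest (lift d t) = (\<lambda>i. i + d) ` freest t"
  by (induction t) auto

lemma freest_substt: "freest (substt \<sigma> t) = (\<Union>i\<in>freest t. freest (\<sigma> i))"
  by (induction t) auto

lemma frees_subst: "frees (subst \<sigma> p) = (\<Union>i\<in>frees p. freest (\<sigma> i))"
proof (induction p arbitrary: \<sigma>)
  case (Forall p)
  have "Suc j \<in> freest (up \<sigma> i) \<longleftrightarrow> (\<exists>k. i = Suc k \<and> j \<in> freest (\<sigma> k))" for i j
    by (cases i) (auto simp: freest_lift)
  then show ?case by (auto simp: Forall)
qed (auto simp: freest_substt)

definition patom :: "(nat \<Rightarrow> nat \<Rightarrow> fm) \<Rightarrow> nat \<Rightarrow> nat list \<Rightarrow> fm" where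
  "patom f p xs = subst (\<lambda>i. V (xs ! i)) (f p (length xs))"

lemma interp_MPred: "interp \<tau> f (MPred p xs) = patom f p xs"
  by (simp add: patom_def interp.simps(1))

lemma holds_patom: "interpretation_of f \<Longrightarrow> holds M e (patom f p xs) \<longleftrightarrow> prd M f p (map e xs)"
  using holds_MPred[of f M e undefined p xs] by (simp add: patom_def interp.simps(1))

text \<open>\<open>V 1\<close> is the element of the interpreted structure that corresponds to \<open>V 0\<close>. The substitution has
  no effect on the meaning; it removes all other free variables.\<close>

definition jform :: "(nat \<Rightarrow> nat \<Rightarrow> fm) \<Rightarrow> fm" where
  "jform f = subst (V 0 ## (\<lambda>_. V 1)) (Derivable (\<lambda>E. (\<^bold>\<exists> patom f 0 [0] \<^bold>\<and> V 1 \<^bold>= \<langle>Zero, V 0\<rangle>)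
     \<^bold>\<or> (\<^bold>\<exists> \<^bold>\<exists> \<^bold>\<exists> E 3 \<langle>V 2, V 1\<rangle> \<^bold>\<and> patom f 1 [1, 0] \<^bold>\<and> V 3 \<^bold>= \<langle>Succ (V 2), V 0\<rangle>)) \<langle>V 0, V 1\<rangle>)"

lemma frees_jform: "frees (jform f) \<subseteq> {0, 1}"
  unfolding jform_def frees_subst by (auto split: nat.splits)

context is1 begin

definition RJ :: "(nat \<Rightarrow> nat \<Rightarrow> fm) \<Rightarrow> ('m \<Rightarrow> bool) \<Rightarrow> 'm \<Rightarrow> bool" where
  "RJ f E y \<longleftrightarrow> (\<exists>x. prd M f 0 [x] \<and> y = prM \<zero> x) \<or>
    (\<exists>n u x. E (prM n u) \<and> prd M f 1 [u, x] \<and> y = prM (sc n) x)"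

definition JM :: "(nat \<Rightarrow> nat \<Rightarrow> fm) \<Rightarrow> 'm \<Rightarrow> 'm \<Rightarrow> bool" where
  "JM f n x \<longleftrightarrow> derM (RJ f) (prM n x)"

lemma holds_jform: "interpretation_of f \<Longrightarrow> holds M e (jform f) \<longleftrightarrow> JM f (e 0) (e 1)"
  unfolding jform_def JM_def holds_subst
  by (subst holds_Derivable[where R' = "RJ f"]) (simp_all add: RJ_def holds_patom disj_imp)

lemma mono_RJ: "mono (RJ f)"
  by (rule monoI_pred, unfold RJ_def, elim disj_forward ex_forward conj_forward) simp_all

lemma JM_zero: "JM f \<zero> x \<longleftrightarrow> prd M f 0 [x]"
proof
  show "JM f \<zero> x \<Longrightarrow> prd M f 0 [x]"
    using derM_unfold[OF mono_RJ, of f "prM \<zero> x"] unfolding JM_def by (auto simp: RJ_def)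
  show "prd M f 0 [x] \<Longrightarrow> JM f \<zero> x"
    unfolding JM_def by (rule derM_intro0) (simp add: RJ_def)
qed

lemma JM_succ: "JM f (sc n) x \<longleftrightarrow> (\<exists>u. JM f n u \<and> prd M f 1 [u, x])"
proof
  show "JM f (sc n) x \<Longrightarrow> \<exists>u. JM f n u \<and> prd M f 1 [u, x]"
    using derM_unfold[OF mono_RJ, of f "prM (sc n) x"] unfolding JM_def by (auto simp: RJ_def)
  assume "\<exists>u. JM f n u \<and> prd M f 1 [u, x]"
  then obtain u where u: "JM f n u" "prd M f 1 [u, x]" by blast
  show "JM f (sc n) x"
    using u(1) unfolding JM_def by (rule derM_intro1[OF mono_RJ]) (use u(2) in \<open>simp add: RJ_def\<close>)
qed

lemma dd_JM: "interpretation_of f \<Longrightarrow> td g \<Longrightarrow> td h \<Longrightarrow> dd M (\<lambda>e. JM f (g e) (h e))"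
  using dd_holds[of M "\<lambda>e. g e ## h e ## (\<lambda>_. \<zero>)" "jform f"]
  by (simp add: holds_jform tdef_scons tdef_const)

lemma dd_prd:
  assumes "interpretation_of f"
  shows "td g \<Longrightarrow> td h \<Longrightarrow> dd M (\<lambda>e. prd M f p [g e, h e])"
    and "td g \<Longrightarrow> td h \<Longrightarrow> td k \<Longrightarrow> dd M (\<lambda>e. prd M f p [g e, h e, k e])"
  using dd_holds[of M "\<lambda>e. g e ## h e ## (\<lambda>_. \<zero>)" "patom f p [0, 1]"]
    dd_holds[of M "\<lambda>e. g e ## h e ## k e ## (\<lambda>_. \<zero>)" "patom f p [0, 1, 2]"]
  by (simp_all add: holds_patom[OF assms] tdef_scons tdef_const)

text \<open>\<open>JM f\<close> has the complexity of the interpretation, so its properties need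
  induction for arbitrary formulas in \<open>M\<close>.\<close>

lemma embedding_JM:
  assumes PA: "models M PA" and f: "interpretation_of f" and r: "rax (rel_of M f)"
  shows "embedding M (rel_of M f) (JM f)"
proof -
  define Z where "Z x = prd M f 0 [x]" for x
  define S where "S x y = prd M f 1 [x, y]" for x y
  define A where "A x y z = prd M f 2 [x, y, z]" for x y z
  define P where "P x y z = prd M f 3 [x, y, z]" for x y z
  define L where "L x y = prd M f 4 [x, y]" for x y
  define E where "E x y = prd M f 5 [x, y]" for x y
  define J where "J = JM f"
  note dd_J = dd_JM[OF f, folded J_def]
  note dd_S = dd_prd(1)[OF f, of _ _ 1, folded S_def] and dd_L = dd_prd(1)[OF f, of _ _ 4, folded L_def]
    and dd_E = dd_prd(1)[OF f, of _ _ 5, folded E_def]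
    and dd_A = dd_prd(2)[OF f, of _ _ _ 2, folded A_def] and dd_P = dd_prd(2)[OF f, of _ _ _ 3, folded P_def]
  note dd = dd_intros dd_J dd_S dd_L dd_E dd_A dd_P
  note ax = r[unfolded rax_def rel_of_simps, folded Z_def S_def A_def P_def L_def E_def]
  have "\<forall>x. E x x"
    and "\<forall>x y. E x y \<longrightarrow> E y x"
    and "\<forall>x y z. E x y \<longrightarrow> E y z \<longrightarrow> E x z"
    and Z_ex: "\<exists>x. Z x"
    and "\<forall>x y. Z x \<longrightarrow> E x y \<longrightarrow> Z y"
    and "\<forall>x y. Z x \<longrightarrow> Z y \<longrightarrow> E x y"
    and "\<forall>x. \<exists>y. S x y"
    and "\<forall>x y z. S x y \<longrightarrow> E y z \<longrightarrow> S x z"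
    and "\<forall>x y x' y'. S x y \<longrightarrow> S x' y' \<longrightarrow> E x x' \<longrightarrow> E y y'"
    and "\<forall>x y x' y'. S x y \<longrightarrow> S x' y' \<longrightarrow> E y y' \<longrightarrow> E x x'"
    and "\<forall>x y. S x y \<longrightarrow> \<not> Z y"
    and "\<forall>x y z. Z y \<longrightarrow> E x z \<longrightarrow> A x y z"
    and "\<forall>x y z y' z'. A x y z \<longrightarrow> S y y' \<longrightarrow> S z z' \<longrightarrow> A x y' z'"
    and "\<forall>x y z z'. A x y z \<longrightarrow> A x y z' \<longrightarrow> E z z'"
    and "\<forall>x y z. Z y \<longrightarrow> Z z \<longrightarrow> P x y z"
    and "\<forall>x y z y' z'. P x y z \<longrightarrow> S y y' \<longrightarrow> A z x z' \<longrightarrow> P x y' z'"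
    and "\<forall>x y z z'. P x y z \<longrightarrow> P x y z' \<longrightarrow> E z z'"
    and "\<forall>x y. Z y \<longrightarrow> \<not> L x y"
    and L_S': "\<forall>x y y'. S y y' \<longrightarrow> (L x y' \<longrightarrow> \<not> L x y \<longrightarrow> E x y) \<and> (\<not> L x y \<and> \<not> E x y \<or> L x y')"
    by (insert ax, (elim conjE, assumption)+)
  note E_refl = this(1)[rule_format] and E_sym = this(2)[rule_format]
    and Z_E = this(5)[rule_format] and Z_un = this(6)[rule_format]
    and S_ex = this(7)[rule_format] and S_E = this(8)[rule_format] and S_un = this(9)[rule_format]
    and S_inj = this(10)[rule_format] and S_Z = this(11)[rule_format]
    and A_Z = this(12)[rule_format] and A_S = this(13)[rule_format] and A_un = this(14)[rule_format]
    and P_Z = this(15)[rule_format] and P_S = this(16)[rule_format] and P_un = this(17)[rule_format]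
    and L_Z = this(18)[rule_format]
  have L_S: "L x y' \<longleftrightarrow> L x y \<or> E x y" if "S y y'" for x y y' using L_S' that by blast
  have J0: "J \<zero> x \<longleftrightarrow> Z x" for x unfolding J_def Z_def by (rule JM_zero)
  have JS: "J (sc n) x \<longleftrightarrow> (\<exists>u. J n u \<and> S u x)" for n x unfolding J_def S_def by (rule JM_succ)
  note induct = induct_PA[OF PA, case_names definable zero succ]
  have total: "\<exists>x. J n x" for n
  proof (induction n rule: induct)
    case definable
    show ?case by (intro dd)
  qed (use J0 JS Z_ex S_ex in blast)+
  have un: "\<forall>x y. J n x \<longrightarrow> (J n y \<longleftrightarrow> E x y)" for n
  proof (induction n rule: induct)
    case definable
    show ?case by (intro dd)
  next
    case zero
    show ?case unfolding J0 using Z_E Z_un by blast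
  next
    case (succ n)
    show ?case unfolding JS using succ S_E S_un by blast
  qed
  have inj: "\<forall>n x. J m x \<longrightarrow> J n x \<longrightarrow> m = n" for m
  proof (induction m rule: induct)
    case definable
    show ?case by (intro dd)
  next
    case zero
    show ?case using J0 JS S_Z cases_M by metis
  next
    case (succ m)
    show ?case
    proof (intro allI impI)
      fix n x assume a: "J (sc m) x" "J n x"
      then obtain u where u: "J m u" "S u x" unfolding JS by blast
      show "sc m = n"
      proof (cases "n = \<zero>")
        case True
        then show ?thesis using a(2) u J0 S_Z by blast
      next
        case False
        then obtain n' where n: "n = sc n'" using cases_M by blast
        then obtain v where v: "J n' v" "S v x" using a(2) unfolding n JS by blast
        then have "J m v" using un u S_inj E_refl by blast
        then show ?thesis using succ v n by blast
      qed
    qed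
  qed
  \<comment> \<open>Induction proves one direction; the converse follows from uniqueness of sums in
    the interpreted structure and totality of \<open>J\<close>.\<close>
  have add': "\<forall>y z. J n y \<longrightarrow> J (m \<oplus> n) z \<longrightarrow> A x y z" if "J m x" for m n x
  proof (induction n rule: induct)
    case definable
    show ?case by (intro dd)
  next
    case zero
    show ?case unfolding add_zero J0 using un that A_Z by blast
  next
    case (succ n)
    show ?case unfolding add_succ JS using succ A_S by blast
  qed
  have add: "A x y z \<longleftrightarrow> J (m \<oplus> n) z" if "J m x" "J n y" for m n x y z
    using add'[OF that(1)] that(2) total A_un un by metis
  have mul': "\<forall>y z. J n y \<longrightarrow> J (m \<otimes> n) z \<longrightarrow> P x y z" if x: "J m x" for m n x
  proof (induction n rule: induct)
    case definable
    show ?case by (intro dd)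
  next
    case zero
    show ?case using J0 P_Z by simp
  next
    case (succ n)
    show ?case
    proof (intro allI impI)
      fix y z assume a: "J (sc n) y" "J (m \<otimes> sc n) z"
      obtain v where v: "J n v" "S v y" using a(1) unfolding JS by blast
      obtain w where w: "J (m \<otimes> n) w" using total by blast
      have "A w x z" using add[OF w x] a(2) by simp
      then show "P x y z" using succ v w P_S by blast
    qed
  qed
  have mul: "P x y z \<longleftrightarrow> J (m \<otimes> n) z" if "J m x" "J n y" for m n x y z
    using mul'[OF that(1)] that(2) total P_un un by metis
  have less: "\<forall>y. J n y \<longrightarrow> (L x y \<longleftrightarrow> m \<prec> n)" if x: "J m x" for m n x
  proof (induction n rule: induct)
    case definable
    show ?case by (intro dd)
  next
    case zero
    show ?case using J0 L_Z by simp
  next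
    case (succ n)
    show ?case
    proof (intro allI impI)
      fix y assume "J (sc n) y"
      then obtain v where v: "J n v" "S v y" unfolding JS by blast
      have "E x v \<longleftrightarrow> m = n" using un x v(1) inj by blast
      then show "L x y \<longleftrightarrow> m \<prec> sc n" using succ v L_S by simp
    qed
  qed
  have initial: "\<forall>y. J n y \<longrightarrow> L x y \<longrightarrow> (\<exists>m. J m x)" for n x
  proof (induction n rule: induct)
    case definable
    show ?case by (intro dd)
  next
    case zero
    show ?case using J0 L_Z by blast
  next
    case (succ n)
    show ?case unfolding JS using succ L_S un E_sym by blast
  qed
  have "embedding M (rel_of M f) J"
  proof (unfold_locales, unfold rel_of_simps, fold Z_def S_def A_def P_def L_def E_def)
    show "J n y \<longleftrightarrow> E x y" if "J n x" for n x y using un that by blast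
    show "m = n" if "J m x" "J n x" for m n x using inj that by blast
    show "L x y \<longleftrightarrow> m \<prec> n" if "J m x" "J n y" for m n x y using less that by blast
    show "\<exists>m. J m x" if "J n y" "L x y" for n x y using initial that by blast
  qed (fact J0 JS total E_sym add mul)+
  then show ?thesis unfolding J_def .
qed

end

section \<open>Nonstandard interpreted structures are not decidable\<close>

lemma trel_rename: "trel N e (substt (\<lambda>i. V (r i)) t) x = trel N (\<lambda>i. e (r i)) t x"
  by (induction t arbitrary: x) simp_all

lemma rholds_rename: "rholds N e (subst (\<lambda>i. V (r i)) p) = rholds N (\<lambda>i. e (r i)) p"
proof (induction p arbitrary: e r)
  case (Forall p)
  have "up (\<lambda>i. V (r i)) = (\<lambda>i. V ((0 ## (\<lambda>i. Suc (r i))) i))"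
    by (rule ext) (simp add: up_def split: nat.split)
  moreover have "(\<lambda>i. (x ## e) ((0 ## (\<lambda>i. Suc (r i))) i)) = x ## (\<lambda>i. e (r i))" for x
    by (rule ext) (simp split: nat.split)
  ultimately show ?case using Forall[of _ "0 ## (\<lambda>i. Suc (r i))"] by simp
qed (simp_all add: trel_rename)

definition neg_arg :: "fm \<Rightarrow> fm" where
  "neg_arg W = subst (V 0 ## (\<lambda>_. cNeg (V 1))) W"

definition at_arg :: "fm \<Rightarrow> nat \<Rightarrow> fm" where
  "at_arg W i = subst (\<lambda>k. V ((0 ## (\<lambda>_. i)) k)) W"

text \<open>If \<open>W\<close> says that \<open>V 0\<close> witnesses the provability of (the code) \<open>V 1\<close>, then \<open>rosser W i j\<close> says: below \<open>V j\<close>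
  there is a witness for \<open>V i\<close> that is smaller than any witness for the negation of \<open>V i\<close>.\<close>

definition rosser :: "fm \<Rightarrow> nat \<Rightarrow> nat \<Rightarrow> mfm" where
  "rosser W i j = MEx (MAnd (pL 0 (Suc j)) (MAnd (mform (at_arg W (Suc i)))
     (MAll (MImp (MImp (MNeg (pL 0 1)) (pE 0 1)) (MNeg (mform (at_arg (neg_arg W) (Suc (Suc i)))))))))"

text \<open>The premise on \<open>s'\<close> says that it is at most \<open>s\<close>, with the
  disjunction written as an implication.\<close>

definition ros :: "fm \<Rightarrow> 'n rstr \<Rightarrow> 'n \<Rightarrow> 'n \<Rightarrow> bool" where
  "ros W N x c \<longleftrightarrow> (\<exists>s. rless N s c \<and> rholds N (s ## (\<lambda>_. x)) W \<and>
     (\<forall>s'. (\<not> rless N s' s \<longrightarrow> req N s' s) \<longrightarrow> \<not> rholds N (s' ## (\<lambda>_. x)) (neg_arg W)))"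

lemma rholds_at_arg: "rholds N e (at_arg W i) = rholds N (e 0 ## (\<lambda>_. e i)) W"
proof -
  have "(\<lambda>k. e ((0 ## (\<lambda>_. i)) k)) = e 0 ## (\<lambda>_. e i)"
    by (rule ext) (simp split: nat.split)
  then show ?thesis unfolding at_arg_def rholds_rename by simp
qed

lemma holds_rosser:
  "interpretation_of f \<Longrightarrow> holds M e (interp \<tau> f (rosser W i j)) \<longleftrightarrow> ros W (rel_of M f) (e i) (e j)"
  by (simp add: rosser_def ros_def holds_MPred holds_mform rholds_at_arg) blast

lemma frees_at_arg: "frees (at_arg W i) \<subseteq> {0, i}"
  unfolding at_arg_def frees_subst by (auto split: nat.splits)

lemma mfrees_rosser: "mfrees (rosser W i j) \<subseteq> {i, j}"
  using mfrees_mform[of "at_arg W (Suc i)"] mfrees_mform[of "at_arg (neg_arg W) (Suc (Suc i))"]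
    frees_at_arg[of W "Suc i"] frees_at_arg[of "neg_arg W" "Suc (Suc i)"]
  by (auto simp: rosser_def)

text \<open>The modal axioms whose interpretations are isomorphic to the ambient model of arithmetic: those of
  a discrete order with addition and multiplication, and decidability of zero, successor and
  the Rosser relation.\<close>

definition rosser_axioms :: "fm \<Rightarrow> mfm" where
  "rosser_axioms W = MAnd maxiom (MAll (MAll (MAll (MImp (pE 2 1) (MImp (rosser W 2 0) (rosser W 1 0))))))"

text \<open>For zero and successor only positive facts are boxed: they suffice to prove that an
  element represents a number. The Rosser relation needs both signs. \<open>rosser_axioms\<close> is
  boxed so that negative Rosser facts pass between equal elements in models of the theory.\<close>

definition decidable_axioms :: "fm \<Rightarrow> mfm" where
  "decidable_axioms W = MAnd (rosser_axioms W) (MAnd (Box (rosser_axioms W))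
     (MAnd (MAll (MImp (pZ 0) (Box (pZ 0))))
     (MAnd (MAll (MAll (MImp (pS 1 0) (Box (pS 1 0)))))
     (MAnd (MAll (MAll (MImp (rosser W 1 0) (Box (rosser W 1 0)))))
           (MAll (MAll (MImp (MNeg (rosser W 1 0)) (Box (MNeg (rosser W 1 0))))))))))"

lemma mfrees_axioms: "mfrees (rosser_axioms W) = {}" "mfrees (decidable_axioms W) = {}"
  using mfrees_rosser[of W 2 0] mfrees_rosser[of W 1 0]
  by (auto simp: rosser_axioms_def decidable_axioms_def mfrees_maxiom numeral_2_eq_2)

lemma holds_rosser_axioms:
  "interpretation_of f \<Longrightarrow> holds M e (interp \<tau> f (rosser_axioms W)) \<longleftrightarrow> rax (rel_of M f) \<and>
    (\<forall>x x' c. prd M f 5 [x, x'] \<longrightarrow> ros W (rel_of M f) x c \<longrightarrow> ros W (rel_of M f) x' c)"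
  unfolding rosser_axioms_def holds_MAnd by (simp add: holds_maxiom holds_MPred holds_rosser)

locale pa_theory = arith_theory T \<tau> for T \<tau> +
  fixes W :: fm
  assumes PA: "p \<in> PA \<Longrightarrow> T \<turnstile> p"
    and W_Delta0: "Delta0 W"
    and W: "models (M :: nat str) ISigma1 \<Longrightarrow>
      holds M (\<lambda>_. u) (Pr \<tau> (V 0)) \<longleftrightarrow> (\<exists>s. holds M (s ## (\<lambda>_. u)) W)"
begin

lemma models_PA: "models M T \<Longrightarrow> models M PA"
  using soundness[OF PA] by (auto simp: models_def)

text \<open>In the situation \<open>V 0 = z\<close>, \<open>V 1 = d\<close>, \<open>V 2 = y\<close>: \<open>z\<close> is the code of the formula with code \<open>y\<close> at the
  numerals of \<open>d\<close> and \<open>y\<close>.\<close>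

definition dgform :: fm where
  "dgform = (\<^bold>\<exists> \<^bold>\<exists> Num (V 4) (V 1) \<^bold>\<and> Num (V 3) (V 0) \<^bold>\<and>
    V 2 \<^bold>= cAll (cImp (cEq (cV (num 0)) (V 1)) (cAll (cImp (cEq (cV (num 0)) (V 0)) (V 4)))))"

definition gform :: "(nat \<Rightarrow> nat \<Rightarrow> fm) \<Rightarrow> fm" where
  "gform f = subst (V 0 ## (\<lambda>_. V 1)) (\<^bold>\<forall> (dgform \<^bold>\<longrightarrow>
    \<^bold>\<not> (\<^bold>\<exists> subst (V 1 ## (\<lambda>_. V 0)) (jform f) \<^bold>\<and> interp \<tau> f (rosser W 0 2))))"

text \<open>A fixed point: \<open>sform f\<close> says of \<open>d = V 0\<close> that its own code at \<open>d\<close> is not in the set decided by \<open>d\<close>.\<close>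

definition sform :: "(nat \<Rightarrow> nat \<Rightarrow> fm) \<Rightarrow> fm" where
  "sform f = (\<^bold>\<forall> (V 0 \<^bold>= num (gn (gform f)) \<^bold>\<longrightarrow> (\<^bold>\<forall> (V 0 \<^bold>= V 2 \<^bold>\<longrightarrow> gform f))))"

text \<open>The graph of the diagonal function in \<Sigma>1 form, so that its values are provable
  also at nonstandard arguments.\<close>

definition dform :: "(nat \<Rightarrow> nat \<Rightarrow> fm) \<Rightarrow> fm" where
  "dform f = subst (V 0 ## V 1 ## (\<lambda>_. num (gn (gform f)))) dgform"

lemma Sg_dform: "Sg (dform f)"
  unfolding dform_def dgform_def by (intro Sg_subst Sg_intros Sg_Num)

end

context is1 begin

lemma ctm_num [simp]: "ctm \<rho> (num k) = numM (nm k)"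
  by (induction k) (simp_all add: nm.simps num.simps)

text \<open>With all its variables bound from outside, a formula has a code independent of
  \<open>\<sigma>\<close>. This is applied to \<open>gform f\<close> below the two quantifiers of
  \<open>sform f\<close>.\<close>

lemma cfm_bound:
  "(\<And>i. i \<in> frees p \<Longrightarrow> i < n + d) \<Longrightarrow> cfm \<sigma> (n + d) p = cfm (cvar V) d p"
proof (induction p arbitrary: d)
  have u: "under d (cvar V) = (\<lambda>i. tag 0 (nm i))" for d
    by (rule ext) (simp add: under_def cvar_V)
  {
    case (Eq s t)
    have "ctm (under (n + d) \<sigma>) s = ctm (under d (cvar V)) s" "ctm (under (n + d) \<sigma>) t = ctm (under d (cvar V)) t"
      unfolding u by (rule ctm_cong, simp add: under_def Eq)+
    then show ?case by simp
  next
    case (Less s t)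
    have "ctm (under (n + d) \<sigma>) s = ctm (under d (cvar V)) s" "ctm (under (n + d) \<sigma>) t = ctm (under d (cvar V)) t"
      unfolding u by (rule ctm_cong, simp add: under_def Less)+
    then show ?case by simp
  next
    case (Neg p)
    have "cfm \<sigma> (n + d) p = cfm (cvar V) d p" by (rule Neg.IH) (simp add: Neg.prems)
    then show ?case by simp
  next
    case (Imp p q)
    have "cfm \<sigma> (n + d) p = cfm (cvar V) d p" "cfm \<sigma> (n + d) q = cfm (cvar V) d q"
      by (rule Imp.IH, simp add: Imp.prems)+
    then show ?case by simp
  next
    case (Forall p)
    have "cfm \<sigma> (n + Suc d) p = cfm (cvar V) (Suc d) p"
    proof (rule Forall.IH)
      fix i assume "i \<in> frees p"
      then show "i < n + Suc d" using Forall.prems[of "i - 1"] by (cases i) auto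
    qed
    then show ?case by simp
  }
qed

end

context theory_in
begin

text \<open>Dependence on \<open>X\<close> is required in models only, which avoids computing the
  free variables of interpreted formulas: variables outside \<open>X\<close> are replaced by
  \<open>Zero\<close>, giving an equivalent formula.\<close>

lemma PrM_semantic_cong_set:
  assumes "PrM \<tau> e p" "\<And>i. i \<in> X \<Longrightarrow> e i = e' i"
    and p: "\<And>(N :: nat str) e e'. models N T \<Longrightarrow> (\<And>i. i \<in> X \<Longrightarrow> e i = e' i) \<Longrightarrow> holds N e p = holds N e' p"
  shows "PrM \<tau> e' p"
proof -
  let ?p = "subst (\<lambda>i. if i \<in> X then V i else Zero) p"
  have p': "holds N e ?p = holds N e p" if "models N T" for N :: "nat str" and e
    unfolding holds_subst by (rule p[OF that]) simp
  have "frees ?p \<subseteq> X" unfolding frees_subst by (auto split: if_splits)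
  moreover have "PrM \<tau> e ?p" by (rule PrM_valid1[OF assms(1)]) (simp add: p')
  ultimately have "PrM \<tau> e' ?p" using PrM_cong[of ?p e e'] assms(2) by blast
  then show ?thesis by (rule PrM_valid1) (simp add: p')
qed

lemma PrM_semantic_cong:
  assumes "PrM \<tau> e p" "\<And>i. i < k \<Longrightarrow> e i = e' i"
    and p: "\<And>(N :: nat str) e e'. models N T \<Longrightarrow> (\<And>i. i < k \<Longrightarrow> e i = e' i) \<Longrightarrow> holds N e p = holds N e' p"
  shows "PrM \<tau> e' p"
proof (rule PrM_semantic_cong_set[OF assms(1), of "{..<k}"])
  show "holds N e p = holds N e' p" if "models N T" "\<And>i. i \<in> {..<k} \<Longrightarrow> e i = e' i" for N :: "nat str" and e e'
    by (rule p[OF that(1)]) (use that(2) in simp)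
qed (use assms(2) in simp)

end

section \<open>Surjectivity of the embedding\<close>

locale pa_theory_in = theory_in M T \<tau> + pa_theory T \<tau> W for M :: "nat str" and T \<tau> W +
  assumes model: "models M T"
begin

definition dgM :: "(nat \<Rightarrow> nat \<Rightarrow> fm) \<Rightarrow> nat \<Rightarrow> nat" where
  "dgM f d = allM (impM (tag 5 (prM (tag 0 (nm 0)) (numM (nm (gn (gform f))))))
     (allM (impM (tag 5 (prM (tag 0 (nm 0)) (numM d))) (nm (gn (gform f))))))"

lemma holds_dgform: "holds M e dgform \<longleftrightarrow> e 0 = allM (impM (tag 5 (prM (tag 0 (nm 0)) (numM (e 2))))
     (allM (impM (tag 5 (prM (tag 0 (nm 0)) (numM (e 1)))) (e 2))))"
  unfolding dgform_def by (auto simp: numR_numM)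

lemma holds_dform: "holds M e (dform f) \<longleftrightarrow> e 0 = dgM f (e 1)"
  unfolding dform_def holds_subst holds_dgform by (simp add: dgM_def)

lemma holds_gform:
  assumes "interpretation_of f"
  shows "holds M e (gform f) \<longleftrightarrow> \<not> (\<exists>x. JM f (allM (impM (tag 5 (prM (tag 0 (nm 0)) (numM (e 1))))
     (allM (impM (tag 5 (prM (tag 0 (nm 0)) (numM (e 0)))) (e 1))))) x \<and> ros W (rel_of M f) x (e 0))"
  unfolding gform_def holds_subst[of M e "V 0 ## (\<lambda>_. V 1)"]
  by (simp add: holds_subst scons_ev holds_dgform holds_jform[OF assms] holds_rosser[OF assms])

lemma frees_gform: "frees (gform f) \<subseteq> {0, 1}"
  unfolding gform_def frees_subst by (auto split: nat.splits)

lemma holds_sform: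
  assumes "interpretation_of f"
  shows "holds M e (sform f) \<longleftrightarrow> \<not> (\<exists>x. JM f (dgM f (e 0)) x \<and> ros W (rel_of M f) x (e 0))"
  unfolding sform_def by (simp add: holds_gform[OF assms] dgM_def)

text \<open>The self-reference. In \<open>sform\<close> the arguments of \<open>gform\<close> are
  fixed by equations under quantifiers, not by substitution, so its code arises from numerals by
  pairing alone and \<open>dgform\<close> can compute it.\<close>

lemma code_sform: "code e (sform f) = dgM f (e 0)"
proof -
  have "cfm (\<lambda>_ i. numM (e i)) (2 + 0) (gform f) = nm (gn (gform f))"
    unfolding nm_gn by (intro cfm_bound) (use frees_gform in fastforce)
  then show ?thesis
    by (simp add: code_def sform_def dgM_def under_def numeral_2_eq_2)
qed

lemma W_prvM: "prvM \<tau> u \<longleftrightarrow> (\<exists>s. holds M (s ## (\<lambda>_. u)) W)"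
  using W[OF models, of u] by simp

lemma W_prvM_neg: "prvM \<tau> (negM u) \<longleftrightarrow> (\<exists>s. holds M (s ## (\<lambda>_. u)) (neg_arg W))"
  unfolding W_prvM by (simp add: neg_arg_def holds_subst scons_ev)

lemma PrM_jform_subst:
  assumes "ctm (\<lambda>i. numM (e i)) s = numM n" "ctm (\<lambda>i. numM (e i)) t = numM x"
  shows "PrM \<tau> e (subst (s ## (\<lambda>_. t)) (jform f)) = PrM \<tau> (n ## x ## e') (jform f)"
  by (rule PrM_subst) (use assms frees_jform[of f] in \<open>auto split: nat.split\<close>)

text \<open>Induction on \<open>n\<close> in \<open>M\<close>: a chain of provable successor facts
  starting from a provable zero. \<open>JM f\<close> may be of any complexity, so full induction is
  used.\<close>

lemma PrM_JM:
  assumes f: "interpretation_of f"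
    and Z: "\<And>x e. prd M f 0 [x] \<Longrightarrow> PrM \<tau> (x ## e) (patom f 0 [0])"
    and S: "\<And>x y e. prd M f 1 [x, y] \<Longrightarrow> PrM \<tau> (y ## x ## e) (patom f 1 [1, 0])"
  shows "JM f n x \<Longrightarrow> PrM \<tau> (n ## x ## e) (jform f)"
proof -
  have "\<forall>x. JM f n x \<longrightarrow> PrM \<tau> (n ## x ## e) (jform f)"
  proof (induction n rule: induct_PA)
    case PA
    show ?case using models_PA[OF model] .
  next
    case definable
    have "dd M (\<lambda>e'. holds M (e' (Suc 0) ## e' 0 ## e) (Prdot \<tau> (jform f)))"
      by (intro dd_holds tdef_scons tdef_intros)
    then have "dd M (\<lambda>e'. PrM \<tau> (e' (Suc 0) ## e' 0 ## e) (jform f))" by simp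
    then show ?case by (intro dd_intros dd_JM f)
  next
    case zero
    show ?case
    proof (intro allI impI)
      fix x assume "JM f \<zero> x"
      then have "PrM \<tau> (x ## e) (patom f 0 [0])" using Z JM_zero by blast
      then have "PrM \<tau> (x ## e) (subst (Zero ## (\<lambda>_. V 0)) (jform f))"
      proof (rule PrM_valid1)
        fix N :: "nat str" and e assume N: "models N T" and h: "holds N e (patom f 0 [0])"
        then interpret N: is1 N using models_ISigma1 by unfold_locales
        show "holds N e (subst (Zero ## (\<lambda>_. V 0)) (jform f))"
          using h by (simp add: holds_subst N.holds_jform[OF f] N.JM_zero holds_patom[OF f])
      qed
      then show "PrM \<tau> (\<zero> ## x ## e) (jform f)" by (subst (asm) PrM_jform_subst) simp_all
    qed
  next
    case (succ n)
    show ?case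
    proof (intro allI impI)
      fix x assume "JM f (sc n) x"
      then obtain u where u: "JM f n u" "prd M f 1 [u, x]" unfolding JM_succ by blast
      let ?e = "x ## u ## n ## e"
      have "PrM \<tau> ?e (subst (V 2 ## (\<lambda>_. V 1)) (jform f)) = PrM \<tau> (n ## u ## e) (jform f)"
        by (rule PrM_jform_subst) simp_all
      then have "PrM \<tau> ?e (subst (V 2 ## (\<lambda>_. V 1)) (jform f))" using succ u(1) by blast
      moreover have "PrM \<tau> ?e (patom f 1 [1, 0])" using S u(2) by blast
      ultimately have "PrM \<tau> ?e (subst (Succ (V 2) ## (\<lambda>_. V 0)) (jform f))"
      proof (rule PrM_valid2)
        fix N :: "nat str" and e assume N: "models N T"
          and h: "holds N e (subst (V 2 ## (\<lambda>_. V 1)) (jform f))" "holds N e (patom f 1 [1, 0])"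
        then interpret N: is1 N using models_ISigma1 by unfold_locales
        show "holds N e (subst (Succ (V 2) ## (\<lambda>_. V 0)) (jform f))"
          using h by (auto simp: holds_subst N.holds_jform[OF f] N.JM_succ holds_patom[OF f])
      qed
      then show "PrM \<tau> (sc n ## x ## e) (jform f)" by (subst (asm) PrM_jform_subst) simp_all
    qed
  qed
  then show "JM f n x \<Longrightarrow> PrM \<tau> (n ## x ## e) (jform f)" by blast
qed

lemma decidableD:
  assumes f: "interpretation_of f" and d: "holds M e0 (interp \<tau> f (decidable_axioms W))"
  shows "holds M e (interp \<tau> f (rosser_axioms W))"
    and "PrM \<tau> e (interp \<tau> f (rosser_axioms W))"
    and "prd M f 0 [x] \<Longrightarrow> PrM \<tau> (x ## e) (patom f 0 [0])"
    and "prd M f 1 [x, y] \<Longrightarrow> PrM \<tau> (y ## x ## e) (patom f 1 [1, 0])"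
    and "ros W (rel_of M f) x c \<Longrightarrow> PrM \<tau> (c ## x ## e) (interp \<tau> f (rosser W 1 0))"
    and "\<not> ros W (rel_of M f) x c \<Longrightarrow> PrM \<tau> (c ## x ## e) (\<^bold>\<not> interp \<tau> f (rosser W 1 0))"
proof -
  let ?R = "interp \<tau> f (rosser W 1 0)"
  note d' = d[unfolded decidable_axioms_def holds_MAnd]
  show "holds M e (interp \<tau> f (rosser_axioms W))"
    using d' unfolding holds_rosser_axioms[OF f] by blast
  have "PrM \<tau> e0 (interp \<tau> f (rosser_axioms W))" using d' by simp
  then show "PrM \<tau> e (interp \<tau> f (rosser_axioms W))"
    by (rule PrM_semantic_cong[where k = 0]) (simp_all add: holds_rosser_axioms[OF f])
  have P: "holds N e (patom f p xs) = holds N e' (patom f p xs)"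
    if "\<And>i. i < k \<Longrightarrow> e i = e' i" "set xs \<subseteq> {..<k}" for N :: "nat str" and e e' p xs k
  proof -
    have "map e xs = map e' xs" by (rule map_cong) (use that in auto)
    then show ?thesis unfolding holds_patom[OF f] by (rule arg_cong)
  qed
  show "PrM \<tau> (x ## e) (patom f 0 [0])" if "prd M f 0 [x]"
  proof (rule PrM_semantic_cong[where k = 1])
    show "PrM \<tau> (x ## e0) (patom f 0 [0])" using d' that by (simp add: holds_MPred[OF f] interp_MPred holds_patom[OF f])
    show "holds N e (patom f 0 [0]) = holds N e' (patom f 0 [0])" if "\<And>i. i < 1 \<Longrightarrow> e i = e' i" for N :: "nat str" and e e'
      by (rule P[where k = 1]) (use that in simp_all)
  qed simp
  show "PrM \<tau> (y ## x ## e) (patom f 1 [1, 0])" if "prd M f 1 [x, y]"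
  proof (rule PrM_semantic_cong[where k = 2])
    show "PrM \<tau> (y ## x ## e0) (patom f 1 [1, 0])" using d' that by (simp add: interp_MPred holds_patom[OF f])
    show "holds N e (patom f 1 [1, 0]) = holds N e' (patom f 1 [1, 0])" if "\<And>i. i < 2 \<Longrightarrow> e i = e' i" for N :: "nat str" and e e'
      by (rule P[where k = 2]) (use that in simp_all)
  qed (auto simp: less_Suc_eq numeral_2_eq_2)
  have R: "holds N e ?R = holds N e' ?R" if "\<And>i. i < 2 \<Longrightarrow> e i = e' i" for N :: "nat str" and e e'
    using that[of 0] that[of 1] unfolding holds_rosser[OF f] by simp
  show "PrM \<tau> (c ## x ## e) ?R" if "ros W (rel_of M f) x c"
  proof (rule PrM_semantic_cong[where k = 2])
    show "PrM \<tau> (c ## x ## e0) ?R" using d' that by (simp add: holds_rosser[OF f])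
    show "holds N e ?R = holds N e' ?R" if "\<And>i. i < 2 \<Longrightarrow> e i = e' i" for N :: "nat str" and e e'
      by (rule R[OF that])
  qed (auto simp: less_Suc_eq numeral_2_eq_2)
  show "PrM \<tau> (c ## x ## e) (\<^bold>\<not> ?R)" if "\<not> ros W (rel_of M f) x c"
  proof (rule PrM_semantic_cong[where k = 2])
    show "PrM \<tau> (c ## x ## e0) (\<^bold>\<not> ?R)" using d' that by (simp add: holds_rosser[OF f])
    show "holds N e (\<^bold>\<not> ?R) = holds N e' (\<^bold>\<not> ?R)" if "\<And>i. i < 2 \<Longrightarrow> e i = e' i" for N :: "nat str" and e e'
      using R[OF that] by simp
  qed (auto simp: less_Suc_eq numeral_2_eq_2)
qed

lemma JM_surj:
  assumes f: "interpretation_of f" and con: "\<not> PrM \<tau> e0 (Zero \<^bold>= num 1)"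
    and d: "holds M e0 (interp \<tau> f (decidable_axioms W))"
  shows "\<exists>n. JM f n c"
proof (rule ccontr)
  assume c: "\<nexists>n. JM f n c"
  note D = decidableD[OF f d]
  have ax: "rax (rel_of M f)" using D(1) holds_rosser_axioms[OF f] by blast
  interpret emb: embedding M "rel_of M f" "JM f" by (rule embedding_JM[OF models_PA[OF model] f ax])
  define i where "i = dgM f c"
  obtain x where x: "JM f i x" using emb.J_total by blast
  define e where "e = c ## x ## i ## (\<lambda>_. \<zero>)"
  let ?j = "subst (V 2 ## (\<lambda>_. V 1)) (jform f)" and ?d = "subst (V 2 ## (\<lambda>_. V 0)) (dform f)"
  have "PrM \<tau> e ?j = PrM \<tau> (i ## x ## e) (jform f)"
    by (rule PrM_jform_subst) (simp_all add: e_def)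
  then have j: "PrM \<tau> e ?j" using PrM_JM[OF f D(3) D(4) x] by simp
  \<comment> \<open>The theory must know that \<open>i\<close> is the code which the fixed point at
    \<open>c\<close> talks about.\<close>
  have d: "PrM \<tau> e ?d"
    by (rule Sg_complete[OF Sg_subst[OF Sg_dform]]) (simp add: holds_subst holds_dform e_def i_def)
  have jd: "PrM \<tau> e (?j \<^bold>\<and> ?d)" by (rule PrM_valid2[OF j d]) simp
  have i: "code e (sform f) = i" by (simp add: code_sform i_def e_def)
  have con: "\<not> (PrM \<tau> e (sform f) \<and> PrM \<tau> e (\<^bold>\<not> sform f))"
  proof
    assume a: "PrM \<tau> e (sform f) \<and> PrM \<tau> e (\<^bold>\<not> sform f)"
    have "PrM \<tau> e (Zero \<^bold>= num 1)"
      by (rule PrM_valid2[OF conjunct1[OF a] conjunct2[OF a]]) simp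
    then show False using con PrM_cong[of "Zero \<^bold>= num 1" e e0] by simp
  qed
  have P: "PrM \<tau> e (sform f) \<longleftrightarrow> (\<exists>s. holds M (s ## (\<lambda>_. i)) W)"
    unfolding PrM_def i by (rule W_prvM)
  have N: "PrM \<tau> e (\<^bold>\<not> sform f) \<longleftrightarrow> (\<exists>s. holds M (s ## (\<lambda>_. i)) (neg_arg W))"
    unfolding PrM_def code_simps i by (rule W_prvM_neg)
  \<comment> \<open>\<open>W\<close> is bounded and \<open>JM f\<close> is an initial embedding, so
    witnesses in its range mean the same in both structures.\<close>
  have rW: "rholds (rel_of M f) (s' ## (\<lambda>_. x)) W \<longleftrightarrow> holds M (s ## (\<lambda>_. i)) W"
    "rholds (rel_of M f) (s' ## (\<lambda>_. x)) (neg_arg W) \<longleftrightarrow> holds M (s ## (\<lambda>_. i)) (neg_arg W)" if "JM f s s'" for s s'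
  proof -
    have "Delta0 (neg_arg W)" unfolding neg_arg_def by (rule Delta0_subst[OF W_Delta0])
    moreover have "JM f ((s ## (\<lambda>_. i)) k) ((s' ## (\<lambda>_. x)) k)" for k
      using that x by (simp split: nat.split)
    ultimately show "rholds (rel_of M f) (s' ## (\<lambda>_. x)) W \<longleftrightarrow> holds M (s ## (\<lambda>_. i)) W"
      "rholds (rel_of M f) (s' ## (\<lambda>_. x)) (neg_arg W) \<longleftrightarrow> holds M (s ## (\<lambda>_. i)) (neg_arg W)"
      using emb.rholds_Delta0 W_Delta0 by blast+
  qed
  let ?L = "\<lambda>x y. prd M f 4 [x, y]" and ?E = "\<lambda>x y. prd M f 5 [x, y]"
  have linear: "?L a b \<or> ?E a b \<or> ?L b a" for a b
    using ax unfolding rax_def rel_of_simps by blast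
  have range: "\<exists>m. JM f m s" if "JM f n t" "?L s t \<or> ?E s t" for s t n
    using that emb.J_initial[of n t s] emb.J_eq[of n t s] emb.req_sym[of s t] by auto
  show False
  proof (cases "ros W (rel_of M f) x c")
    case True
    have "PrM \<tau> e (\<^bold>\<not> sform f)"
    proof (rule PrM_valid2[OF jd])
      show "PrM \<tau> e (interp \<tau> f (rosser W 1 0))" unfolding e_def by (rule D(5)[OF True])
      fix N :: "nat str" and e
      assume N: "models N T" and h: "holds N e (?j \<^bold>\<and> ?d)" "holds N e (interp \<tau> f (rosser W 1 0))"
      interpret N: pa_theory_in N T \<tau> W using N models_ISigma1 by unfold_locales
      show "holds N e (\<^bold>\<not> sform f)"
        using h by (auto simp: holds_subst N.holds_sform[OF f] N.holds_dform N.holds_jform[OF f] holds_rosser[OF f])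
    qed
    then obtain t where t: "holds M (t ## (\<lambda>_. i)) (neg_arg W)" and np: "\<not> (\<exists>s. holds M (s ## (\<lambda>_. i)) W)"
      using N P con by blast
    obtain t' where t': "JM f t t'" using emb.J_total by blast
    obtain s where s: "rholds (rel_of M f) (s ## (\<lambda>_. x)) W"
      and s': "\<And>s'. ?L s' s \<or> ?E s' s \<Longrightarrow> \<not> rholds (rel_of M f) (s' ## (\<lambda>_. x)) (neg_arg W)"
      using True unfolding ros_def rel_of_simps by blast
    \<comment> \<open>The Rosser witness \<open>s\<close> precedes the image \<open>t'\<close> of a
      refutation in \<open>M\<close>. Hence \<open>s\<close> is in the range too and comes from a
      proof in \<open>M\<close>, which consistency excludes.\<close>
    have "\<not> (?L t' s \<or> ?E t' s)" using s' rW(2)[OF t'] t by blast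
    then have "?L s t' \<or> ?E s t'" using linear by blast
    then obtain s0 where "JM f s0 s" using range[OF t'] by blast
    then show False using rW(1) s np by blast
  next
    case False
    have "PrM \<tau> e (\<^bold>\<not> interp \<tau> f (rosser W 1 0))" unfolding e_def by (rule D(6)[OF False])
    then have "PrM \<tau> e (\<^bold>\<not> interp \<tau> f (rosser W 1 0) \<^bold>\<and> interp \<tau> f (rosser_axioms W))"
      by (rule PrM_valid2[OF _ D(2)]) simp
    \<comment> \<open>\<open>sform\<close> speaks of every element that represents its code, so the
      negative fact at \<open>x\<close> must be carried to all elements equal to \<open>x\<close> in
      the interpreted structure.\<close>
    then have "PrM \<tau> e (sform f)"
    proof (rule PrM_valid2[OF jd])
      fix N :: "nat str" and e
      assume N: "models N T" and h: "holds N e (?j \<^bold>\<and> ?d)"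
        "holds N e (\<^bold>\<not> interp \<tau> f (rosser W 1 0) \<^bold>\<and> interp \<tau> f (rosser_axioms W))"
      interpret N: pa_theory_in N T \<tau> W using N models_ISigma1 by unfold_locales
      have ax: "rax (rel_of N f)"
        and cong: "\<And>x x' c. prd N f 5 [x, x'] \<Longrightarrow> ros W (rel_of N f) x c \<Longrightarrow> ros W (rel_of N f) x' c"
        using h(2) by (simp_all add: holds_rosser_axioms[OF f])
      interpret emb: embedding N "rel_of N f" "N.JM f" by (rule N.embedding_JM[OF models_PA[OF N] f ax])
      have j: "N.JM f (N.dgM f (e 0)) (e 1)" and nr: "\<not> ros W (rel_of N f) (e 1) (e 0)"
        using h by (auto simp: holds_subst N.holds_dform N.holds_jform[OF f] holds_rosser[OF f])
      have "\<not> ros W (rel_of N f) y (e 0)" if "N.JM f (N.dgM f (e 0)) y" for y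
        using emb.J_eq[OF that, of "e 1"] j nr cong by auto
      then show "holds N e (sform f)" by (auto simp: N.holds_sform[OF f])
    qed
    then obtain s where s: "holds M (s ## (\<lambda>_. i)) W" and np: "\<not> (\<exists>s. holds M (s ## (\<lambda>_. i)) (neg_arg W))"
      using N P con by blast
    obtain s' where s': "JM f s s'" using emb.J_total by blast
    \<comment> \<open>Being outside the range, \<open>c\<close> lies above the image of every proof
      in \<open>M\<close>.\<close>
    have "?L s' c" using linear[of s' c] range[OF s', of c] c emb.req_sym[of s' c] by auto
    moreover have "\<not> rholds (rel_of M f) (t' ## (\<lambda>_. x)) (neg_arg W)" if "?L t' s' \<or> ?E t' s'" for t'
      using range[OF s' that] rW(2) np by blast
    moreover have "rholds (rel_of M f) (s' ## (\<lambda>_. x)) W" using rW(1)[OF s'] s by blast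
    ultimately have "ros W (rel_of M f) x c" unfolding ros_def rel_of_simps by blast
    then show False using False by simp
  qed
qed

end

section \<open>Transfer between the two theories\<close>

abbreviation mcon :: mfm where "mcon \<equiv> MNeg (Box MBot)"

lemma interp_MAll_iter: "interp \<tau> f ((MAll ^^ n) A) = (Forall ^^ n) (interp \<tau> f A)"
  by (induction n) simp_all

lemma mfrees_MAll_iter: "mfrees ((MAll ^^ n) A) = {i. i + n \<in> mfrees A}"
  by (induction n) auto

lemma finite_mfrees: "finite (mfrees A)"
proof (induction A)
  case (MAll A)
  have "{i. Suc i \<in> mfrees A} = Suc -` mfrees A" by auto
  then show ?case using MAll by (auto intro: finite_vimageI)
qed auto

lemma (in arith_theory) holds_interp_cong:
  assumes f: "interpretation_of f"
  shows "models (N :: nat str) T \<Longrightarrow> (\<And>i. i \<in> mfrees A \<Longrightarrow> e i = e' i) \<Longrightarrow>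
    holds N e (interp \<tau> f A) = holds N e' (interp \<tau> f A)"
proof (induction A arbitrary: N e e')
  case (MPred p xs)
  have "map e xs = map e' xs" by (rule map_cong) (use MPred in auto)
  then show ?case unfolding holds_MPred[OF f] by (rule arg_cong)
next
  case (MNeg A)
  have "holds N e (interp \<tau> f A) = holds N e' (interp \<tau> f A)" by (rule MNeg.IH) (simp_all add: MNeg.prems)
  then show ?case by simp
next
  case (MImp A B)
  have "holds N e (interp \<tau> f A) = holds N e' (interp \<tau> f A)" "holds N e (interp \<tau> f B) = holds N e' (interp \<tau> f B)"
    by (rule MImp.IH, simp_all add: MImp.prems)+
  then show ?case by simp
next
  case (MAll A)
  have "holds N (x ## e) (interp \<tau> f A) = holds N (x ## e') (interp \<tau> f A)" for x
    by (rule MAll.IH) (auto simp: MAll.prems split: nat.split)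
  then show ?case by simp
next
  case (Box A)
  interpret N: theory_in N T \<tau> using Box.prems(1) models_ISigma1 by unfold_locales
  have *: "N.PrM \<tau> e' (interp \<tau> f A)" if "N.PrM \<tau> e (interp \<tau> f A)" "\<And>i. i \<in> mfrees A \<Longrightarrow> e i = e' i" for e e'
    by (rule N.PrM_semantic_cong_set[OF that(1,2) Box.IH])
  have "N.PrM \<tau> e (interp \<tau> f A) = N.PrM \<tau> e' (interp \<tau> f A)"
    using *[of e e'] *[of e' e] Box.prems(2) by auto
  then show ?case by simp
next
  case MBot
  show ?case unfolding interp.simps by (rule holds_cong) simp
qed

lemma (in theory_in) PrM_foldr_And:
  "(\<And>p. p \<in> set ps \<Longrightarrow> PrM \<tau> e p) \<Longrightarrow> PrM \<tau> e q \<Longrightarrow> PrM \<tau> e (foldr And ps q)"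
proof (induction ps)
  case (Cons p ps)
  have "PrM \<tau> e p" "PrM \<tau> e (foldr And ps q)" using Cons by simp_all
  then show ?case by (rule PrM_valid2) simp
qed simp

lemma (in theory_in) PrM_ex_falso:
  assumes "PrM \<tau> e (Zero \<^bold>= num 1)"
  shows "PrM \<tau> e p"
proof (rule PrM_valid1[OF assms])
  fix N :: "nat str" and e assume "models N T" and h: "holds N e (Zero \<^bold>= num 1)"
  then interpret N: is1 N using models_ISigma1 by unfold_locales
  show "holds N e p" using h by (simp add: N.nm.simps)
qed

section \<open>The two transfer principles\<close>

context pa_theory_in
begin

text \<open>The isomorphism is used in \<open>M\<close> for the outer formula and again in each
  model of \<open>T\<close> for the formula under the box. Where consistency fails in such a model,
  the two implications hold trivially.\<close>

lemma transfer_box: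
  assumes f: "interpretation_of f" and con: "\<not> PrM \<tau> e0 (Zero \<^bold>= num 1)"
    and d: "holds M e0 (interp \<tau> f (decidable_axioms W))" and bd: "PrM \<tau> e0 (interp \<tau> f (decidable_axioms W))"
  shows "holds M e (interp \<tau> f (mform (Prdot \<tau> (Con \<tau> \<^bold>\<longrightarrow> p)))) \<longleftrightarrow>
    PrM \<tau> e (interp \<tau> f (MImp mcon (mform p)))"
proof -
  have ax: "rax (rel_of M f)" using decidableD(1)[OF f d] holds_rosser_axioms[OF f] by blast
  interpret emb: embedding M "rel_of M f" "JM f" by (rule embedding_JM[OF models_PA[OF model] f ax])
  have "\<forall>i. \<exists>y. JM f y (e i)" using JM_surj[OF f con d] by blast
  then obtain y where y: "\<And>i. JM f (y i) (e i)" by metis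
  let ?q = "interp \<tau> f (MImp mcon (mform p))"
  define n where "n = bound p"
  \<comment> \<open>One environment for both sides: even places hold the numbers \<open>y i\<close>,
    odd places the elements \<open>e i\<close> representing them. The conjunction \<open>?K\<close>
    records this relation for the finitely many variables of \<open>p\<close>.\<close>
  define E where "E i = (if even i then y (i div 2) else e (i div 2))" for i
  have E: "E (2 * i) = y i" "E (Suc (2 * i)) = e i" for i by (simp_all add: E_def)
  let ?p = "subst (\<lambda>i. V (2 * i)) (Con \<tau> \<^bold>\<longrightarrow> p)" and ?q' = "subst (\<lambda>i. V (Suc (2 * i))) ?q"
  let ?J = "\<lambda>i. subst (V (2 * i) ## (\<lambda>_. V (Suc (2 * i)))) (jform f)"
  let ?K = "foldr And (map ?J [0..<n]) (interp \<tau> f (decidable_axioms W))"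
  have "PrM \<tau> E (?J i)" for i
  proof -
    have "PrM \<tau> E (?J i) = PrM \<tau> (y i ## e i ## e) (jform f)"
      by (rule PrM_jform_subst) (simp_all add: E)
    then show ?thesis using PrM_JM[OF f decidableD(3)[OF f d] decidableD(4)[OF f d] y] by simp
  qed
  moreover have "PrM \<tau> E (interp \<tau> f (decidable_axioms W))"
    by (rule PrM_semantic_cong_set[OF bd, of "{}"])
      (auto simp: mfrees_axioms intro!: holds_interp_cong[OF f])
  ultimately have K: "PrM \<tau> E ?K" by (intro PrM_foldr_And) auto
  have *: "holds N E ?p = holds N E ?q'" if N: "models N T" and K: "holds N E ?K" for N :: "nat str" and E
  proof -
    interpret N: pa_theory_in N T \<tau> W using N models_ISigma1 by unfold_locales
    have c: "N.PrM \<tau> e (Zero \<^bold>= num 1) = N.PrM \<tau> E (Zero \<^bold>= num 1)" for e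
      by (rule N.PrM_cong) simp
    have J: "N.JM f (E (2 * i)) (E (Suc (2 * i)))" if "i < n" for i
      using K that unfolding N.holds_foldr_And by (simp add: holds_subst N.holds_jform[OF f])
    have d: "holds N E (interp \<tau> f (decidable_axioms W))"
      using K unfolding N.holds_foldr_And by blast
    show ?thesis
    proof (cases "N.PrM \<tau> E (Zero \<^bold>= num 1)")
      case True
      then have "N.PrM \<tau> e (Zero \<^bold>= num 1)" for e using c by blast
      then show ?thesis by (simp add: holds_subst N.holds_Con)
    next
      case False
      have ax: "rax (rel_of N f)" using N.decidableD(1)[OF f d] holds_rosser_axioms[OF f] by blast
      interpret emb: embedding N "rel_of N f" "N.JM f" by (rule N.embedding_JM[OF models_PA[OF N] f ax])
      have "rholds (rel_of N f) (\<lambda>i. E (Suc (2 * i))) p \<longleftrightarrow> holds N (\<lambda>i. E (2 * i)) p"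
        by (rule emb.rholds_surj[OF N.JM_surj[OF f False d]])
          (use frees_bound[of p] J in \<open>auto simp: n_def\<close>)
      moreover have "\<not> N.PrM \<tau> e (Zero \<^bold>= num 1)" for e using False c by blast
      ultimately show ?thesis by (simp add: holds_subst N.holds_Con holds_mform[OF f])
    qed
  qed
  have "PrM \<tau> E ?p \<longleftrightarrow> PrM \<tau> E ?q'"
    using PrM_valid2[OF K, of ?p ?q'] PrM_valid2[OF K, of ?q' ?p] * by blast
  moreover have "PrM \<tau> E ?p = PrM \<tau> y (Con \<tau> \<^bold>\<longrightarrow> p)" by (rule PrM_subst) (simp add: E)
  moreover have "PrM \<tau> E ?q' = PrM \<tau> e ?q" by (rule PrM_subst) (simp add: E)
  moreover have "holds M e (interp \<tau> f (mform (Prdot \<tau> (Con \<tau> \<^bold>\<longrightarrow> p)))) \<longleftrightarrow> holds M y (Prdot \<tau> (Con \<tau> \<^bold>\<longrightarrow> p))"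
    unfolding holds_mform[OF f] using y by (intro emb.rholds_surj JM_surj[OF f con d])
  ultimately show ?thesis by simp
qed

text \<open>An initial embedding suffices: the witness of inconsistency is mapped to the interpreted
  structure, and the bounded \<open>W\<close> is preserved.\<close>

lemma transfer_inconsistency:
  assumes f: "interpretation_of f" and ax: "rax (rel_of M f)" and inc: "PrM \<tau> e (Zero \<^bold>= num 1)"
  shows "rholds (rel_of M f) e' (\<^bold>\<exists> subst (V 0 ## (\<lambda>_. num (gn (Zero \<^bold>= num 1)))) W)"
proof -
  interpret emb: embedding M "rel_of M f" "JM f" by (rule embedding_JM[OF models_PA[OF model] f ax])
  let ?W = "subst (V 0 ## (\<lambda>_. num (gn (Zero \<^bold>= num 1)))) W"
  have "prvM \<tau> (nm (gn (Zero \<^bold>= num 1)))"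
    using inc unfolding PrM_def by (subst (asm) code_sentence) simp_all
  then obtain s where "holds M (s ## (\<lambda>_. nm (gn (Zero \<^bold>= num 1)))) W" unfolding W_prvM by blast
  then have s: "holds M (s ## (\<lambda>_. \<zero>)) ?W" by (simp add: holds_subst scons_ev)
  obtain s' where s': "JM f s s'" using emb.J_total by blast
  have "frees ?W \<subseteq> {0}" unfolding frees_subst by (auto split: nat.splits)
  then have "rholds (rel_of M f) (s' ## e') ?W = holds M (s ## (\<lambda>_. \<zero>)) ?W"
    using s' by (intro emb.rholds_Delta0 Delta0_subst W_Delta0) auto
  then show ?thesis using s by auto
qed

end

section \<open>The standard interpretation\<close>

lemma (in is1) holds_rosser_axioms_std: "holds M e (interp \<tau> std (rosser_axioms W))"
  using rax_std by (simp add: holds_rosser_axioms[OF interpretation_std])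

text \<open>The interpreted \<open>rosser\<close> has guarded but syntactically unbounded
  quantifiers; this equivalent is \<Delta>0, so that \<open>Delta0_complete\<close> decides
  it.\<close>

definition rosser_bounded :: "fm \<Rightarrow> fm" where
  "rosser_bounded W = (\<^bold>\<exists> (V 0 \<^bold>< lift 1 (V 0) \<^bold>\<and> (at_arg W 2 \<^bold>\<and>
     (\<^bold>\<forall> (V 0 \<^bold>< lift 1 (Succ (V 0)) \<^bold>\<longrightarrow> \<^bold>\<not> at_arg (neg_arg W) 3)))))"

lemma Delta0_rosser_bounded: "Delta0 W \<Longrightarrow> Delta0 (rosser_bounded W)"
  unfolding rosser_bounded_def at_arg_def neg_arg_def
  by (intro Delta0.intros Delta0_subst)

lemma (in is1) holds_rosser_bounded:
  "holds M e (rosser_bounded W) \<longleftrightarrow> holds M e (interp \<tau> std (rosser W 1 0))"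
proof -
  have a: "holds M e (at_arg W i) = holds M (e 0 ## (\<lambda>_. e i)) W" for e W i
    using rholds_at_arg[of "rel_of M std" e W i] by (simp add: rholds_std)
  have "holds M e (rosser_bounded W) \<longleftrightarrow> (\<exists>s. s \<prec> e 0 \<and> holds M (s ## (\<lambda>_. e 1)) W \<and>
      (\<forall>s'. s' \<prec> s \<or> s' = s \<longrightarrow> \<not> holds M (s' ## (\<lambda>_. e 1)) (neg_arg W)))"
    unfolding rosser_bounded_def by (simp add: a) blast
  also have "\<dots> \<longleftrightarrow> holds M e (interp \<tau> std (rosser W 1 0))"
    unfolding holds_rosser[OF interpretation_std] ros_def rholds_std rel_of_simps prd_std disj_imp ..
  finally show ?thesis .
qed

lemma (in theory_in) holds_decidable_axioms_std:
  assumes W: "Delta0 W"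
  shows "holds M e (interp \<tau> std (decidable_axioms W))"
proof -
  note f = interpretation_std
  have Z: "PrM \<tau> (x ## e) (interp \<tau> std (pZ 0))" if "x = \<zero>" for x
  proof -
    have "Delta0 (interp \<tau> std (pZ 0))" by (simp add: interp.simps(1) std_def Delta0.intros)
    then show ?thesis using Delta0_complete that by (simp add: holds_MPred[OF f])
  qed
  have S: "PrM \<tau> (y ## x ## e) (interp \<tau> std (pS 1 0))" if "sc x = y" for x y
  proof -
    have "Delta0 (interp \<tau> std (pS 1 0))" by (simp add: interp.simps(1) std_def Delta0.intros numeral_2_eq_2)
    then show ?thesis using Delta0_complete that by (simp add: holds_MPred[OF f])
  qed
  let ?R = "interp \<tau> std (rosser W 1 0)"
  have N: "holds N e (rosser_bounded W) = holds N e ?R" if "models N T" for N :: "nat str" and e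
  proof -
    interpret N: is1 N using that models_ISigma1 by unfold_locales
    show ?thesis by (rule N.holds_rosser_bounded)
  qed
  have R: "PrM \<tau> e ?R" if "holds M e ?R" for e
    using Delta0_complete[OF Delta0_rosser_bounded[OF W], of e] that holds_rosser_bounded
    by (auto intro: PrM_valid1[of e "rosser_bounded W"] simp: N)
  have R': "PrM \<tau> e (\<^bold>\<not> ?R)" if "\<not> holds M e ?R" for e
    using Delta0_complete[OF Delta0_rosser_bounded[OF W], of e] that holds_rosser_bounded
    by (auto intro: PrM_valid1[of e "\<^bold>\<not> rosser_bounded W"] simp: N)
  have A: "PrM \<tau> e (interp \<tau> std (rosser_axioms W))"
  proof (rule PrM_valid)
    fix N :: "nat str" and e assume "models N T"
    then interpret N: is1 N using models_ISigma1 by unfold_locales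
    show "holds N e (interp \<tau> std (rosser_axioms W))" by (rule N.holds_rosser_axioms_std)
  qed
  show ?thesis
    unfolding decidable_axioms_def holds_MAnd
    using holds_rosser_axioms_std A Z S R R' by (simp add: holds_MPred[OF f])
qed

lemma sentence_axioms: "p \<in> PA \<Longrightarrow> sentence p" "p \<in> ISigma1 \<Longrightarrow> sentence p"
  by (auto simp: PA_def ISigma1_def basic_axioms_def ind_axiom_def sentence_closure)

theorem theorem3p7:
  fixes T0 T1 :: "fm set" and \<tau>0 \<tau>1 :: fm
  assumes "re_theory T0" and "Th ISigma1 \<subseteq> Th T0"
    and "re_theory T1" and "Th ISigma1 \<subseteq> Th T1"
    and "Sigma1 \<tau>0" and "defines_theory \<tau>0 T0"
    and "Sigma1 \<tau>1" and "defines_theory \<tau>1 T1"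
    and "Th PA \<subseteq> Th T0"
    and "QPL \<tau>0 T0 \<subseteq> QPL \<tau>1 T1"
  shows "\<forall>\<phi> :: fm. T1 \<turnstile> closure
    (Prdot \<tau>0 (Con \<tau>0 \<^bold>\<longrightarrow> \<phi>) \<^bold>\<longleftrightarrow> Prdot \<tau>1 (Con \<tau>1 \<^bold>\<longrightarrow> \<phi>))"
proof
  fix \<phi>
  have Th: "T \<turnstile> p" if "Th S \<subseteq> Th T" "p \<in> S" "sentence p" for S T p
    using that proves.Ax[of p S] by (auto simp: Th_def)
  interpret T0: arith_theory T0 \<tau>0
    by unfold_locales (use assms Th sentence_axioms in \<open>auto simp: re_theory_def\<close>)
  interpret T1: arith_theory T1 \<tau>1
    by unfold_locales (use assms Th sentence_axioms in \<open>auto simp: re_theory_def\<close>)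
  obtain W where W: "Delta0 W" "\<And>(M :: nat str) e. models M ISigma1 \<Longrightarrow>
      holds M e (Pr \<tau>0 (V 0)) \<longleftrightarrow> (\<exists>s. holds M (s ## e) W)"
    using Sg_normal_form[OF Sg_Pr[OF assms(5)], of "V 0", where 'm = nat] by blast
  interpret P0: pa_theory T0 \<tau>0 W
    by unfold_locales (use assms(9) Th sentence_axioms W in auto)
  let ?\<psi> = "Prdot \<tau>0 (Con \<tau>0 \<^bold>\<longrightarrow> \<phi>)" and ?D = "decidable_axioms W"
  define B where "B = MIff (mform ?\<psi>) (Box (MImp mcon (mform \<phi>)))"
  have holds_B: "holds M e (interp \<tau> f B) \<longleftrightarrow>
      (holds M e (interp \<tau> f (mform ?\<psi>)) \<longleftrightarrow> holds M e (Prdot \<tau> (interp \<tau> f (MImp mcon (mform \<phi>)))))"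
    for M :: "nat str" and e \<tau> f
    unfolding B_def by auto
  \<comment> \<open>\<open>QPL\<close> contains sentences only; the quantifier prefix is removed
    again by \<open>all_env_Forall\<close>.\<close>
  obtain n where "mfrees B \<subseteq> {..<n}"
    using finite_mfrees[of B] finite_nat_iff_bounded by blast
  then have n: "mfrees ((MAll ^^ n) B) = {}" unfolding mfrees_MAll_iter by auto
  \<comment> \<open>\<open>Box ?D\<close> carries the hypotheses into the models considered under
    the box in \<open>B\<close>.\<close>
  let ?A = "MImp (MAnd mcon (MAnd ?D (Box ?D))) ((MAll ^^ n) B)"
  \<comment> \<open>Inconsistency of \<open>T0\<close> as an existential quantifier before a bounded
    formula, the form that initial embeddings preserve.\<close>
  define \<chi> where "\<chi> = (\<^bold>\<exists> subst (V 0 ## (\<lambda>_. num (gn (Zero \<^bold>= num 1)))) W)"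
  let ?A' = "MImp (MAnd (rosser_axioms W) (Box MBot)) (mform \<chi>)"
  have "?A \<in> QPL \<tau>0 T0"
    unfolding QPL_def
  proof (intro CollectI conjI allI impI)
    show "mfrees ?A = {}" by (simp add: n mfrees_axioms)
    fix f assume f: "interpretation_of f"
    show "T0 \<turnstile> interp \<tau>0 f ?A"
    proof (rule T0.complete)
      fix M :: "nat str" and e assume M: "models M T0"
      interpret M: pa_theory_in M T0 \<tau>0 W using M T0.models_ISigma1 by unfold_locales
      have "holds M e ((Forall ^^ n) (interp \<tau>0 f B))"
        if "\<not> M.PrM \<tau>0 e (Zero \<^bold>= num 1)" "holds M e (interp \<tau>0 f ?D)" "M.PrM \<tau>0 e (interp \<tau>0 f ?D)"
      proof -
        have "\<forall>e. holds M e (interp \<tau>0 f B)"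
          unfolding holds_B using M.transfer_box[OF f that, of _ \<phi>] by simp
        then show ?thesis using all_env_Forall by blast
      qed
      then show "holds M e (interp \<tau>0 f ?A)" by (simp add: interp_MAll_iter)
    qed
  qed
  then have A: "T1 \<turnstile> interp \<tau>1 std ?A"
    using assms(10) interpretation_std unfolding QPL_def by blast
  have "?A' \<in> QPL \<tau>0 T0"
    unfolding QPL_def
  proof (intro CollectI conjI allI impI)
    have "frees \<chi> = {}" by (auto simp: \<chi>_def frees_subst split: nat.splits)
    then show "mfrees ?A' = {}"
      using mfrees_mform[of \<chi>] by (simp add: mfrees_axioms)
    fix f assume f: "interpretation_of f"
    show "T0 \<turnstile> interp \<tau>0 f ?A'"
    proof (rule T0.complete)
      fix M :: "nat str" and e assume M: "models M T0"
      interpret M: pa_theory_in M T0 \<tau>0 W using M T0.models_ISigma1 by unfold_locales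
      show "holds M e (interp \<tau>0 f ?A')"
        using M.transfer_inconsistency[OF f, of e e, folded \<chi>_def]
        by (simp add: holds_mform[OF f] holds_rosser_axioms[OF f])
    qed
  qed
  then have A': "T1 \<turnstile> interp \<tau>1 std ?A'"
    using assms(10) interpretation_std unfolding QPL_def by blast
  show "T1 \<turnstile> closure (?\<psi> \<^bold>\<longleftrightarrow> Prdot \<tau>1 (Con \<tau>1 \<^bold>\<longrightarrow> \<phi>))"
  proof (rule T1.complete)
    \<comment> \<open>\<open>M\<close> need not satisfy \<open>T0\<close>, which enters only through
      its arithmetised provability.\<close>
    fix M :: "nat str" and e assume M: "models M T1"
    interpret M0: theory_in M T0 \<tau>0 using M T1.models_ISigma1 by unfold_locales
    interpret M1: theory_in M T1 \<tau>1 using M T1.models_ISigma1 by unfold_locales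
    have "M0.PrM \<tau>0 e (Con \<tau>0 \<^bold>\<longrightarrow> \<phi>) \<longleftrightarrow> M0.PrM \<tau>1 e (Con \<tau>1 \<^bold>\<longrightarrow> \<phi>)" for e
    proof (cases "M0.PrM \<tau>1 e (Zero \<^bold>= num 1)")
      case True
      have "holds M e \<chi>"
        using soundness[OF A' M, of e] True
        by (simp add: M0.holds_rosser_axioms_std M0.holds_mform_std)
      then have "\<exists>s. holds M (s ## (\<lambda>_. M0.nm (gn (Zero \<^bold>= num 1)))) W"
        by (simp add: \<chi>_def holds_subst scons_ev del: gn.simps)
      then have "M0.prvM \<tau>0 (M0.nm (gn (Zero \<^bold>= num 1)))"
        using W(2)[OF M0.models, of "\<lambda>_. M0.nm (gn (Zero \<^bold>= num 1))"] by (simp del: gn.simps)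
      then have "M0.PrM \<tau>0 e (Zero \<^bold>= num 1)"
        unfolding M0.PrM_def by (subst M0.code_sentence) simp_all
      then show ?thesis using True M0.PrM_ex_falso M1.PrM_ex_falso by blast
    next
      case False
      have D: "holds M e' (interp \<tau>1 std ?D)" "M0.PrM \<tau>1 e' (interp \<tau>1 std ?D)" for e'
      proof -
        show "holds M e' (interp \<tau>1 std ?D)" by (rule M1.holds_decidable_axioms_std[OF W(1)])
        show "M0.PrM \<tau>1 e' (interp \<tau>1 std ?D)"
        proof (rule M1.PrM_valid)
          fix N :: "nat str" and e assume "models N T1"
          then interpret N: theory_in N T1 \<tau>1 using T1.models_ISigma1 by unfold_locales
          show "holds N e (interp \<tau>1 std ?D)" by (rule N.holds_decidable_axioms_std[OF W(1)])
        qed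
      qed
      have "M0.PrM \<tau>1 e' (Zero \<^bold>= num 1) = M0.PrM \<tau>1 e (Zero \<^bold>= num 1)" for e'
        by (rule M0.PrM_cong) simp
      then have "holds M e' ((Forall ^^ n) (interp \<tau>1 std B))" for e'
        using soundness[OF A M, of e'] False D by (simp add: interp_MAll_iter)
      then have "holds M e (interp \<tau>1 std B)" using all_env_Forall by blast
      then have "M0.PrM \<tau>0 e (Con \<tau>0 \<^bold>\<longrightarrow> \<phi>) \<longleftrightarrow> M0.PrM \<tau>1 e (interp \<tau>1 std (MImp mcon (mform \<phi>)))"
        unfolding holds_B by (simp add: M0.holds_mform_std)
      also have "\<dots> \<longleftrightarrow> M0.PrM \<tau>1 e (Con \<tau>1 \<^bold>\<longrightarrow> \<phi>)"
      proof -
        have "holds N e (interp \<tau>1 std (MImp mcon (mform \<phi>))) = holds N e (Con \<tau>1 \<^bold>\<longrightarrow> \<phi>)"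
          if "models N T1" for N :: "nat str" and e
        proof -
          interpret N: theory_in N T1 \<tau>1 using that T1.models_ISigma1 by unfold_locales
          show ?thesis by (simp add: N.holds_Con N.holds_mform_std)
        qed
        then show ?thesis using M1.PrM_valid1 by blast
      qed
      finally show ?thesis .
    qed
    then have "\<forall>e. holds M e (?\<psi> \<^bold>\<longleftrightarrow> Prdot \<tau>1 (Con \<tau>1 \<^bold>\<longrightarrow> \<phi>))" by simp
    then show "holds M e (closure (?\<psi> \<^bold>\<longleftrightarrow> Prdot \<tau>1 (Con \<tau>1 \<^bold>\<longrightarrow> \<phi>)))"
      using all_env_closure by blast
  qed
qed

end
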